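(* Let $0<\rho<1$, and let $\alpha_1\ge\alpha_2\ge\cdots>0$ be real numbers satisfying $$\frac{\alpha_{\ell+1}}{\alpha_\ell}\ge\rho,\qquad \ell=1,2,\ldots$$ Let $C(\mathrm{SNR})$ be the capacity of the associated noncoherent interference channel $Y_k=H_kX_k+\sum_{\ell=1}^\infty H_{\ell,k}X_{\ell,k}+Z_k$, as defined in the context. Then the capacity is bounded in the SNR, i.e., $$\sup_{\mathrm{SNR}>0}C(\mathrm{SNR})<\infty .$$
   Context: Notation: $A_1^n=(A_1,\ldots,A_n)$; $\mathcal N_{\mathbb C}(0,v)$ is the circularly-symmetric complex Gaussian law of mean $0$ and variance $v$; logarithms are natural, so mutual information $I(\cdot;\cdot)$ is in nats. Channel model: for $k\in\mathbb Z$, the complex-valued output is $$Y_k=H_kX_k+\sum_{\ell=1}^{\infty}H_{\ell,k}X_{\ell,k}+Z_k ,$$ where $X_k$ is the input of the transmitter and $X_{\ell,k}$ is the symbol of the $\ell$-th interferer. The sequences $\{Z_k\}_k$, $\{H_k\}_k$ and $\{H_{\ell,k}\}_k$, $\ell=1,2,\ldots$, are each i.i.d. in $k$ and are independent of each other, with $Z_k\sim\mathcal N_{\mathbb C}(0,\sigma^2)$ ($\sigma^2>0$), $H_k\sim\mathcal N_{\mathbb C}(0,1)$ and $H_{\ell,k}\sim\mathcal N_{\mathbb C}(0,\alpha_\ell)$. The fading and noise are independent of all the symbols $X_k, X_{\ell,k}$. The infinite sum is assumed to converge almost surely, so that $Y_k$ is a well-defined complex random variable. The nodes do not cooperate and use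 the same distribution: for block length $n$ and a probability distribution $Q^n$ on $\mathbb C^n$, the vectors $X_1^n=(X_1,\ldots,X_n)$ and $X_{\ell,1}^n=(X_{\ell,1},\ldots,X_{\ell,n})$, $\ell=1,2,\ldots$, are independent of each other and each has distribution $Q^n$ (the components within a vector need not be i.i.d.). Capacity: for $\mathsf P>0$ and $\mathrm{SNR}=\mathsf P/\sigma^2$, $$C(\mathrm{SNR})=\limsup_{n\to\infty}\frac1n\sup_{Q^n}I(X_1^n;Y_1^n),$$ where the supremum is over all probability distributions $Q^n$ on $\mathbb C^n$ satisfying $\int\frac1n\sum_{k=1}^n|x_k|^2\,dQ^n(x_1^n)\le\mathsf P$. Only the transmitter's vector $X_1^n$ appears in the mutual information; the interferers' symbols, fading and noise are unobserved. *)

theory Defs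
  imports "HOL-Probability.Probability"
begin

text \<open>The circularly-symmetric complex Gaussian law with mean 0 and variance \<open>v > 0\<close>; note that
  \<open>v\<close> is \<open>E |Z|^2\<close>, so real and imaginary part have variance \<open>v / 2\<close> each.\<close>

definition complex_gaussian :: "real \<Rightarrow> complex measure" where
  "complex_gaussian v = density lborel (\<lambda>z. ennreal (exp (- (cmod z)\<^sup>2 / v) / (pi * v)))"

text \<open>\<^const>\<open>prob_space.mutual_information\<close> is defined through the Bochner integral and returns junk
  when the joint law is not absolutely continuous with respect to the product of the marginals, or
  when the log-density is not integrable. In both cases the mutual information is infinite (the
  negative part of the log-density is always integrable under the joint law).\<close>

definition mutual_info_nats ::
  "'a measure \<Rightarrow> 'b measure \<Rightarrow> 'c measure \<Rightarrow> ('a \<Rightarrow> 'b) \<Rightarrow> ('a \<Rightarrow> 'c) \<Rightarrow> ereal" where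
  "mutual_info_nats M S T X Y =
    (let P = distr M S X \<Otimes>\<^sub>M distr M T Y; J = distr M (S \<Otimes>\<^sub>M T) (\<lambda>\<omega>. (X \<omega>, Y \<omega>)) in
     if absolutely_continuous P J \<and> integrable J (entropy_density (exp 1) P J)
     then ereal (prob_space.mutual_information M (exp 1) S T X Y) else \<infinity>)"

text \<open>Blocks of length \<open>n\<close> are functions on the time indices \<open>{1..n}\<close>.\<close>

abbreviation block_space :: "nat \<Rightarrow> (nat \<Rightarrow> complex) measure" where
  "block_space n \<equiv> (\<Pi>\<^sub>M k\<in>{1..n}. borel)"

definition input_laws :: "nat \<Rightarrow> real \<Rightarrow> (nat \<Rightarrow> complex) measure set" where
  "input_laws n P = {Q. prob_space Q \<and> sets Q = sets (block_space n) \<and>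
     (\<integral>\<^sup>+ x. ennreal (1 / real n * (\<Sum>k=1..n. (cmod (x k))\<^sup>2)) \<partial>Q) \<le> ennreal P}"

text \<open>The mutual information depends only on the joint law of all the random variables, so the
  channel is realised on a product space with points \<open>(x, xi, h, hi, z)\<close>: the transmitted block, the
  interferers' blocks \<open>xi l\<close>, the fading \<open>h\<close>, the interferers' fading \<open>hi l\<close>, and the noise.
  Interferers are numbered from 0, so \<open>\<alpha> l\<close> is the variance usually written with index \<open>l + 1\<close>.\<close>

type_synonym sample = "(nat \<Rightarrow> complex) \<times> (nat \<Rightarrow> nat \<Rightarrow> complex) \<times> (nat \<Rightarrow> complex) \<times>
  (nat \<Rightarrow> nat \<Rightarrow> complex) \<times> (nat \<Rightarrow> complex)"

definition channel_space ::
  "(nat \<Rightarrow> real) \<Rightarrow> real \<Rightarrow> nat \<Rightarrow> (nat \<Rightarrow> complex) measure \<Rightarrow> sample measure" where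
  "channel_space \<alpha> \<sigma>2 n Q =
    Q \<Otimes>\<^sub>M (\<Pi>\<^sub>M l\<in>UNIV. Q) \<Otimes>\<^sub>M
    (\<Pi>\<^sub>M k\<in>{1..n}. complex_gaussian 1) \<Otimes>\<^sub>M
    (\<Pi>\<^sub>M l\<in>UNIV. \<Pi>\<^sub>M k\<in>{1..n}. complex_gaussian (\<alpha> l)) \<Otimes>\<^sub>M
    (\<Pi>\<^sub>M k\<in>{1..n}. complex_gaussian \<sigma>2)"

fun channel_input :: "sample \<Rightarrow> nat \<Rightarrow> complex" where
  "channel_input (x, xi, h, hi, z) = x"

fun interference_terms :: "sample \<Rightarrow> nat \<Rightarrow> nat \<Rightarrow> complex" where
  "interference_terms (x, xi, h, hi, z) k = (\<lambda>l. hi l k * xi l k)"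

fun channel_output :: "nat \<Rightarrow> sample \<Rightarrow> nat \<Rightarrow> complex" where
  "channel_output n (x, xi, h, hi, z) =
    (\<lambda>k\<in>{1..n}. h k * x k + (\<Sum>l. interference_terms (x, xi, h, hi, z) k l) + z k)"

text \<open>Almost sure convergence (of the partial sums) for every input law of finite power.\<close>

definition interference_converges :: "(nat \<Rightarrow> real) \<Rightarrow> real \<Rightarrow> bool" where
  "interference_converges \<alpha> \<sigma>2 \<longleftrightarrow>
    (\<forall>n P. P > 0 \<longrightarrow> (\<forall>Q\<in>input_laws n P.
      AE \<omega> in channel_space \<alpha> \<sigma>2 n Q. \<forall>k\<in>{1..n}. summable (interference_terms \<omega> k)))"

definition block_information ::
  "(nat \<Rightarrow> real) \<Rightarrow> real \<Rightarrow> nat \<Rightarrow> (nat \<Rightarrow> complex) measure \<Rightarrow> ereal" where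
  "block_information \<alpha> \<sigma>2 n Q =
    mutual_info_nats (channel_space \<alpha> \<sigma>2 n Q) (block_space n) (block_space n)
      channel_input (channel_output n)"

definition capacity :: "(nat \<Rightarrow> real) \<Rightarrow> real \<Rightarrow> real \<Rightarrow> ereal" where
  "capacity \<alpha> \<sigma>2 snr =
    limsup (\<lambda>n. ereal (1 / real n) *
      (SUP Q\<in>input_laws n (snr * \<sigma>2). block_information \<alpha> \<sigma>2 n Q))"

end

theory Submission
  imports Defs
begin

text \<open>
  Given the transmitted block \<open>x\<close> and the interferers' symbols \<open>\<xi>\<close>, the output is Gaussian with
  variances \<open>V = T \<xi> + |x|\<^sup>2\<close>, where \<open>T\<close> is the variance of interference plus noise. Write \<open>g\<close> for
  the density of interference plus noise \<open>W\<close>. Three facts bound \<open>I(X;Y) = h(Y) - h(Y|X)\<close> by a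
  constant multiple of \<open>n\<close>; the first and the third are instances of
  \<open>E ln R \<le> E R - 1 \<le> 0\<close>.
  First, \<open>Y\<close> is \<open>W\<close> plus an independent term, so \<open>h(Y|X) \<ge> h(W)\<close>.
  Second, since all users have the same law, shifting the transmitter into the sequence of
  interferers gives a \<open>T'\<close> distributed as \<open>T\<close>, and \<open>\<rho> \<le> \<alpha>\<^sub>l\<^sub>+\<^sub>1 / \<alpha>\<^sub>l \<le> 1\<close> makes
  \<open>T'\<close> comparable to \<open>V\<close> up to constants; hence \<open>-E ln p(Y)\<close> is at most
  \<open>-E ln g(sqrt K W) + O(n)\<close> for the output density \<open>p\<close>, with a constant \<open>K\<close>.
  Third, by data processing from the pair of \<open>T\<close> and \<open>W\<close>,
  \<open>-E ln g(sqrt K W) \<le> h(W) + O(n)\<close>.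
\<close>

section \<open>Complex Gaussian densities\<close>

text \<open>The symbols of a block may be arbitrarily dependent, so neither \<open>h(Y)\<close> nor
  \<open>h(W)\<close> can be computed. Everything is compared with the one unknown density
  \<open>g\<close>, whose entropy cancels at the end without being evaluated. The scaling by
  \<open>sqrt K\<close> arises because two Gaussians with comparable variances are comparable
  pointwise only after the argument of one is stretched. Its price is measured on
  \<open>W / sqrt T\<close>, which is a standard Gaussian block whatever \<open>T\<close> is; hence
  the price is linear in \<open>n\<close> and does not see the variances. The comparison factors
  depend only on \<rho> and on the first interferer's fading variance, while power and noise level
  enter only through finiteness and positivity, so the bound is uniform in the SNR. Two preparations
  make the argument rigorous. The fading variances are shown to be summable, from almost sure
  convergence for one constant input, so that \<open>T\<close> has finite mean. Densities are
  bounded above, and bounded below by Gaussian shapes, so that second moments make all log-densities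
  integrable and every entropy is finite.\<close>

definition phi :: "real \<Rightarrow> complex \<Rightarrow> real" where
  "phi v z = exp (- (cmod z)\<^sup>2 / v) / (pi * v)"

lemma phi_measurable [measurable (raw)]:
  assumes [measurable]: "v \<in> borel_measurable M" "y \<in> borel_measurable M"
  shows "(\<lambda>x. phi (v x) (y x)) \<in> borel_measurable M"
  unfolding phi_def by measurable

lemma phi_pos: "v > 0 \<Longrightarrow> phi v z > 0"
  by (simp add: phi_def)

lemma complex_gaussian_eq: "complex_gaussian v = density lborel (\<lambda>z. ennreal (phi v z))"
  by (simp add: complex_gaussian_def phi_def)

text \<open>A complex box is a rectangle in real and imaginary part, and boxes determine Lebesgue
  measure. This reduces integrals over the plane to iterated real ones.\<close>

lemma lborel_complex_eq:
  "(lborel :: complex measure) = distr (lborel \<Otimes>\<^sub>M lborel) borel (\<lambda>(x, y). Complex x y)"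
proof (rule lborel_eqI)
  have [measurable]: "(\<lambda>(x, y). Complex x y) \<in> borel_measurable (lborel \<Otimes>\<^sub>M lborel)"
    unfolding Complex_eq by measurable
  fix l u :: complex assume le: "\<And>b. b \<in> Basis \<Longrightarrow> l \<bullet> b \<le> u \<bullet> b"
  have le': "Re l \<le> Re u" "Im l \<le> Im u" using le[of 1] le[of \<i>] by (auto simp: Basis_complex_def)
  have "(\<lambda>(x, y). Complex x y) -` box l u \<inter> space (lborel \<Otimes>\<^sub>M lborel) = {Re l<..<Re u} \<times> {Im l<..<Im u}"
    by (auto simp: box_def Basis_complex_def space_pair_measure)
  then show "emeasure (distr (lborel \<Otimes>\<^sub>M lborel) borel (\<lambda>(x, y). Complex x y)) (box l u) =
     ennreal (\<Prod>b\<in>Basis. (u - l) \<bullet> b)"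
    using le' by (simp add: emeasure_distr lborel.emeasure_pair_measure_Times Basis_complex_def ennreal_mult)
qed simp

text \<open>In Cartesian coordinates \<open>phi v\<close> is a product of two normal densities of
  variance \<open>v / 2\<close>, each of mass one.\<close>

lemma nn_integral_phi:
  assumes "v > 0"
  shows "(\<integral>\<^sup>+ z. ennreal (phi v z) \<partial>lborel) = 1"
proof -
  define s where "s = sqrt (v / 2)"
  have s: "s > 0" "s\<^sup>2 = v / 2" using assms by (auto simp: s_def)
  have [measurable]: "(\<lambda>(x, y). Complex x y) \<in> borel_measurable (lborel \<Otimes>\<^sub>M lborel)"
    unfolding Complex_eq by measurable
  have *: "phi v (Complex x y) = normal_density 0 s x * normal_density 0 s y" for x y
    using assms by (simp add: phi_def normal_density_def s cmod_power2 exp_add[symmetric] add_divide_distrib real_sqrt_mult[symmetric] field_simps)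
  have "(\<integral>\<^sup>+ z. ennreal (phi v z) \<partial>lborel) = (\<integral>\<^sup>+ x. \<integral>\<^sup>+ y. ennreal (normal_density 0 s x) * ennreal (normal_density 0 s y) \<partial>lborel \<partial>lborel)"
    apply (subst lborel_complex_eq)
    apply (subst nn_integral_distr)
    apply measurable
    apply (subst lborel.nn_integral_fst[symmetric])
     apply (auto simp: * ennreal_mult')
    done
  also have "\<dots> = 1"
  proof -
    have "(\<integral>\<^sup>+ x. ennreal (normal_density 0 s x) \<partial>lborel) = 1"
      using prob_space.emeasure_space_1[OF prob_space_normal_density[OF s(1), of 0]]
      by (simp add: emeasure_density)
    then show ?thesis by (simp add: nn_integral_cmult nn_integral_multc)
  qed
  finally show ?thesis .
qed

lemma prob_space_complex_gaussian:
  assumes "v > 0" shows "prob_space (complex_gaussian v)"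
  by (rule prob_spaceI) (simp add: complex_gaussian_eq emeasure_density nn_integral_phi assms)

lemma sets_complex_gaussian [measurable_cong, simp]: "sets (complex_gaussian v) = sets borel"
  by (simp add: complex_gaussian_eq)

lemma space_complex_gaussian [simp]: "space (complex_gaussian v) = UNIV"
  by (simp add: complex_gaussian_eq)

lemma nn_integral_complex_gaussian:
  assumes [measurable]: "f \<in> borel_measurable borel"
  shows "(\<integral>\<^sup>+ z. f z \<partial>complex_gaussian v) = (\<integral>\<^sup>+ z. ennreal (phi v z) * f z \<partial>lborel)"
  by (simp add: complex_gaussian_eq nn_integral_density)

lemma nn_integral_phi_translate:
  assumes "v > 0"
  shows "(\<integral>\<^sup>+ z. ennreal (phi v (z + c)) \<partial>lborel) = 1"
proof -
  have "(\<integral>\<^sup>+ z. ennreal (phi v z) \<partial>lborel) = (\<integral>\<^sup>+ z. ennreal (phi v z) \<partial>distr lborel borel ((+) c))"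
    by (simp add: lborel_distr_plus)
  also have "\<dots> = (\<integral>\<^sup>+ z. ennreal (phi v (c + z)) \<partial>lborel)"
    by (rule nn_integral_distr) auto
  finally show ?thesis by (simp add: nn_integral_phi assms add.commute)
qed

text \<open>Completing the square.\<close>
lemma phi_mult_phi:
  fixes a x y :: complex
  assumes v: "v > 0" and w: "w > 0"
  defines "s \<equiv> w + (cmod a)\<^sup>2 * v"
  shows "phi v x * phi w (y - x * a) = phi s y * phi (v * w / s) (x + - (of_real (v / s) * cnj a * y))"
proof -
  have s: "s > 0" using v w unfolding s_def by (intro add_pos_nonneg) auto
  obtain a1 a2 where a: "a = Complex a1 a2" by (cases a)
  obtain x1 x2 where x: "x = Complex x1 x2" by (cases x)
  obtain y1 y2 where y: "y = Complex y1 y2" by (cases y)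
  \<comment> \<open>With \<open>v = t * s\<close> the identity \<open>sq\<close> contains no
    division and is polynomial modulo the relation \<open>st\<close>, which \<open>algebra\<close>
    can settle.\<close>
  define t where "t = v / s"
  have vt: "v = t * s" using s by (simp add: t_def)
  have tpos: "t > 0" using v s by (simp add: t_def)
  have sq: "(cmod x)\<^sup>2 * w + (cmod (y - x * a))\<^sup>2 * v = (cmod y)\<^sup>2 * (t * w) + (cmod (x + - (of_real t * cnj a * y)))\<^sup>2 * s"
  proof -
    have n1: "(cmod (y - x * a))\<^sup>2 = (cmod y)\<^sup>2 + (cmod x)\<^sup>2 * (cmod a)\<^sup>2 - 2 * Re (cnj y * x * a)"
      unfolding a x y cmod_power2 by simp algebra
    have n2: "(cmod (x + - (of_real t * cnj a * y)))\<^sup>2 = (cmod x)\<^sup>2 + t\<^sup>2 * (cmod a)\<^sup>2 * (cmod y)\<^sup>2 - 2 * t * Re (cnj y * x * a)"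
      unfolding a x y cmod_power2 by simp algebra
    have st: "s = w + (cmod a)\<^sup>2 * (t * s)" using vt by (simp add: s_def)
    show ?thesis unfolding n1 n2 vt using st by algebra
  qed
  have "(cmod x)\<^sup>2 / v + (cmod (y - x * a))\<^sup>2 / w = ((cmod x)\<^sup>2 * w + (cmod (y - x * a))\<^sup>2 * v) / (v * w)"
    using v w by (simp add: field_simps)
  also have "\<dots> = (cmod y)\<^sup>2 / s + (cmod (x + - (of_real t * cnj a * y)))\<^sup>2 / (v * w / s)"
    unfolding sq using v w s tpos by (simp add: field_simps vt)
  finally have e: "- (cmod x)\<^sup>2 / v + - (cmod (y - x * a))\<^sup>2 / w = - (cmod y)\<^sup>2 / s + - (cmod (x + - (of_real t * cnj a * y)))\<^sup>2 / (v * w / s)"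
    by simp
  have "phi v x * phi w (y - x * a) = exp (- (cmod x)\<^sup>2 / v + - (cmod (y - x * a))\<^sup>2 / w) / (pi * v * (pi * w))"
    unfolding exp_add by (simp add: phi_def)
  also have "\<dots> = phi s y * phi (v * w / s) (x + - (of_real t * cnj a * y))"
    unfolding e exp_add using s by (simp add: phi_def)
  finally show ?thesis unfolding t_def .
qed

text \<open>Read \<open>x\<close> as a fading coefficient and \<open>y\<close> as the noisy
  observation of \<open>x * a\<close>. Then \<open>phi_mult_phi\<close> rewrites prior times
  likelihood as the marginal density of \<open>y\<close> times the posterior of \<open>x\<close>, a
  translated Gaussian density of mass one.\<close>

lemma nn_integral_phi_convolution:
  fixes a y :: complex
  assumes v: "v > 0" and w: "w > 0"
  shows "(\<integral>\<^sup>+ x. ennreal (phi w (y - x * a)) \<partial>complex_gaussian v) = ennreal (phi (w + (cmod a)\<^sup>2 * v) y)"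
proof -
  define s where "s = w + (cmod a)\<^sup>2 * v"
  have s: "s > 0" using v w unfolding s_def by (intro add_pos_nonneg) auto
  have "(\<integral>\<^sup>+ x. ennreal (phi w (y - x * a)) \<partial>complex_gaussian v) = (\<integral>\<^sup>+ x. ennreal (phi v x * phi w (y - x * a)) \<partial>lborel)"
    using v w by (subst nn_integral_complex_gaussian) (auto simp: ennreal_mult'' phi_pos less_imp_le)
  also have "\<dots> = (\<integral>\<^sup>+ x. ennreal (phi s y) * ennreal (phi (v * w / s) (x + - (of_real (v / s) * cnj a * y))) \<partial>lborel)"
    unfolding phi_mult_phi[OF v w] s_def[symmetric]
    using s by (simp add: ennreal_mult' phi_pos less_imp_le)
  also have "\<dots> = ennreal (phi s y)"
    using s v w by (subst nn_integral_cmult) (auto simp: nn_integral_phi_translate simp del: add_uminus_conv_diff)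
  finally show ?thesis unfolding s_def .
qed

text \<open>The inequality \<open>u / 2 \<le> exp (u / 2)\<close> trades the factor
  \<open>(cmod z)\<^sup>2\<close> for a doubled variance. The exact moment is 1; a crude value
  suffices, as it only enters the final constant.\<close>

lemma nn_integral_sq_complex_gaussian:
  "(\<integral>\<^sup>+ z. ennreal ((cmod z)\<^sup>2) \<partial>complex_gaussian 1) \<le> 4"
proof -
  have "phi 1 z * (cmod z)\<^sup>2 \<le> 4 * phi 2 z" for z
  proof -
    have "(cmod z)\<^sup>2 / 2 \<le> exp ((cmod z)\<^sup>2 / 2)" using exp_ge_add_one_self[of "(cmod z)\<^sup>2 / 2"] by linarith
    then have "exp (- (cmod z)\<^sup>2) * ((cmod z)\<^sup>2 / 2) \<le> exp (- (cmod z)\<^sup>2) * exp ((cmod z)\<^sup>2 / 2)"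
      by (intro mult_left_mono) auto
    also have "\<dots> = exp (- (cmod z)\<^sup>2 / 2)" unfolding exp_add[symmetric] by (simp add: field_simps)
    finally show ?thesis by (simp add: phi_def field_simps)
  qed
  then have "(\<integral>\<^sup>+ z. ennreal ((cmod z)\<^sup>2) \<partial>complex_gaussian 1) \<le> (\<integral>\<^sup>+ z. ennreal 4 * ennreal (phi 2 z) \<partial>lborel)"
    by (subst nn_integral_complex_gaussian)
       (auto simp: ennreal_mult''[symmetric] phi_pos less_imp_le intro!: nn_integral_mono simp flip: ennreal_numeral)
  also have "\<dots> = 4" by (subst nn_integral_cmult) (auto simp: nn_integral_phi)
  finally show ?thesis .
qed

text \<open>Linear change of variables: real dimension 2 makes the Jacobian \<open>v\<close>, which
  cancels the normalisation of \<open>phi v\<close>. Gaussian blocks of different variances thus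
  become images of one standard block and can share its randomness.\<close>

lemma complex_gaussian_scale:
  assumes v: "v > 0"
  shows "distr (complex_gaussian 1) (complex_gaussian v) (\<lambda>e. of_real (sqrt v) * e) = complex_gaussian v"
proof (rule measure_eqI)
  fix A assume "A \<in> sets (distr (complex_gaussian 1) (complex_gaussian v) (\<lambda>e. of_real (sqrt v) * e))"
  then have A [measurable]: "A \<in> sets borel" by simp
  have "emeasure (complex_gaussian v) A = (\<integral>\<^sup>+ z. ennreal (phi v z) * indicator A z \<partial>lborel)"
    by (simp add: complex_gaussian_eq emeasure_density)
  also have "\<dots> = (\<integral>\<^sup>+ z. ennreal (phi v z) * indicator A z \<partial>density (distr lborel borel (\<lambda>x. 0 + sqrt v *\<^sub>R x)) (\<lambda>_. \<bar>sqrt v\<bar> ^ DIM(complex)))"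
    using v by (subst lborel_affine[of "sqrt v" 0]) auto
  also have "\<dots> = (\<integral>\<^sup>+ e. ennreal v * (ennreal (phi v (sqrt v *\<^sub>R e)) * indicator A (sqrt v *\<^sub>R e)) \<partial>lborel)"
    using v by (simp add: nn_integral_density nn_integral_distr)
  also have "\<dots> = (\<integral>\<^sup>+ e. ennreal (phi 1 e) * indicator A (of_real (sqrt v) * e) \<partial>lborel)"
  proof (intro nn_integral_cong)
    fix e
    have "v * phi v (sqrt v *\<^sub>R e) = phi 1 e"
      using v by (simp add: phi_def power_mult_distrib)
    then have "ennreal v * ennreal (phi v (sqrt v *\<^sub>R e)) = ennreal (phi 1 e)"
      using v by (simp add: ennreal_mult'[symmetric])
    then show "ennreal v * (ennreal (phi v (sqrt v *\<^sub>R e)) * indicator A (sqrt v *\<^sub>R e)) = ennreal (phi 1 e) * indicator A (of_real (sqrt v) * e)"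
      by (simp add: mult.assoc[symmetric] scaleR_conv_of_real)
  qed
  also have "\<dots> = emeasure (distr (complex_gaussian 1) (complex_gaussian v) (\<lambda>e. of_real (sqrt v) * e)) A"
  proof -
    have "emeasure (distr (complex_gaussian 1) (complex_gaussian v) (\<lambda>e. of_real (sqrt v) * e)) A = (\<integral>\<^sup>+ e. indicator ((\<lambda>e. of_real (sqrt v) * e) -` A) e \<partial>complex_gaussian 1)"
      by (subst emeasure_distr, simp, simp) (subst nn_integral_indicator, auto intro!: measurable_sets_borel[of _ borel])
    also have "\<dots> = (\<integral>\<^sup>+ e. indicator A (of_real (sqrt v) * e) \<partial>complex_gaussian 1)"
      by (intro nn_integral_cong) (auto simp: indicator_def)
    finally show ?thesis
      by (subst (asm) nn_integral_complex_gaussian) auto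
  qed
  finally show "emeasure (distr (complex_gaussian 1) (complex_gaussian v) (\<lambda>e. of_real (sqrt v) * e)) A = emeasure (complex_gaussian v) A" ..
qed simp

section \<open>Products of complex Gaussians\<close>

text \<open>Once all symbols are known, only fading and noise are random, and these are independent
  over time. A conditional law of a block is therefore a product, and dependence between symbols
  survives only in the variance vector \<open>v\<close>.\<close>

definition Phi :: "'i set \<Rightarrow> ('i \<Rightarrow> real) \<Rightarrow> ('i \<Rightarrow> complex) \<Rightarrow> real" where
  "Phi I v y = (\<Prod>k\<in>I. phi (v k) (y k))"

lemma Phi_measurable [measurable (raw)]:
  assumes "\<And>k. k \<in> I \<Longrightarrow> (\<lambda>x. v x k) \<in> borel_measurable M" "\<And>k. k \<in> I \<Longrightarrow> (\<lambda>x. y x k) \<in> borel_measurable M"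
  shows "(\<lambda>x. Phi I (v x) (y x)) \<in> borel_measurable M"
  unfolding Phi_def using assms by (intro borel_measurable_prod phi_measurable) auto

lemma Phi_pos: "(\<And>k. k \<in> I \<Longrightarrow> v k > 0) \<Longrightarrow> Phi I v y > 0"
  unfolding Phi_def by (intro prod_pos) (auto intro: phi_pos)

lemma Phi_cong: "(\<And>k. k \<in> I \<Longrightarrow> v k = v' k) \<Longrightarrow> (\<And>k. k \<in> I \<Longrightarrow> y k = y' k) \<Longrightarrow> Phi I v y = Phi I v' y'"
  unfolding Phi_def by (intro prod.cong) auto

lemma ennreal_Phi: "(\<And>k. k \<in> I \<Longrightarrow> v k > 0) \<Longrightarrow> ennreal (Phi I v y) = (\<Prod>k\<in>I. ennreal (phi (v k) (y k)))"
  unfolding Phi_def by (subst prod_ennreal) (auto intro: phi_pos less_imp_le)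

section \<open>Finite products: densities, translations and scalings\<close>

abbreviation block_lborel :: "'i set \<Rightarrow> ('i \<Rightarrow> complex) measure" where
  "block_lborel I \<equiv> (\<Pi>\<^sub>M k\<in>I. lborel)"

lemma sigma_finite_block_lborel: "finite I \<Longrightarrow> sigma_finite_measure (block_lborel I)"
  by (rule product_sigma_finite.sigma_finite) (auto intro!: product_sigma_finite.intro lborel.sigma_finite_measure_axioms)

lemma sets_block_lborel [measurable_cong]: "sets (block_lborel I) = sets (\<Pi>\<^sub>M k\<in>I. borel)"
  by (intro sets_PiM_cong) auto

text \<open>Under a coordinatewise map rectangles pull back to rectangles, and these determine a
  finite product measure.\<close>

lemma PiM_distr:
  assumes I: "finite I" and M: "\<And>i. prob_space (M i)" "\<And>i. prob_space (M' i)"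
    and f [measurable]: "\<And>i. f i \<in> M i \<rightarrow>\<^sub>M M' i"
  shows "(\<Pi>\<^sub>M i\<in>I. distr (M i) (M' i) (f i)) = distr (PiM I M) (PiM I M') (\<lambda>x. \<lambda>i\<in>I. f i (x i))"
proof -
  interpret M: product_prob_space M using M by (intro product_prob_spaceI)
  interpret D: product_prob_space "\<lambda>i. distr (M i) (M' i) (f i)"
    using M by (intro product_prob_spaceI prob_space.prob_space_distr) auto
  show ?thesis
  proof (rule D.PiM_eqI[OF I, symmetric])
    show "sets (distr (PiM I M) (PiM I M') (\<lambda>x. \<lambda>i\<in>I. f i (x i))) = sets (\<Pi>\<^sub>M i\<in>I. distr (M i) (M' i) (f i))"
      by (simp cong: sets_PiM_cong)
    fix A assume "\<And>i. i \<in> I \<Longrightarrow> A i \<in> sets (distr (M i) (M' i) (f i))"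
    then have A: "\<And>i. i \<in> I \<Longrightarrow> A i \<in> sets (M' i)" by simp
    have "(\<lambda>x. \<lambda>i\<in>I. f i (x i)) -` Pi\<^sub>E I A \<inter> space (PiM I M) = Pi\<^sub>E I (\<lambda>i. f i -` A i \<inter> space (M i))"
      by (auto simp: space_PiM PiE_iff)
    then show "emeasure (distr (PiM I M) (PiM I M') (\<lambda>x. \<lambda>i\<in>I. f i (x i))) (Pi\<^sub>E I A)
        = (\<Prod>i\<in>I. emeasure (distr (M i) (M' i) (f i)) (A i))"
      using A I by (subst emeasure_distr) (auto intro!: sets_PiM_I_finite measurable_sets[OF f] prod.cong simp: M.emeasure_PiM emeasure_distr)
  qed
qed

lemma indicator_PiE_prod:
  "finite I \<Longrightarrow> y \<in> extensional I \<Longrightarrow> (indicator (Pi\<^sub>E I A) y :: ennreal) = (\<Prod>k\<in>I. indicator (A k) (y k))"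
  by (cases "y \<in> Pi\<^sub>E I A") (auto simp: PiE_def Pi_iff intro!: prod.neutral prod_zero[symmetric] bexI)

text \<open>On a rectangle the indicator factors over the coordinates, so the integral of the
  product is the product of the integrals.\<close>

lemma PiM_density:
  fixes f :: "'i \<Rightarrow> complex \<Rightarrow> ennreal"
  assumes I: "finite I" and [measurable]: "\<And>k. f k \<in> borel_measurable borel"
    and sf: "\<And>k. sigma_finite_measure (density lborel (f k))"
  shows "(\<Pi>\<^sub>M k\<in>I. density lborel (f k)) = density (block_lborel I) (\<lambda>y. \<Prod>k\<in>I. f k (y k))"
proof -
  interpret P: product_sigma_finite "\<lambda>k. density lborel (f k)" by (rule product_sigma_finite.intro) (rule sf)
  interpret L: product_sigma_finite "\<lambda>k::'i. lborel :: complex measure" ..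
  show ?thesis
  proof (rule P.PiM_eqI[OF I, symmetric])
    show "sets (density (block_lborel I) (\<lambda>y. \<Prod>k\<in>I. f k (y k))) = sets (\<Pi>\<^sub>M k\<in>I. density lborel (f k))"
      by (simp cong: sets_PiM_cong)
    fix A assume A: "\<And>i. i \<in> I \<Longrightarrow> A i \<in> sets (density lborel (f i))"
    then have A' [measurable]: "i \<in> I \<Longrightarrow> A i \<in> sets borel" for i by auto
    have "emeasure (density (block_lborel I) (\<lambda>y. \<Prod>k\<in>I. f k (y k))) (Pi\<^sub>E I A)
      = (\<integral>\<^sup>+ y. (\<Prod>k\<in>I. f k (y k)) * indicator (Pi\<^sub>E I A) y \<partial>block_lborel I)"
      using I A by (subst emeasure_density) (auto intro!: sets_PiM_I_finite)
    also have "\<dots> = (\<integral>\<^sup>+ y. (\<Prod>k\<in>I. f k (y k) * indicator (A k) (y k)) \<partial>block_lborel I)"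
      using I by (intro nn_integral_cong) (simp add: indicator_PiE_prod prod.distrib space_PiM PiE_iff)
    also have "\<dots> = (\<Prod>k\<in>I. \<integral>\<^sup>+ y. f k y * indicator (A k) y \<partial>lborel)"
      using I by (intro L.product_nn_integral_prod) auto
    also have "\<dots> = (\<Prod>i\<in>I. emeasure (density lborel (f i)) (A i))"
      by (intro prod.cong) (auto simp: emeasure_density)
    finally show "emeasure (density (block_lborel I) (\<lambda>y. \<Prod>k\<in>I. f k (y k))) (Pi\<^sub>E I A) = (\<Prod>i\<in>I. emeasure (density lborel (f i)) (A i))" .
  qed
qed

lemma PiM_complex_gaussian:
  assumes I: "finite I" and v: "\<And>k. v k > 0"
  shows "(\<Pi>\<^sub>M k\<in>I. complex_gaussian (v k)) = density (block_lborel I) (\<lambda>y. ennreal (Phi I v y))"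
proof -
  have "(\<Pi>\<^sub>M k\<in>I. density lborel (\<lambda>z. ennreal (phi (v k) z))) = density (block_lborel I) (\<lambda>y. \<Prod>k\<in>I. ennreal (phi (v k) (y k)))"
    using prob_space_complex_gaussian[OF v]
    by (intro PiM_density I) (auto simp: complex_gaussian_eq prob_space_imp_sigma_finite)
  then show ?thesis by (simp add: complex_gaussian_eq ennreal_Phi v)
qed

lemma distr_block_lborel_translate:
  fixes a :: "'i \<Rightarrow> complex"
  assumes I: "finite I"
  shows "distr (block_lborel I) (block_lborel I) (\<lambda>y. \<lambda>k\<in>I. a k + y k) = block_lborel I"
proof -
  interpret L: product_sigma_finite "\<lambda>k::'i. lborel :: complex measure" ..
  show ?thesis
  proof (rule L.PiM_eqI[OF I])
    fix A :: "'i \<Rightarrow> complex set" assume A: "\<And>i. i \<in> I \<Longrightarrow> A i \<in> sets lborel"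
    then have A' [measurable]: "i \<in> I \<Longrightarrow> A i \<in> sets borel" for i by auto
    have "(\<lambda>y. \<lambda>k\<in>I. a k + y k) -` Pi\<^sub>E I A \<inter> space (block_lborel I) = Pi\<^sub>E I (\<lambda>k. (+) (a k) -` A k)"
      by (auto simp: space_PiM PiE_iff)
    then have "emeasure (distr (block_lborel I) (block_lborel I) (\<lambda>y. \<lambda>k\<in>I. a k + y k)) (Pi\<^sub>E I A)
        = emeasure (block_lborel I) (Pi\<^sub>E I (\<lambda>k. (+) (a k) -` A k))"
      using I A by (subst emeasure_distr) (auto intro!: sets_PiM_I_finite)
    also have "\<dots> = (\<Prod>k\<in>I. emeasure lborel ((+) (a k) -` A k))"
      using A' by (subst L.emeasure_PiM[OF I]) (auto intro!: measurable_sets_borel[of _ borel])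
    also have "\<dots> = (\<Prod>k\<in>I. emeasure (distr lborel borel ((+) (a k))) (A k))"
      using A' by (intro prod.cong) (auto simp: emeasure_distr)
    finally show "emeasure (distr (block_lborel I) (block_lborel I) (\<lambda>y. \<lambda>k\<in>I. a k + y k)) (Pi\<^sub>E I A) = (\<Prod>i\<in>I. emeasure lborel (A i))"
      by (simp add: lborel_distr_plus)
  qed simp
qed

lemma nn_integral_block_lborel_translate:
  assumes I: "finite I" and [measurable]: "F \<in> borel_measurable (\<Pi>\<^sub>M k\<in>I. borel)"
  shows "(\<integral>\<^sup>+ y. F (\<lambda>k\<in>I. a k + y k) \<partial>block_lborel I) = (\<integral>\<^sup>+ y. F y \<partial>block_lborel I)"
  by (subst (2) distr_block_lborel_translate[OF I, of a, symmetric]) (subst nn_integral_distr, auto)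

lemma nn_integral_PiM_complex_gaussian:
  assumes "finite I" "\<And>k. v k > 0" and [measurable]: "F \<in> borel_measurable (\<Pi>\<^sub>M k\<in>I. borel)"
  shows "(\<integral>\<^sup>+ y. F y \<partial>(\<Pi>\<^sub>M k\<in>I. complex_gaussian (v k))) = (\<integral>\<^sup>+ y. ennreal (Phi I v y) * F y \<partial>block_lborel I)"
  using assms(1,2) by (subst PiM_complex_gaussian) (auto simp: nn_integral_density)

lemma prob_space_PiM_complex_gaussian: "(\<And>k. v k > 0) \<Longrightarrow> prob_space (\<Pi>\<^sub>M k\<in>I. complex_gaussian (v k))"
  by (intro prob_space_PiM prob_space_complex_gaussian) auto

lemma sets_PiM_complex_gaussian [measurable_cong]: "sets (\<Pi>\<^sub>M k\<in>I. complex_gaussian (v k)) = sets (\<Pi>\<^sub>M k\<in>I. borel)"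
  by (intro sets_PiM_cong) auto

text \<open>The variances move from the density into the test function: a block with density
  \<open>Phi I v\<close> is \<open>sqrt v\<close> times a standard block. All couplings below rest
  on this passage.\<close>

lemma nn_integral_Phi_scale:
  assumes I: "finite I" and v: "\<And>k. v k > 0" and [measurable]: "F \<in> borel_measurable (\<Pi>\<^sub>M k\<in>I. borel)"
  shows "(\<integral>\<^sup>+ y. ennreal (Phi I v y) * F y \<partial>block_lborel I)
    = (\<integral>\<^sup>+ e. F (\<lambda>k\<in>I. of_real (sqrt (v k)) * e k) \<partial>(\<Pi>\<^sub>M k\<in>I. complex_gaussian 1))"
proof -
  have "(\<integral>\<^sup>+ y. ennreal (Phi I v y) * F y \<partial>block_lborel I) = (\<integral>\<^sup>+ y. F y \<partial>(\<Pi>\<^sub>M k\<in>I. complex_gaussian (v k)))"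
    using I v by (simp add: nn_integral_PiM_complex_gaussian)
  also have "(\<Pi>\<^sub>M k\<in>I. complex_gaussian (v k)) = (\<Pi>\<^sub>M k\<in>I. distr (complex_gaussian 1) (complex_gaussian (v k)) (\<lambda>e. of_real (sqrt (v k)) * e))"
    by (simp add: complex_gaussian_scale v)
  also have "\<dots> = distr (\<Pi>\<^sub>M k\<in>I. complex_gaussian 1) (\<Pi>\<^sub>M k\<in>I. complex_gaussian (v k)) (\<lambda>e. \<lambda>k\<in>I. of_real (sqrt (v k)) * e k)"
    by (rule PiM_distr) (auto simp: I prob_space_complex_gaussian v)
  also have "(\<integral>\<^sup>+ y. F y \<partial>\<dots>) = (\<integral>\<^sup>+ e. F (\<lambda>k\<in>I. of_real (sqrt (v k)) * e k) \<partial>(\<Pi>\<^sub>M k\<in>I. complex_gaussian 1))"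
    by (subst nn_integral_distr) auto
  finally show ?thesis .
qed

section \<open>Integrating out the fading when the symbols are known\<close>

lemma nn_integral_Phi_convolution:
  assumes I: "finite I" and v: "v > 0" and w: "\<And>k. w k > 0"
  shows "(\<integral>\<^sup>+ h. ennreal (Phi I w (\<lambda>k. y k - h k * a k)) \<partial>(\<Pi>\<^sub>M k\<in>I. complex_gaussian v))
    = ennreal (Phi I (\<lambda>k. w k + (cmod (a k))\<^sup>2 * v) y)"
proof -
  interpret L: product_sigma_finite "\<lambda>k::'i. complex_gaussian v"
    by (intro product_sigma_finite.intro prob_space_imp_sigma_finite prob_space_complex_gaussian v)
  have pos: "w k + (cmod (a k))\<^sup>2 * v > 0" for k using v w by (intro add_pos_nonneg) auto
  have "(\<integral>\<^sup>+ h. ennreal (Phi I w (\<lambda>k. y k - h k * a k)) \<partial>(\<Pi>\<^sub>M k\<in>I. complex_gaussian v))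
    = (\<integral>\<^sup>+ h. (\<Prod>k\<in>I. ennreal (phi (w k) (y k - h k * a k))) \<partial>(\<Pi>\<^sub>M k\<in>I. complex_gaussian v))"
    by (simp add: ennreal_Phi w)
  also have "\<dots> = (\<Prod>k\<in>I. \<integral>\<^sup>+ h. ennreal (phi (w k) (y k - h * a k)) \<partial>complex_gaussian v)"
    by (rule L.product_nn_integral_prod[OF I]) auto
  finally show ?thesis using v w pos by (simp add: nn_integral_phi_convolution ennreal_Phi)
qed

lemma measurable_fading_component:
  assumes "l \<in> J" "k \<in> I"
  shows "(\<lambda>h. h l k) \<in> borel_measurable (\<Pi>\<^sub>M l\<in>J. \<Pi>\<^sub>M k\<in>I. (borel :: complex measure))"
proof -
  have "(\<lambda>h. h l) \<in> (\<Pi>\<^sub>M l\<in>J. \<Pi>\<^sub>M k\<in>I. (borel :: complex measure)) \<rightarrow>\<^sub>M (\<Pi>\<^sub>M k\<in>I. borel)"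
    using assms by measurable
  moreover have "(\<lambda>h. h k) \<in> (\<Pi>\<^sub>M k\<in>I. (borel :: complex measure)) \<rightarrow>\<^sub>M borel"
    using assms by measurable
  ultimately show ?thesis by (rule measurable_compose)
qed

lemma measurable_fading_sum:
  assumes "J \<subseteq> J'"
  shows "(\<lambda>h. ennreal (Phi I w (\<lambda>k. y k - (\<Sum>l\<in>J. h l k * \<xi> l k)))) \<in> borel_measurable (\<Pi>\<^sub>M l\<in>J'. \<Pi>\<^sub>M k\<in>I. (borel :: complex measure))"
  using assms
  by (intro measurable_compose[OF _ measurable_ennreal] Phi_measurable borel_measurable_diff borel_measurable_sum
      borel_measurable_times measurable_fading_component borel_measurable_const) auto

lemma sets_finite_fading [measurable_cong]: "sets (\<Pi>\<^sub>M l\<in>J. \<Pi>\<^sub>M k\<in>I. complex_gaussian (\<alpha> l)) = sets (\<Pi>\<^sub>M l\<in>J. \<Pi>\<^sub>M k\<in>I. borel)"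
  by (intro sets_PiM_cong sets_PiM_complex_gaussian) auto

text \<open>Integrating out the fading of one interferer adds its received power to the variances.
  The induction over interferers generalises \<open>w\<close>, which absorbs the powers already
  treated.\<close>

lemma nn_integral_Phi_sum_finite:
  fixes \<xi> :: "nat \<Rightarrow> 'i \<Rightarrow> complex"
  assumes I: "finite I" and v: "\<And>l. \<alpha> l > 0" and w: "\<And>k. w k > 0" and J: "finite J"
  shows "(\<integral>\<^sup>+ h. ennreal (Phi I w (\<lambda>k. y k - (\<Sum>l\<in>J. h l k * \<xi> l k))) \<partial>(\<Pi>\<^sub>M l\<in>J. \<Pi>\<^sub>M k\<in>I. complex_gaussian (\<alpha> l)))
    = ennreal (Phi I (\<lambda>k. w k + (\<Sum>l\<in>J. \<alpha> l * (cmod (\<xi> l k))\<^sup>2)) y)"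
  using J w
proof (induction J arbitrary: w y rule: finite_induct)
  case empty
  show ?case by (simp add: PiM_empty nn_integral_count_space_finite)
next
  case (insert i J)
  interpret L: product_sigma_finite "\<lambda>l. \<Pi>\<^sub>M k\<in>I. complex_gaussian (\<alpha> l)"
    by (intro product_sigma_finite.intro prob_space_imp_sigma_finite prob_space_PiM_complex_gaussian v)
  have "(\<integral>\<^sup>+ h. ennreal (Phi I w (\<lambda>k. y k - (\<Sum>l\<in>insert i J. h l k * \<xi> l k))) \<partial>(\<Pi>\<^sub>M l\<in>insert i J. \<Pi>\<^sub>M k\<in>I. complex_gaussian (\<alpha> l)))
    = (\<integral>\<^sup>+ h. \<integral>\<^sup>+ h'. ennreal (Phi I w (\<lambda>k. y k - (\<Sum>l\<in>insert i J. (h(i := h')) l k * \<xi> l k))) \<partial>(\<Pi>\<^sub>M k\<in>I. complex_gaussian (\<alpha> i)) \<partial>(\<Pi>\<^sub>M l\<in>J. \<Pi>\<^sub>M k\<in>I. complex_gaussian (\<alpha> l)))"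
    by (rule L.product_nn_integral_insert[OF insert(1,2)])
       (subst measurable_cong_sets[OF sets_finite_fading refl], rule measurable_fading_sum, simp)
  also have "\<dots> = (\<integral>\<^sup>+ h. \<integral>\<^sup>+ h'. ennreal (Phi I w (\<lambda>k. (y k - (\<Sum>l\<in>J. h l k * \<xi> l k)) - h' k * \<xi> i k)) \<partial>(\<Pi>\<^sub>M k\<in>I. complex_gaussian (\<alpha> i)) \<partial>(\<Pi>\<^sub>M l\<in>J. \<Pi>\<^sub>M k\<in>I. complex_gaussian (\<alpha> l)))"
    using insert(1,2) by (intro nn_integral_cong arg_cong[where f=ennreal] Phi_cong) (auto intro!: sum.cong)
  also have "\<dots> = (\<integral>\<^sup>+ h. ennreal (Phi I (\<lambda>k. w k + (cmod (\<xi> i k))\<^sup>2 * \<alpha> i) (\<lambda>k. y k - (\<Sum>l\<in>J. h l k * \<xi> l k))) \<partial>(\<Pi>\<^sub>M l\<in>J. \<Pi>\<^sub>M k\<in>I. complex_gaussian (\<alpha> l)))"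
    by (simp add: nn_integral_Phi_convolution I v insert.prems)
  also have "\<dots> = ennreal (Phi I (\<lambda>k. w k + (\<Sum>l\<in>insert i J. \<alpha> l * (cmod (\<xi> l k))\<^sup>2)) y)"
    using insert(1,2) v insert.prems
    by (subst insert.IH) (auto intro!: add_pos_nonneg arg_cong[where f=ennreal] Phi_cong simp: less_imp_le algebra_simps)
  finally show ?case .
qed

abbreviation fading_space :: "'i set \<Rightarrow> (nat \<Rightarrow> real) \<Rightarrow> (nat \<Rightarrow> 'i \<Rightarrow> complex) measure" where
  "fading_space I \<alpha> \<equiv> (\<Pi>\<^sub>M l\<in>UNIV. \<Pi>\<^sub>M k\<in>I. complex_gaussian (\<alpha> l))"

text \<open>A partial sum sees finitely many interferers, and the infinite product restricted to
  these is the finite product.\<close>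

lemma nn_integral_Phi_partial_sum:
  fixes \<xi> :: "nat \<Rightarrow> 'i \<Rightarrow> complex"
  assumes I: "finite I" and v: "\<And>l. \<alpha> l > 0" and w: "\<And>k. w k > 0"
  shows "(\<integral>\<^sup>+ h. ennreal (Phi I w (\<lambda>k. y k - (\<Sum>l<m. h l k * \<xi> l k))) \<partial>fading_space I \<alpha>)
    = ennreal (Phi I (\<lambda>k. w k + (\<Sum>l<m. \<alpha> l * (cmod (\<xi> l k))\<^sup>2)) y)"
proof -
  have P: "\<And>l. prob_space (\<Pi>\<^sub>M k\<in>I. complex_gaussian (\<alpha> l))"
    by (intro prob_space_PiM_complex_gaussian v)
  interpret product_prob_space "\<lambda>l. \<Pi>\<^sub>M k\<in>I. complex_gaussian (\<alpha> l)" UNIV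
    using P by (intro product_prob_spaceI)
  let ?F = "\<lambda>h. ennreal (Phi I w (\<lambda>k. y k - (\<Sum>l<m. h l k * \<xi> l k)))"
  let ?N = "\<Pi>\<^sub>M l\<in>{..<m}. \<Pi>\<^sub>M k\<in>I. complex_gaussian (\<alpha> l)"
  have "(\<integral>\<^sup>+ h. ?F h \<partial>?N) = (\<integral>\<^sup>+ h. ?F h \<partial>distr (fading_space I \<alpha>) ?N (\<lambda>x. restrict x {..<m}))"
    by (subst distr_PiM_restrict_finite) auto
  also have "\<dots> = (\<integral>\<^sup>+ h. ?F (restrict h {..<m}) \<partial>fading_space I \<alpha>)"
    by (intro nn_integral_distr measurable_restrict_subset)
       (auto simp: measurable_cong_sets[OF sets_finite_fading refl] intro!: measurable_fading_sum)
  also have "\<dots> = (\<integral>\<^sup>+ h. ?F h \<partial>fading_space I \<alpha>)"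
    by (intro nn_integral_cong arg_cong[where f=ennreal] Phi_cong) auto
  finally show ?thesis
    using nn_integral_Phi_sum_finite[OF I v w, where J = "{..<m}" and \<xi> = \<xi>] by simp
qed

section \<open>The law of the channel output\<close>

text \<open>Otherwise the simplifier turns \<open>{1..n}\<close> into \<open>{Suc 0..n}\<close>.\<close>
declare One_nat_def [simp del]

text \<open>Kept apart from \<open>interference_block\<close>, because the summability of \<alpha>
  assumed there is proved by instantiating this locale with a point mass.\<close>

locale interference_channel =
  fixes \<alpha> :: "nat \<Rightarrow> real" and \<sigma>2 :: real and n :: nat and Q :: "(nat \<Rightarrow> complex) measure"
  assumes prob_Q: "prob_space Q" and sets_Q [measurable_cong]: "sets Q = sets (block_space n)"
    and \<alpha>_pos: "\<And>l. \<alpha> l > 0" and \<sigma>2_pos: "\<sigma>2 > 0"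
begin

abbreviation "I \<equiv> {1..n}"
abbreviation "B \<equiv> block_space n"
abbreviation "L \<equiv> block_lborel I"
abbreviation "\<Gamma> \<equiv> (\<Pi>\<^sub>M k\<in>I. complex_gaussian 1)"
abbreviation "S \<equiv> (\<Pi>\<^sub>M l\<in>(UNIV :: nat set). Q)"
abbreviation "HI \<equiv> fading_space I \<alpha>"
abbreviation "Z \<equiv> (\<Pi>\<^sub>M k\<in>I. complex_gaussian \<sigma>2)"

sublocale Q: prob_space Q by (rule prob_Q)
text \<open>\<open>sequence_space\<close> provides \<open>PiM_iter\<close>: prepending an
  independent draw from \<open>Q\<close> to an i.i.d. sequence does not change the law of the
  sequence.\<close>

sublocale S: sequence_space Q
  by (rule sequence_space.intro, rule product_prob_spaceI, rule prob_Q)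
sublocale L: sigma_finite_measure L by (intro sigma_finite_block_lborel) simp
sublocale \<Gamma>: prob_space \<Gamma> by (intro prob_space_PiM_complex_gaussian) simp
sublocale HI: prob_space HI by (intro prob_space_PiM prob_space_PiM_complex_gaussian \<alpha>_pos)
sublocale Z: prob_space Z by (intro prob_space_PiM_complex_gaussian \<sigma>2_pos)

sublocale HZ: prob_space "HI \<Otimes>\<^sub>M Z"
  by (intro prob_space_pair HI.prob_space_axioms Z.prob_space_axioms)
sublocale GHZ: prob_space "\<Gamma> \<Otimes>\<^sub>M HI \<Otimes>\<^sub>M Z"
  by (intro prob_space_pair \<Gamma>.prob_space_axioms HZ.prob_space_axioms)
sublocale SGHZ: prob_space "S \<Otimes>\<^sub>M \<Gamma> \<Otimes>\<^sub>M HI \<Otimes>\<^sub>M Z"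
  by (intro prob_space_pair S.prob_space_axioms GHZ.prob_space_axioms)

lemma prob_space_channel_space: "prob_space (channel_space \<alpha> \<sigma>2 n Q)"
  unfolding channel_space_def by (intro prob_space_pair prob_Q SGHZ.prob_space_axioms)

lemma AE_channel_space:
  assumes "AE \<omega> in channel_space \<alpha> \<sigma>2 n Q. P \<omega>"
  shows "AE x in Q. AE \<xi> in S. AE h in \<Gamma>. AE hi in HI. AE z in Z. P (x, \<xi>, h, hi, z)"
proof -
  interpret P1: pair_sigma_finite HI Z ..
  interpret P2: pair_sigma_finite \<Gamma> "HI \<Otimes>\<^sub>M Z" ..
  interpret P3: pair_sigma_finite S "\<Gamma> \<Otimes>\<^sub>M HI \<Otimes>\<^sub>M Z" ..
  interpret P4: pair_sigma_finite Q "S \<Otimes>\<^sub>M \<Gamma> \<Otimes>\<^sub>M HI \<Otimes>\<^sub>M Z" ..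
  note P4.AE_pair[OF assms[unfolded channel_space_def]]
  then show ?thesis
  proof (elim eventually_mono)
    fix x assume "AE y in S \<Otimes>\<^sub>M \<Gamma> \<Otimes>\<^sub>M HI \<Otimes>\<^sub>M Z. P (x, y)"
    note P3.AE_pair[OF this]
    then show "AE \<xi> in S. AE h in \<Gamma>. AE hi in HI. AE z in Z. P (x, \<xi>, h, hi, z)"
    proof (elim eventually_mono)
      fix \<xi> assume "AE y in \<Gamma> \<Otimes>\<^sub>M HI \<Otimes>\<^sub>M Z. P (x, \<xi>, y)"
      note P2.AE_pair[OF this]
      then show "AE h in \<Gamma>. AE hi in HI. AE z in Z. P (x, \<xi>, h, hi, z)"
      proof (elim eventually_mono)
        fix h assume "AE y in HI \<Otimes>\<^sub>M Z. P (x, \<xi>, h, y)"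
        from P1.AE_pair[OF this] show "AE hi in HI. AE z in Z. P (x, \<xi>, h, hi, z)" .
      qed
    qed
  qed
qed

lemma interference_terms_summable_AE:
  assumes "AE \<omega> in channel_space \<alpha> \<sigma>2 n Q. \<forall>k\<in>I. summable (interference_terms \<omega> k)"
  shows "AE \<xi> in S. AE hi in HI. \<forall>k\<in>I. summable (\<lambda>l. hi l k * \<xi> l k)"
  using AE_channel_space[OF assms] by simp

text \<open>The noise keeps all variances away from zero, so each factor is at most the peak at
  variance \<sigma>2. This gives the majorant for dominated convergence and, after averaging, the
  upper bound on all densities.\<close>

lemma Phi_sigma2_le:
  assumes "\<And>k. k \<in> I \<Longrightarrow> v k \<ge> \<sigma>2"
  shows "Phi I v y \<le> (1 / (pi * \<sigma>2)) ^ n"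
proof -
  have "phi (v k) (y k) \<le> 1 / (pi * \<sigma>2)" if "k \<in> I" for k
  proof -
    have v: "v k \<ge> \<sigma>2" "v k > 0" using assms[OF that] \<sigma>2_pos by auto
    have "phi (v k) (y k) \<le> 1 / (pi * v k)"
      unfolding phi_def using v by (intro divide_right_mono) auto
    also have "\<dots> \<le> 1 / (pi * \<sigma>2)" using v \<sigma>2_pos by (intro divide_left_mono) auto
    finally show ?thesis .
  qed
  moreover have "phi (v k) (y k) \<ge> 0" if "k \<in> I" for k
    using assms[OF that] \<sigma>2_pos by (intro less_imp_le phi_pos) auto
  ultimately have "Phi I v y \<le> (\<Prod>k\<in>I. 1 / (pi * \<sigma>2))"
    unfolding Phi_def by (intro prod_mono) auto
  then show ?thesis by simp
qed

lemma measurable_hi: "k \<in> I \<Longrightarrow> (\<lambda>hi. hi l k) \<in> borel_measurable HI"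
  unfolding measurable_cong_sets[OF sets_finite_fading refl] by (rule measurable_fading_component) auto

lemma measurable_interference:
  "k \<in> I \<Longrightarrow> (\<lambda>hi. \<Sum>l. hi l k * \<xi> l k) \<in> borel_measurable HI"
  by (intro borel_measurable_suminf borel_measurable_times measurable_hi) auto

lemma measurable_Phi_interference:
  "(\<lambda>hi. ennreal (Phi I w (\<lambda>k. y k - (\<Sum>l. hi l k * \<xi> l k)))) \<in> borel_measurable HI"
  by (intro measurable_compose[OF _ measurable_ennreal] Phi_measurable borel_measurable_diff measurable_interference) auto

text \<open>For each \<open>m\<close> the left side is the density of the noise plus
  \<open>m\<close> interferers given their symbols. The partial sums converge for almost every
  fading, and \<open>Phi_sigma2_le\<close> dominates. The partial powers stay inside the sequence
  because this limit is also the means to show that \<alpha> is summable.\<close>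

lemma Phi_partial_sum_limit:
  assumes s: "AE hi in HI. \<forall>k\<in>I. summable (\<lambda>l. hi l k * \<xi> l k)"
  shows "(\<lambda>m. ennreal (Phi I (\<lambda>k. \<sigma>2 + (\<Sum>l<m. \<alpha> l * (cmod (\<xi> l k))\<^sup>2)) y))
     \<longlonglongrightarrow> (\<integral>\<^sup>+ hi. ennreal (Phi I (\<lambda>_. \<sigma>2) (\<lambda>k. y k - (\<Sum>l. hi l k * \<xi> l k))) \<partial>HI)"
proof -
  have "(\<lambda>m. \<integral>\<^sup>+ hi. ennreal (Phi I (\<lambda>_. \<sigma>2) (\<lambda>k. y k - (\<Sum>l<m. hi l k * \<xi> l k))) \<partial>HI)
     \<longlonglongrightarrow> (\<integral>\<^sup>+ hi. ennreal (Phi I (\<lambda>_. \<sigma>2) (\<lambda>k. y k - (\<Sum>l. hi l k * \<xi> l k))) \<partial>HI)"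
  proof (rule nn_integral_dominated_convergence[where w = "\<lambda>_. ennreal ((1 / (pi * \<sigma>2)) ^ n)"])
    show "(\<lambda>hi. ennreal (Phi I (\<lambda>_. \<sigma>2) (\<lambda>k. y k - (\<Sum>l<m. hi l k * \<xi> l k)))) \<in> borel_measurable HI" for m
      by (intro measurable_compose[OF _ measurable_ennreal] Phi_measurable borel_measurable_diff borel_measurable_sum borel_measurable_times measurable_hi) auto
    show "(\<lambda>hi. ennreal (Phi I (\<lambda>_. \<sigma>2) (\<lambda>k. y k - (\<Sum>l. hi l k * \<xi> l k)))) \<in> borel_measurable HI"
      by (rule measurable_Phi_interference)
    show "AE hi in HI. (\<lambda>m. ennreal (Phi I (\<lambda>_. \<sigma>2) (\<lambda>k. y k - (\<Sum>l<m. hi l k * \<xi> l k))))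
        \<longlonglongrightarrow> ennreal (Phi I (\<lambda>_. \<sigma>2) (\<lambda>k. y k - (\<Sum>l. hi l k * \<xi> l k)))"
      using s
    proof (elim eventually_mono)
      fix hi assume "\<forall>k\<in>I. summable (\<lambda>l. hi l k * \<xi> l k)"
      then show "(\<lambda>m. ennreal (Phi I (\<lambda>_. \<sigma>2) (\<lambda>k. y k - (\<Sum>l<m. hi l k * \<xi> l k))))
        \<longlonglongrightarrow> ennreal (Phi I (\<lambda>_. \<sigma>2) (\<lambda>k. y k - (\<Sum>l. hi l k * \<xi> l k)))"
        unfolding Phi_def phi_def using \<sigma>2_pos
        by (intro tendsto_ennrealI tendsto_prod tendsto_intros) (auto intro: summable_LIMSEQ)
    qed
    show "AE hi in HI. ennreal (Phi I (\<lambda>_. \<sigma>2) (\<lambda>k. y k - (\<Sum>l<m. hi l k * \<xi> l k))) \<le> ennreal ((1 / (pi * \<sigma>2)) ^ n)" for m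
      by (intro AE_I2 ennreal_leI Phi_sigma2_le) simp
    show "(\<integral>\<^sup>+ hi. ennreal ((1 / (pi * \<sigma>2)) ^ n) \<partial>HI) < \<infinity>"
      by (simp add: HI.emeasure_space_1 ennreal_power[symmetric])
  qed simp
  then show ?thesis
    by (subst (asm) nn_integral_Phi_partial_sum) (auto simp: \<alpha>_pos \<sigma>2_pos)
qed

text \<open>An infinite sum is sent to 0 by \<open>enn2real\<close>; this occurs only on a null set and keeps
  \<open>T\<close> real and at least \<open>\<sigma>2\<close> everywhere.\<close>
definition T :: "(nat \<Rightarrow> nat \<Rightarrow> complex) \<Rightarrow> nat \<Rightarrow> real" where
  "T \<xi> k = \<sigma>2 + enn2real (\<Sum>l. ennreal (\<alpha> l * (cmod (\<xi> l k))\<^sup>2))"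

lemma T_ge: "T \<xi> k \<ge> \<sigma>2" by (simp add: T_def)
lemma T_pos: "T \<xi> k > 0" using T_ge[of \<xi> k] \<sigma>2_pos by linarith

lemma measurable_xi: "k \<in> I \<Longrightarrow> (\<lambda>\<xi>. \<xi> l k) \<in> borel_measurable S"
proof -
  have s: "sets S = sets (\<Pi>\<^sub>M l\<in>(UNIV :: nat set). \<Pi>\<^sub>M k\<in>I. (borel :: complex measure))"
    by (intro sets_PiM_cong sets_Q) auto
  show "k \<in> I \<Longrightarrow> (\<lambda>\<xi>. \<xi> l k) \<in> borel_measurable S"
    unfolding measurable_cong_sets[OF s refl] by (rule measurable_fading_component) auto
qed

lemma measurable_T: "k \<in> I \<Longrightarrow> (\<lambda>\<xi>. T \<xi> k) \<in> borel_measurable S"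
proof -
  assume [simp]: "k \<in> I"
  have [measurable]: "(\<lambda>\<xi>. \<xi> l k) \<in> borel_measurable S" for l by (rule measurable_xi) fact
  show ?thesis unfolding T_def by measurable
qed

lemma measurable_T' [measurable (raw)]:
  assumes "f \<in> M \<rightarrow>\<^sub>M S" "k \<in> I"
  shows "(\<lambda>\<omega>. T (f \<omega>) k) \<in> borel_measurable M"
  using measurable_compose[OF assms(1) measurable_T[OF assms(2)]] .

lemma measurable_Q_component:
  assumes "f \<in> M \<rightarrow>\<^sub>M Q" "k \<in> I"
  shows "(\<lambda>\<omega>. f \<omega> k) \<in> borel_measurable M"
proof -
  have "(\<lambda>x. x k) \<in> borel_measurable Q" using assms(2) by measurable
  from measurable_compose[OF assms(1) this] show ?thesis .
qed

text \<open>Both sides are limits of the sequence in \<open>Phi_partial_sum_limit\<close>. Finite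
  power rules out the default value of \<open>enn2real\<close>, so the partial variances do converge
  to \<open>T \<xi>\<close>.\<close>

lemma nn_integral_interference_Phi:
  assumes s: "AE hi in HI. \<forall>k\<in>I. summable (\<lambda>l. hi l k * \<xi> l k)"
    and fin: "\<And>k. k \<in> I \<Longrightarrow> (\<Sum>l. ennreal (\<alpha> l * (cmod (\<xi> l k))\<^sup>2)) < \<infinity>"
  shows "(\<integral>\<^sup>+ hi. ennreal (Phi I (\<lambda>_. \<sigma>2) (\<lambda>k. y k - (\<Sum>l. hi l k * \<xi> l k))) \<partial>HI) = ennreal (Phi I (T \<xi>) y)"
proof (rule LIMSEQ_unique[OF Phi_partial_sum_limit[OF s]])
  have "(\<lambda>m. \<sigma>2 + (\<Sum>l<m. \<alpha> l * (cmod (\<xi> l k))\<^sup>2)) \<longlonglongrightarrow> T \<xi> k" if k: "k \<in> I" for k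
  proof -
    have nn: "\<alpha> l * (cmod (\<xi> l k))\<^sup>2 \<ge> 0" for l using \<alpha>_pos[of l] by simp
    have sm: "summable (\<lambda>l. \<alpha> l * (cmod (\<xi> l k))\<^sup>2)"
      using fin[OF k] nn by (intro summable_suminf_not_top) auto
    then have "T \<xi> k = \<sigma>2 + (\<Sum>l. \<alpha> l * (cmod (\<xi> l k))\<^sup>2)"
      unfolding T_def by (subst suminf_ennreal2) (auto simp: nn suminf_nonneg)
    then show ?thesis using summable_LIMSEQ[OF sm] by (auto intro!: tendsto_intros)
  qed
  then show "(\<lambda>m. ennreal (Phi I (\<lambda>k. \<sigma>2 + (\<Sum>l<m. \<alpha> l * (cmod (\<xi> l k))\<^sup>2)) y)) \<longlonglongrightarrow> ennreal (Phi I (T \<xi>) y)"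
    unfolding Phi_def phi_def using T_pos less_imp_neq[OF T_pos]
    by (intro tendsto_ennrealI tendsto_prod tendsto_intros) (auto simp: less_imp_neq[symmetric])
qed

end

text \<open>For a single constant symbol 1, the noisy partial sums have density \<open>1 / (pi * (\<sigma>2 + \<Sum>l<m. \<alpha> l))\<close>
  at 0, which would tend to 0 although the density of the limit is positive there.\<close>
lemma summable_interference_powers:
  assumes conv: "interference_converges \<alpha> \<sigma>2" and \<alpha>_pos: "\<And>l. \<alpha> l > 0" and \<sigma>2_pos: "\<sigma>2 > 0"
  shows "summable \<alpha>"
proof (rule ccontr)
  assume ns: "\<not> summable \<alpha>"
  \<comment> \<open>A block of length one carrying the symbol 1 has power exactly 1, hence is
    admissible for power 1. Each interferer then contributes its full fading variance.\<close>
  define c :: "nat \<Rightarrow> complex" where "c = (\<lambda>k\<in>{1..1}. 1)"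
  define Q where "Q = return (block_space 1) c"
  have cs: "c \<in> space (block_space 1)" by (simp add: c_def space_PiM)
  interpret interference_channel \<alpha> \<sigma>2 1 Q
    unfolding Q_def by (rule interference_channel.intro) (rule prob_space_return[OF cs], auto simp: \<alpha>_pos \<sigma>2_pos)
  have "(\<integral>\<^sup>+ x. ennreal (1 / real 1 * (\<Sum>k=1..1. (cmod (x k))\<^sup>2)) \<partial>Q) = 1"
    unfolding Q_def by (subst nn_integral_return) (auto simp: c_def space_PiM)
  then have "Q \<in> input_laws 1 1"
    using prob_Q sets_Q by (simp add: input_laws_def)
  then have "AE \<omega> in channel_space \<alpha> \<sigma>2 1 Q. \<forall>k\<in>{1..1}. summable (interference_terms \<omega> k)"
    using conv[unfolded interference_converges_def, THEN spec[of _ 1], THEN spec[of _ 1], THEN mp, OF zero_less_one] by (rule bspec[rotated])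
  from interference_terms_summable_AE[OF this]
  have a: "AE \<xi> in S. AE hi in HI. \<forall>k\<in>{1..1}. summable (\<lambda>l. hi l k * \<xi> l k)" .
  have b: "AE \<xi> in S. \<forall>l. \<xi> l 1 = 1"
  proof (subst AE_all_countable, intro allI)
    fix l
    have "AE x in Q. x 1 = 1" unfolding Q_def
      by (subst AE_return) (auto simp: c_def space_PiM)
    from S.AE_component[OF _ this, of l] show "AE \<xi> in S. \<xi> l 1 = 1" by simp
  qed
  have "AE \<xi> in S. False" using a b
  proof eventually_elim
    case (elim \<xi>)
    let ?R = "\<integral>\<^sup>+ hi. ennreal (Phi I (\<lambda>_. \<sigma>2) (\<lambda>k. 0 - (\<Sum>l. hi l k * \<xi> l k))) \<partial>HI"
    have "(\<lambda>m. ennreal (Phi I (\<lambda>k. \<sigma>2 + (\<Sum>l<m. \<alpha> l * (cmod (\<xi> l k))\<^sup>2)) (\<lambda>_. 0))) \<longlonglongrightarrow> ?R"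
      using Phi_partial_sum_limit[OF elim(1), of "\<lambda>_. 0"] by simp
    then have "(\<lambda>m. ennreal (1 / (pi * (\<sigma>2 + (\<Sum>l<m. \<alpha> l))))) \<longlonglongrightarrow> ?R"
      using elim(2) by (simp add: Phi_def phi_def)
    moreover have "(\<lambda>m. ennreal (1 / (pi * (\<sigma>2 + (\<Sum>l<m. \<alpha> l))))) \<longlonglongrightarrow> ennreal 0"
    proof (intro tendsto_ennrealI)
      have "filterlim (\<lambda>m. \<Sum>l<m. \<alpha> l) at_top sequentially"
        unfolding filterlim_at_top eventually_sequentially
      proof
        fix c
        have "\<exists>m. (\<Sum>l<m. \<alpha> l) > c"
        proof (rule ccontr)
          assume "\<not> ?thesis"
          then have "summable \<alpha>"
            using \<alpha>_pos by (intro summableI_nonneg_bounded[where x = c]) (auto simp: not_less less_imp_le)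
          with ns show False ..
        qed
        then obtain m where m: "(\<Sum>l<m. \<alpha> l) > c" ..
        have "c \<le> (\<Sum>l<m'. \<alpha> l)" if "m' \<ge> m" for m'
        proof -
          have "(\<Sum>l<m. \<alpha> l) \<le> (\<Sum>l<m'. \<alpha> l)"
            using that \<alpha>_pos by (intro sum_mono2) (auto simp: less_imp_le)
          with m show ?thesis by linarith
        qed
        then show "\<exists>m. \<forall>m'\<ge>m. c \<le> (\<Sum>l<m'. \<alpha> l)" by blast
      qed
      then have "filterlim (\<lambda>m. pi * (\<sigma>2 + (\<Sum>l<m. \<alpha> l))) at_top sequentially"
        by (intro filterlim_tendsto_pos_mult_at_top[OF tendsto_const] filterlim_tendsto_add_at_top[OF tendsto_const]) auto
      then show "(\<lambda>m. 1 / (pi * (\<sigma>2 + (\<Sum>l<m. \<alpha> l)))) \<longlonglongrightarrow> 0"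
        by (intro real_tendsto_divide_at_top[OF tendsto_const])
    qed
    ultimately have "?R = ennreal 0" by (rule LIMSEQ_unique)
    then have "?R = 0" by simp
    then have "AE hi in HI. ennreal (Phi I (\<lambda>_. \<sigma>2) (\<lambda>k. 0 - (\<Sum>l. hi l k * \<xi> l k))) = 0"
      unfolding nn_integral_0_iff_AE[OF measurable_Phi_interference] .
    then have "AE hi in HI. False"
      by (rule eventually_mono) (unfold ennreal_eq_0_iff, use Phi_pos[of I "\<lambda>_. \<sigma>2", OF \<sigma>2_pos] in \<open>blast dest: not_le[THEN iffD2]\<close>)
    then show False by simp
  qed
  then show False by simp
qed

text \<open>Of the power constraint only the finiteness of second moments is kept, so the value of
  the power cannot enter the bound on the information.\<close>

locale interference_block = interference_channel +
  assumes interference_summable: "AE \<omega> in channel_space \<alpha> \<sigma>2 n Q. \<forall>k\<in>{1..n}. summable (interference_terms \<omega> k)"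
    and \<alpha>_summable: "summable \<alpha>"
    and finite_power: "\<And>k. k \<in> {1..n} \<Longrightarrow> (\<integral>\<^sup>+ x. ennreal ((cmod (x k))\<^sup>2) \<partial>Q) < \<infinity>"
begin

lemma nn_integral_S_component:
  assumes [measurable]: "f \<in> borel_measurable Q"
  shows "(\<integral>\<^sup>+ \<xi>. f (\<xi> l) \<partial>S) = (\<integral>\<^sup>+ x. f x \<partial>Q)"
  by (subst (2) S.PiM_component[of l, symmetric]) (simp_all add: nn_integral_distr)

lemma measurable_Q_sq [measurable]: "k \<in> I \<Longrightarrow> (\<lambda>x. ennreal ((cmod (x k))\<^sup>2)) \<in> borel_measurable Q"
  by measurable

text \<open>Since the interferers have a common law, the mean is the sum of all
  \<open>\<alpha> l\<close> times the second moment of one symbol.\<close>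

lemma nn_integral_interference_power:
  assumes k: "k \<in> I"
  shows "(\<integral>\<^sup>+ \<xi>. (\<Sum>l. ennreal (\<alpha> l * (cmod (\<xi> l k))\<^sup>2)) \<partial>S) < \<infinity>"
proof -
  have [measurable]: "(\<lambda>\<xi>. \<xi> l k) \<in> borel_measurable S" for l by (rule measurable_xi[OF k])
  have "(\<integral>\<^sup>+ \<xi>. (\<Sum>l. ennreal (\<alpha> l * (cmod (\<xi> l k))\<^sup>2)) \<partial>S) = (\<Sum>l. \<integral>\<^sup>+ \<xi>. ennreal (\<alpha> l * (cmod (\<xi> l k))\<^sup>2) \<partial>S)"
    by (intro nn_integral_suminf) measurable
  also have "\<dots> = (\<Sum>l. ennreal (\<alpha> l) * (\<integral>\<^sup>+ x. ennreal ((cmod (x k))\<^sup>2) \<partial>Q))"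
  proof (intro suminf_cong)
    fix l
    have "(\<integral>\<^sup>+ \<xi>. ennreal (\<alpha> l * (cmod (\<xi> l k))\<^sup>2) \<partial>S) = (\<integral>\<^sup>+ \<xi>. ennreal (\<alpha> l) * ennreal ((cmod (\<xi> l k))\<^sup>2) \<partial>S)"
      using \<alpha>_pos[of l] by (simp add: ennreal_mult)
    also have "\<dots> = ennreal (\<alpha> l) * (\<integral>\<^sup>+ \<xi>. ennreal ((cmod (\<xi> l k))\<^sup>2) \<partial>S)"
      by (intro nn_integral_cmult) measurable
    finally show "(\<integral>\<^sup>+ \<xi>. ennreal (\<alpha> l * (cmod (\<xi> l k))\<^sup>2) \<partial>S) = ennreal (\<alpha> l) * (\<integral>\<^sup>+ x. ennreal ((cmod (x k))\<^sup>2) \<partial>Q)"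
      using nn_integral_S_component[OF measurable_Q_sq[OF k], of l] by simp
  qed
  also have "\<dots> = (\<Sum>l. ennreal (\<alpha> l)) * (\<integral>\<^sup>+ x. ennreal ((cmod (x k))\<^sup>2) \<partial>Q)"
    by simp
  also have "\<dots> < \<infinity>"
    using finite_power[OF k] \<alpha>_summable \<alpha>_pos
    by (auto simp: ennreal_mult_less_top less_imp_le suminf_ennreal2)
  finally show ?thesis .
qed

lemma interference_power_finite_AE: "AE \<xi> in S. \<forall>k\<in>I. (\<Sum>l. ennreal (\<alpha> l * (cmod (\<xi> l k))\<^sup>2)) < \<infinity>"
proof (intro AE_finite_allI)
  fix k assume k: "k \<in> I"
  have [measurable]: "(\<lambda>\<xi>. \<xi> l k) \<in> borel_measurable S" for l by (rule measurable_xi[OF k])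
  have "(\<lambda>\<xi>. (\<Sum>l. ennreal (\<alpha> l * (cmod (\<xi> l k))\<^sup>2))) \<in> borel_measurable S" by measurable
  from nn_integral_PInf_AE[OF this] nn_integral_interference_power[OF k]
  show "AE \<xi> in S. (\<Sum>l. ennreal (\<alpha> l * (cmod (\<xi> l k))\<^sup>2)) < \<infinity>"
    by (simp add: less_top)
qed simp

lemma nn_integral_T: 
  assumes k: "k \<in> I"
  shows "(\<integral>\<^sup>+ \<xi>. ennreal (T \<xi> k) \<partial>S) < \<infinity>"
proof -
  have [measurable]: "(\<lambda>\<xi>. \<xi> l k) \<in> borel_measurable S" for l by (rule measurable_xi[OF k])
  have "(\<integral>\<^sup>+ \<xi>. ennreal (T \<xi> k) \<partial>S) \<le> (\<integral>\<^sup>+ \<xi>. ennreal \<sigma>2 + (\<Sum>l. ennreal (\<alpha> l * (cmod (\<xi> l k))\<^sup>2)) \<partial>S)"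
  proof (intro nn_integral_mono)
    fix \<xi>
    have "ennreal (T \<xi> k) = ennreal \<sigma>2 + ennreal (enn2real (\<Sum>l. ennreal (\<alpha> l * (cmod (\<xi> l k))\<^sup>2)))"
      unfolding T_def using \<sigma>2_pos by (intro ennreal_plus) auto
    \<comment> \<open>The default 0 of \<open>enn2real\<close> at an infinite sum only lowers the
      left side.\<close>
    also have "\<dots> \<le> ennreal \<sigma>2 + (\<Sum>l. ennreal (\<alpha> l * (cmod (\<xi> l k))\<^sup>2))"
      by (intro add_left_mono) (auto simp: ennreal_enn2real_if)
    finally show "ennreal (T \<xi> k) \<le> ennreal \<sigma>2 + (\<Sum>l. ennreal (\<alpha> l * (cmod (\<xi> l k))\<^sup>2))" .
  qed
  also have "\<dots> = ennreal \<sigma>2 + (\<integral>\<^sup>+ \<xi>. (\<Sum>l. ennreal (\<alpha> l * (cmod (\<xi> l k))\<^sup>2)) \<partial>S)"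
    by (subst nn_integral_add) (auto simp: S.emeasure_space_1)
  also have "\<dots> < \<infinity>" using nn_integral_interference_power[OF k] by simp
  finally show ?thesis .
qed

section \<open>Densities of the output and of interference plus noise\<close>

definition V :: "(nat \<Rightarrow> complex) \<Rightarrow> (nat \<Rightarrow> nat \<Rightarrow> complex) \<Rightarrow> nat \<Rightarrow> real" where
  "V x \<xi> k = T \<xi> k + (cmod (x k))\<^sup>2"

lemma V_ge: "V x \<xi> k \<ge> \<sigma>2" using T_ge[of \<xi> k] by (simp add: V_def add_increasing2)
lemma V_pos: "V x \<xi> k > 0" using V_ge[of x \<xi> k] \<sigma>2_pos by linarith

lemma measurable_V [measurable (raw)]:
  assumes "f \<in> M \<rightarrow>\<^sub>M Q" "g \<in> M \<rightarrow>\<^sub>M S" "k \<in> I"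
  shows "(\<lambda>\<omega>. V (f \<omega>) (g \<omega>) k) \<in> borel_measurable M"
  unfolding V_def using assms measurable_Q_component[of f M k] by measurable

text \<open>Given the transmitted block, the output is a mixture of Gaussians over the interferers'
  symbols; \<open>out_density\<close>, the \<open>p\<close> of the overview, mixes over the input as
  well. Real values allow logarithms and quotients, and the uniform bound
  \<open>density_bound\<close> shows that \<open>enn2real\<close> loses nothing.\<close>

definition cond_density :: "(nat \<Rightarrow> complex) \<Rightarrow> (nat \<Rightarrow> complex) \<Rightarrow> real" where
  "cond_density x y = enn2real (\<integral>\<^sup>+ \<xi>. ennreal (Phi I (V x \<xi>) y) \<partial>S)"

definition out_density :: "(nat \<Rightarrow> complex) \<Rightarrow> real" where
  "out_density y = enn2real (\<integral>\<^sup>+ x. ennreal (cond_density x y) \<partial>Q)"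

definition density_bound :: real where "density_bound = (1 / (pi * \<sigma>2)) ^ n"

lemma density_bound_pos: "density_bound > 0" using \<sigma>2_pos by (simp add: density_bound_def)

lemma Phi_V_le: "Phi I (V x \<xi>) y \<le> density_bound"
  unfolding density_bound_def by (intro Phi_sigma2_le V_ge)

lemma ennreal_cond_density: "ennreal (cond_density x y) = (\<integral>\<^sup>+ \<xi>. ennreal (Phi I (V x \<xi>) y) \<partial>S)"
  and cond_density_le: "cond_density x y \<le> density_bound"
proof -
  have *: "(\<integral>\<^sup>+ \<xi>. ennreal (Phi I (V x \<xi>) y) \<partial>S) \<le> ennreal density_bound"
    using nn_integral_mono[of S "\<lambda>\<xi>. ennreal (Phi I (V x \<xi>) y)" "\<lambda>_. ennreal density_bound"]
    by (simp add: S.emeasure_space_1 Phi_V_le ennreal_leI)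
  then have "\<dots> < top" using le_less_trans by fastforce
  then show "ennreal (cond_density x y) = (\<integral>\<^sup>+ \<xi>. ennreal (Phi I (V x \<xi>) y) \<partial>S)"
    unfolding cond_density_def using * by (intro ennreal_enn2real) (auto intro: le_less_trans)
  with * show "cond_density x y \<le> density_bound" using density_bound_pos by (metis ennreal_le_iff less_imp_le)
qed

lemma measurable_cond_density [measurable (raw)]:
  assumes [measurable]: "u \<in> M \<rightarrow>\<^sub>M Q" "w \<in> M \<rightarrow>\<^sub>M B"
  shows "(\<lambda>\<omega>. cond_density (u \<omega>) (w \<omega>)) \<in> borel_measurable M"
  unfolding cond_density_def by measurable

lemma cond_density_nonneg: "cond_density x y \<ge> 0" by (simp add: cond_density_def)

lemma ennreal_out_density: "ennreal (out_density y) = (\<integral>\<^sup>+ x. ennreal (cond_density x y) \<partial>Q)"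
  and out_density_le: "out_density y \<le> density_bound"
proof -
  have *: "(\<integral>\<^sup>+ x. ennreal (cond_density x y) \<partial>Q) \<le> ennreal density_bound"
    using nn_integral_mono[of Q "\<lambda>x. ennreal (cond_density x y)" "\<lambda>_. ennreal density_bound"]
    by (simp add: Q.emeasure_space_1 cond_density_le ennreal_leI)
  then show "ennreal (out_density y) = (\<integral>\<^sup>+ x. ennreal (cond_density x y) \<partial>Q)"
    unfolding out_density_def using * by (intro ennreal_enn2real) (auto intro: le_less_trans)
  with * show "out_density y \<le> density_bound" using density_bound_pos by (metis ennreal_le_iff less_imp_le)
qed

lemma measurable_out_density [measurable]: "out_density \<in> borel_measurable B"
  unfolding out_density_def by measurable

section \<open>The joint law of input and output\<close>

lemma nn_integral_channel:
  assumes G: "G \<in> borel_measurable (channel_space \<alpha> \<sigma>2 n Q)"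
  shows "(\<integral>\<^sup>+ \<omega>. G \<omega> \<partial>channel_space \<alpha> \<sigma>2 n Q) = (\<integral>\<^sup>+ x. \<integral>\<^sup>+ \<xi>. \<integral>\<^sup>+ h. \<integral>\<^sup>+ hi. \<integral>\<^sup>+ z. G (x, \<xi>, h, hi, z) \<partial>Z \<partial>HI \<partial>\<Gamma> \<partial>S \<partial>Q)"
proof -
  note [measurable] = G[unfolded channel_space_def]
  have "(\<integral>\<^sup>+ \<omega>. G \<omega> \<partial>channel_space \<alpha> \<sigma>2 n Q) = (\<integral>\<^sup>+ x. \<integral>\<^sup>+ w. G (x, w) \<partial>(S \<Otimes>\<^sub>M \<Gamma> \<Otimes>\<^sub>M HI \<Otimes>\<^sub>M Z) \<partial>Q)"
    unfolding channel_space_def by (intro SGHZ.nn_integral_fst[symmetric]) measurable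
  also have "\<dots> = (\<integral>\<^sup>+ x. \<integral>\<^sup>+ \<xi>. \<integral>\<^sup>+ w. G (x, \<xi>, w) \<partial>(\<Gamma> \<Otimes>\<^sub>M HI \<Otimes>\<^sub>M Z) \<partial>S \<partial>Q)"
    by (intro nn_integral_cong GHZ.nn_integral_fst[symmetric]) measurable
  also have "\<dots> = (\<integral>\<^sup>+ x. \<integral>\<^sup>+ \<xi>. \<integral>\<^sup>+ h. \<integral>\<^sup>+ w. G (x, \<xi>, h, w) \<partial>(HI \<Otimes>\<^sub>M Z) \<partial>\<Gamma> \<partial>S \<partial>Q)"
    by (intro nn_integral_cong HZ.nn_integral_fst[symmetric]) measurable
  also have "\<dots> = (\<integral>\<^sup>+ x. \<integral>\<^sup>+ \<xi>. \<integral>\<^sup>+ h. \<integral>\<^sup>+ hi. \<integral>\<^sup>+ z. G (x, \<xi>, h, hi, z) \<partial>Z \<partial>HI \<partial>\<Gamma> \<partial>S \<partial>Q)"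
    by (intro nn_integral_cong Z.nn_integral_fst[symmetric]) measurable
  finally show ?thesis .
qed

lemma nn_integral_noise_translate:
  assumes v: "\<And>k. v k > 0" and [measurable]: "F \<in> borel_measurable B"
  shows "(\<integral>\<^sup>+ z. ennreal (Phi I v z) * F (\<lambda>k\<in>I. a k + z k) \<partial>L) = (\<integral>\<^sup>+ y. ennreal (Phi I v (\<lambda>k. y k - a k)) * F y \<partial>L)"
proof -
  have "(\<integral>\<^sup>+ y. ennreal (Phi I v (\<lambda>k. y k - a k)) * F y \<partial>L) = (\<integral>\<^sup>+ z. ennreal (Phi I v (\<lambda>k. (\<lambda>k\<in>I. a k + z k) k - a k)) * F (\<lambda>k\<in>I. a k + z k) \<partial>L)"
    by (rule nn_integral_block_lborel_translate[symmetric]) measurable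
  also have "\<dots> = (\<integral>\<^sup>+ z. ennreal (Phi I v z) * F (\<lambda>k\<in>I. a k + z k) \<partial>L)"
    by (intro nn_integral_cong arg_cong2[where f="(*)"] arg_cong[where f=ennreal] Phi_cong) auto
  finally show ?thesis ..
qed

sublocale SL: pair_sigma_finite S L ..
sublocale GL: pair_sigma_finite \<Gamma> L ..
sublocale HL: pair_sigma_finite HI L ..
sublocale QL: pair_sigma_finite Q L ..

text \<open>For fixed fading the transmitted symbols merely translate the density. Averaging over
  the fading, of variance one, then adds \<open>(cmod (x k))\<^sup>2\<close> to the variance at time
  \<open>k\<close>.\<close>

lemma nn_integral_Gamma_kernel:
  assumes v: "\<And>k. v k > 0" and F [measurable]: "F \<in> borel_measurable B"
  shows "(\<integral>\<^sup>+ h. \<integral>\<^sup>+ z. ennreal (Phi I v z) * F (\<lambda>k\<in>I. h k * x k + z k) \<partial>L \<partial>\<Gamma>) = (\<integral>\<^sup>+ y. ennreal (Phi I (\<lambda>k. v k + (cmod (x k))\<^sup>2) y) * F y \<partial>L)"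
proof -
  have "(\<integral>\<^sup>+ h. \<integral>\<^sup>+ z. ennreal (Phi I v z) * F (\<lambda>k\<in>I. h k * x k + z k) \<partial>L \<partial>\<Gamma>)
    = (\<integral>\<^sup>+ h. \<integral>\<^sup>+ y. ennreal (Phi I v (\<lambda>k. y k - h k * x k)) * F y \<partial>L \<partial>\<Gamma>)"
    by (intro nn_integral_cong nn_integral_noise_translate v F)
  also have "\<dots> = (\<integral>\<^sup>+ y. \<integral>\<^sup>+ h. ennreal (Phi I v (\<lambda>k. y k - h k * x k)) * F y \<partial>\<Gamma> \<partial>L)"
    by (rule GL.Fubini'[symmetric]) measurable
  also have "\<dots> = (\<integral>\<^sup>+ y. (\<integral>\<^sup>+ h. ennreal (Phi I v (\<lambda>k. y k - h k * x k)) \<partial>\<Gamma>) * F y \<partial>L)"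
    by (intro nn_integral_cong nn_integral_multc) measurable
  also have "\<dots> = (\<integral>\<^sup>+ y. ennreal (Phi I (\<lambda>k. v k + (cmod (x k))\<^sup>2) y) * F y \<partial>L)"
    by (simp add: nn_integral_Phi_convolution v)
  finally show ?thesis .
qed

lemma nn_integral_interference_law:
  assumes s: "AE hi in HI. \<forall>k\<in>I. summable (\<lambda>l. hi l k * \<xi> l k)"
    and fin: "\<And>k. k \<in> I \<Longrightarrow> (\<Sum>l. ennreal (\<alpha> l * (cmod (\<xi> l k))\<^sup>2)) < \<infinity>"
    and F [measurable]: "F \<in> borel_measurable B"
  shows "(\<integral>\<^sup>+ hi. \<integral>\<^sup>+ z. F (\<lambda>k\<in>I. (\<Sum>l. hi l k * \<xi> l k) + z k) \<partial>Z \<partial>HI) = (\<integral>\<^sup>+ y. ennreal (Phi I (T \<xi>) y) * F y \<partial>L)"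
proof -
  have "(\<integral>\<^sup>+ hi. \<integral>\<^sup>+ z. F (\<lambda>k\<in>I. (\<Sum>l. hi l k * \<xi> l k) + z k) \<partial>Z \<partial>HI)
    = (\<integral>\<^sup>+ hi. \<integral>\<^sup>+ z. ennreal (Phi I (\<lambda>_. \<sigma>2) z) * F (\<lambda>k\<in>I. (\<Sum>l. hi l k * \<xi> l k) + z k) \<partial>L \<partial>HI)"
    by (intro nn_integral_cong nn_integral_PiM_complex_gaussian \<sigma>2_pos) measurable
  also have "\<dots> = (\<integral>\<^sup>+ hi. \<integral>\<^sup>+ y. ennreal (Phi I (\<lambda>_. \<sigma>2) (\<lambda>k. y k - (\<Sum>l. hi l k * \<xi> l k))) * F y \<partial>L \<partial>HI)"
    by (intro nn_integral_cong nn_integral_noise_translate \<sigma>2_pos F)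
  also have "\<dots> = (\<integral>\<^sup>+ y. \<integral>\<^sup>+ hi. ennreal (Phi I (\<lambda>_. \<sigma>2) (\<lambda>k. y k - (\<Sum>l. hi l k * \<xi> l k))) * F y \<partial>HI \<partial>L)"
  proof (rule HL.Fubini'[symmetric])
    have *: "(\<lambda>\<omega>. \<Sum>l. fst \<omega> l k * \<xi> l k) \<in> borel_measurable (HI \<Otimes>\<^sub>M L)" if "k \<in> I" for k
      by (rule measurable_compose[OF measurable_fst measurable_interference[OF that]])
    have "(\<lambda>\<omega>. F (snd \<omega>)) \<in> borel_measurable (HI \<Otimes>\<^sub>M L)"
      by (rule measurable_compose[OF measurable_snd]) measurable
    then show "(\<lambda>(hi, y). ennreal (Phi I (\<lambda>_. \<sigma>2) (\<lambda>k. y k - (\<Sum>l. hi l k * \<xi> l k))) * F y) \<in> borel_measurable (HI \<Otimes>\<^sub>M L)"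
      unfolding case_prod_beta
      by (intro borel_measurable_times_ennreal measurable_compose[OF _ measurable_ennreal] Phi_measurable borel_measurable_diff *) auto
  qed
  also have "\<dots> = (\<integral>\<^sup>+ y. (\<integral>\<^sup>+ hi. ennreal (Phi I (\<lambda>_. \<sigma>2) (\<lambda>k. y k - (\<Sum>l. hi l k * \<xi> l k))) \<partial>HI) * F y \<partial>L)"
    by (intro nn_integral_cong nn_integral_multc measurable_Phi_interference)
  also have "\<dots> = (\<integral>\<^sup>+ y. ennreal (Phi I (T \<xi>) y) * F y \<partial>L)"
    by (simp only: nn_integral_interference_Phi[OF s fin])
  finally show ?thesis .
qed

lemma nn_integral_cond_density:
  assumes x: "x \<in> space Q" and F [measurable]: "F \<in> borel_measurable B"
  shows "(\<integral>\<^sup>+ y. ennreal (cond_density x y) * F y \<partial>L) = (\<integral>\<^sup>+ \<xi>. \<integral>\<^sup>+ y. ennreal (Phi I (V x \<xi>) y) * F y \<partial>L \<partial>S)"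
proof -
  have "(\<integral>\<^sup>+ y. ennreal (cond_density x y) * F y \<partial>L) = (\<integral>\<^sup>+ y. \<integral>\<^sup>+ \<xi>. ennreal (Phi I (V x \<xi>) y) * F y \<partial>S \<partial>L)"
    using x unfolding ennreal_cond_density by (intro nn_integral_cong nn_integral_multc[symmetric]) measurable
  also have "\<dots> = (\<integral>\<^sup>+ \<xi>. \<integral>\<^sup>+ y. ennreal (Phi I (V x \<xi>) y) * F y \<partial>L \<partial>S)"
    using x by (intro SL.Fubini') measurable
  finally show ?thesis .
qed

lemma nn_integral_cond_density_scale:
  assumes x: "x \<in> space Q" and F [measurable]: "F \<in> borel_measurable B"
  shows "(\<integral>\<^sup>+ y. ennreal (cond_density x y) * F y \<partial>L) = (\<integral>\<^sup>+ \<xi>. \<integral>\<^sup>+ e. F (\<lambda>k\<in>I. of_real (sqrt (V x \<xi> k)) * e k) \<partial>\<Gamma> \<partial>S)"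
  unfolding nn_integral_cond_density[OF assms] by (intro nn_integral_cong nn_integral_Phi_scale V_pos F) simp

definition zero_block :: "nat \<Rightarrow> complex" where "zero_block = (\<lambda>k\<in>I. 0)"

lemma zero_block_space [measurable, simp]: "zero_block \<in> space Q"
  unfolding sets_eq_imp_space_eq[OF sets_Q] by (auto simp: zero_block_def space_PiM)

text \<open>Interference plus noise is the output of a silent transmitter. The \<open>g\<close> of
  the overview is thus an instance of \<open>cond_density\<close> and inherits its positivity,
  bounds and normalisation.\<close>

definition noise_density :: "(nat \<Rightarrow> complex) \<Rightarrow> real" where "noise_density = cond_density zero_block"

lemma V_zero_block: "k \<in> I \<Longrightarrow> V zero_block \<xi> k = T \<xi> k"
  by (simp add: V_def zero_block_def)

lemma ennreal_noise_density: "ennreal (noise_density y) = (\<integral>\<^sup>+ \<xi>. ennreal (Phi I (T \<xi>) y) \<partial>S)"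
  unfolding noise_density_def ennreal_cond_density by (intro nn_integral_cong arg_cong[where f=ennreal] Phi_cong V_zero_block refl)

lemma measurable_noise_density [measurable]: "noise_density \<in> borel_measurable B"
  unfolding noise_density_def by measurable

lemma nn_integral_cond_density_eq_1: "x \<in> space Q \<Longrightarrow> (\<integral>\<^sup>+ y. ennreal (cond_density x y) \<partial>L) = 1"
  using nn_integral_cond_density_scale[of x "\<lambda>_. 1"] by (simp add: \<Gamma>.emeasure_space_1 S.emeasure_space_1)

lemma nn_integral_T_eq:
  assumes F [measurable]: "F \<in> borel_measurable B"
  shows "(\<integral>\<^sup>+ \<xi>. \<integral>\<^sup>+ y. ennreal (Phi I (T \<xi>) y) * F y \<partial>L \<partial>S) = (\<integral>\<^sup>+ y. ennreal (noise_density y) * F y \<partial>L)"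
  unfolding noise_density_def nn_integral_cond_density[OF zero_block_space F]
  by (intro nn_integral_cong arg_cong2[where f="(*)"] arg_cong[where f=ennreal] Phi_cong V_zero_block[symmetric] refl)

text \<open>The interferers' symbols are independent of the transmitter's fading, so they can be
  averaged before or after the faded symbols are added. The left side exhibits the output as
  \<open>h x + W\<close> with \<open>W\<close> of density \<open>noise_density\<close>, the form
  used to compare \<open>h(Y|X)\<close> with \<open>h(W)\<close>.\<close>

lemma nn_integral_fading_interference:
  assumes x [measurable]: "x \<in> space Q" and F [measurable]: "F \<in> borel_measurable B"
  shows "(\<integral>\<^sup>+ h. \<integral>\<^sup>+ w. ennreal (noise_density w) * F (\<lambda>k\<in>I. h k * x k + w k) \<partial>L \<partial>\<Gamma>) = (\<integral>\<^sup>+ y. ennreal (cond_density x y) * F y \<partial>L)"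
proof -
  interpret GS: pair_sigma_finite \<Gamma> S ..
  have "(\<integral>\<^sup>+ h. \<integral>\<^sup>+ w. ennreal (noise_density w) * F (\<lambda>k\<in>I. h k * x k + w k) \<partial>L \<partial>\<Gamma>)
    = (\<integral>\<^sup>+ h. \<integral>\<^sup>+ \<xi>. \<integral>\<^sup>+ w. ennreal (Phi I (T \<xi>) w) * F (\<lambda>k\<in>I. h k * x k + w k) \<partial>L \<partial>S \<partial>\<Gamma>)"
    by (intro nn_integral_cong nn_integral_T_eq[symmetric]) measurable
  also have "\<dots> = (\<integral>\<^sup>+ \<xi>. \<integral>\<^sup>+ h. \<integral>\<^sup>+ w. ennreal (Phi I (T \<xi>) w) * F (\<lambda>k\<in>I. h k * x k + w k) \<partial>L \<partial>\<Gamma> \<partial>S)"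
    by (rule GS.Fubini'[symmetric]) measurable
  also have "\<dots> = (\<integral>\<^sup>+ \<xi>. \<integral>\<^sup>+ y. ennreal (Phi I (V x \<xi>) y) * F y \<partial>L \<partial>S)"
    unfolding V_def by (intro nn_integral_cong nn_integral_Gamma_kernel T_pos F)
  also have "\<dots> = (\<integral>\<^sup>+ y. ennreal (cond_density x y) * F y \<partial>L)"
    by (rule nn_integral_cond_density[symmetric]) fact+
  finally show ?thesis .
qed

lemma measurable_channel_input [measurable]: "channel_input \<in> channel_space \<alpha> \<sigma>2 n Q \<rightarrow>\<^sub>M Q"
proof -
  have "channel_input = fst" by (auto simp: fun_eq_iff)
  then show ?thesis by (simp add: channel_space_def)
qed

lemma measurable_channel_output [measurable]: "channel_output n \<in> channel_space \<alpha> \<sigma>2 n Q \<rightarrow>\<^sub>M B"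
proof -
  have "(\<lambda>\<omega>. \<lambda>k\<in>I. fst (snd (snd \<omega>)) k * fst \<omega> k + (\<Sum>l. fst (snd (snd (snd \<omega>))) l k * fst (snd \<omega>) l k) + snd (snd (snd (snd \<omega>))) k)
    \<in> channel_space \<alpha> \<sigma>2 n Q \<rightarrow>\<^sub>M B"
  proof (rule measurable_restrict)
    fix k assume k [simp]: "k \<in> I"
    have [measurable]: "(\<lambda>\<omega>. fst (snd (snd (snd \<omega>))) l k) \<in> borel_measurable (channel_space \<alpha> \<sigma>2 n Q)" for l
      unfolding channel_space_def by (rule measurable_compose[OF _ measurable_hi[OF k, of l]]) measurable
    have [measurable]: "(\<lambda>\<omega>. fst (snd \<omega>) l k) \<in> borel_measurable (channel_space \<alpha> \<sigma>2 n Q)" for l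
      unfolding channel_space_def by (rule measurable_compose[OF _ measurable_xi[OF k, of l]]) measurable
    have [measurable]: "(\<lambda>\<omega>. fst (snd (snd \<omega>)) k) \<in> borel_measurable (channel_space \<alpha> \<sigma>2 n Q)"
      "(\<lambda>\<omega>. fst \<omega> k) \<in> borel_measurable (channel_space \<alpha> \<sigma>2 n Q)"
      "(\<lambda>\<omega>. snd (snd (snd (snd \<omega>))) k) \<in> borel_measurable (channel_space \<alpha> \<sigma>2 n Q)"
      unfolding channel_space_def using k by measurable
    show "(\<lambda>\<omega>. fst (snd (snd \<omega>)) k * fst \<omega> k + (\<Sum>l. fst (snd (snd (snd \<omega>))) l k * fst (snd \<omega>) l k) + snd (snd (snd (snd \<omega>))) k)
      \<in> borel_measurable (channel_space \<alpha> \<sigma>2 n Q)"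
      by measurable
  qed
  also have "(\<lambda>\<omega>. \<lambda>k\<in>I. fst (snd (snd \<omega>)) k * fst \<omega> k + (\<Sum>l. fst (snd (snd (snd \<omega>))) l k * fst (snd \<omega>) l k) + snd (snd (snd (snd \<omega>))) k) = channel_output n"
    by (auto simp: fun_eq_iff)
  finally show ?thesis .
qed

text \<open>Grouping the output as faded symbol plus (interference plus noise) lets the two Gaussian
  kernels act in turn. The exceptional symbol sequences, for which the interference fails to
  converge almost surely in the fading or has infinite power, form a null set.\<close>

lemma nn_integral_channel_law:
  assumes F [measurable]: "F \<in> borel_measurable (Q \<Otimes>\<^sub>M B)"
  shows "(\<integral>\<^sup>+ \<omega>. F (channel_input \<omega>, channel_output n \<omega>) \<partial>channel_space \<alpha> \<sigma>2 n Q) = (\<integral>\<^sup>+ x. \<integral>\<^sup>+ y. ennreal (cond_density x y) * F (x, y) \<partial>L \<partial>Q)"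
proof -
  have "(\<integral>\<^sup>+ \<omega>. F (channel_input \<omega>, channel_output n \<omega>) \<partial>channel_space \<alpha> \<sigma>2 n Q)
    = (\<integral>\<^sup>+ x. \<integral>\<^sup>+ \<xi>. \<integral>\<^sup>+ h. \<integral>\<^sup>+ hi. \<integral>\<^sup>+ z. F (channel_input (x, \<xi>, h, hi, z), channel_output n (x, \<xi>, h, hi, z)) \<partial>Z \<partial>HI \<partial>\<Gamma> \<partial>S \<partial>Q)"
    by (rule nn_integral_channel) measurable
  also have "\<dots> = (\<integral>\<^sup>+ x. \<integral>\<^sup>+ y. ennreal (cond_density x y) * F (x, y) \<partial>L \<partial>Q)"
  proof (intro nn_integral_cong)
    fix x assume x [measurable]: "x \<in> space Q"
    have "(\<integral>\<^sup>+ \<xi>. \<integral>\<^sup>+ h. \<integral>\<^sup>+ hi. \<integral>\<^sup>+ z. F (channel_input (x, \<xi>, h, hi, z), channel_output n (x, \<xi>, h, hi, z)) \<partial>Z \<partial>HI \<partial>\<Gamma> \<partial>S)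
      = (\<integral>\<^sup>+ \<xi>. \<integral>\<^sup>+ h. \<integral>\<^sup>+ hi. \<integral>\<^sup>+ z. F (x, \<lambda>k\<in>I. h k * x k + (\<lambda>k\<in>I. (\<Sum>l. hi l k * \<xi> l k) + z k) k) \<partial>Z \<partial>HI \<partial>\<Gamma> \<partial>S)"
      by (intro nn_integral_cong arg_cong[where f=F]) (auto simp: fun_eq_iff)
    also have "\<dots> = (\<integral>\<^sup>+ \<xi>. \<integral>\<^sup>+ y. ennreal (Phi I (V x \<xi>) y) * F (x, y) \<partial>L \<partial>S)"
    proof (rule nn_integral_cong_AE)
      show "AE \<xi> in S. (\<integral>\<^sup>+ h. \<integral>\<^sup>+ hi. \<integral>\<^sup>+ z. F (x, \<lambda>k\<in>I. h k * x k + (\<lambda>k\<in>I. (\<Sum>l. hi l k * \<xi> l k) + z k) k) \<partial>Z \<partial>HI \<partial>\<Gamma>)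
         = (\<integral>\<^sup>+ y. ennreal (Phi I (V x \<xi>) y) * F (x, y) \<partial>L)"
        using interference_terms_summable_AE[OF interference_summable] interference_power_finite_AE
      proof eventually_elim
        case (elim \<xi>)
        have "(\<integral>\<^sup>+ h. \<integral>\<^sup>+ hi. \<integral>\<^sup>+ z. F (x, \<lambda>k\<in>I. h k * x k + (\<lambda>k\<in>I. (\<Sum>l. hi l k * \<xi> l k) + z k) k) \<partial>Z \<partial>HI \<partial>\<Gamma>)
          = (\<integral>\<^sup>+ h. \<integral>\<^sup>+ y. ennreal (Phi I (T \<xi>) y) * F (x, \<lambda>k\<in>I. h k * x k + y k) \<partial>L \<partial>\<Gamma>)"
          using elim by (intro nn_integral_cong nn_integral_interference_law[where F = "\<lambda>y. F (x, \<lambda>k\<in>I. _ k * x k + y k)"]) auto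
        also have "\<dots> = (\<integral>\<^sup>+ y. ennreal (Phi I (V x \<xi>) y) * F (x, y) \<partial>L)"
          unfolding V_def by (rule nn_integral_Gamma_kernel[where F = "\<lambda>y. F (x, y)"]) (auto simp: T_pos)
        finally show ?case .
      qed
    qed
    also have "\<dots> = (\<integral>\<^sup>+ y. ennreal (cond_density x y) * F (x, y) \<partial>L)"
      by (rule nn_integral_cond_density[OF x, symmetric]) measurable
    finally show "(\<integral>\<^sup>+ \<xi>. \<integral>\<^sup>+ h. \<integral>\<^sup>+ hi. \<integral>\<^sup>+ z. F (channel_input (x, \<xi>, h, hi, z), channel_output n (x, \<xi>, h, hi, z)) \<partial>Z \<partial>HI \<partial>\<Gamma> \<partial>S)
      = (\<integral>\<^sup>+ y. ennreal (cond_density x y) * F (x, y) \<partial>L)" .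
  qed
  finally show ?thesis .
qed

end

section \<open>Logarithms of densities\<close>

lemma distr_eqI_nn_integral:
  assumes X [measurable]: "X \<in> M \<rightarrow>\<^sub>M N" and s: "sets N' = sets N"
    and eq: "\<And>F. F \<in> borel_measurable N \<Longrightarrow> (\<integral>\<^sup>+ \<omega>. F (X \<omega>) \<partial>M) = (\<integral>\<^sup>+ x. F x \<partial>N')"
  shows "distr M N X = N'"
proof (rule measure_eqI)
  fix A assume "A \<in> sets (distr M N X)"
  then have A: "A \<in> sets N" by simp
  have "emeasure (distr M N X) A = (\<integral>\<^sup>+ x. indicator A x \<partial>distr M N X)" using A by simp
  also have "\<dots> = (\<integral>\<^sup>+ \<omega>. indicator A (X \<omega>) \<partial>M)"
    using A by (intro nn_integral_distr) auto
  also have "\<dots> = emeasure N' A" using A s by (subst eq) auto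
  finally show "emeasure (distr M N X) A = emeasure N' A" .
qed (simp add: s)

text \<open>The two bounds confine \<open>ln R\<close> between \<open>ln c - h\<close> and
  \<open>ln u\<close>. With \<open>h\<close> a multiple of a squared norm, integrability of
  log-densities reduces to second moments.\<close>

lemma integrable_ln_bounded:
  fixes R h :: "'a \<Rightarrow> real"
  assumes "finite_measure M" and [measurable]: "R \<in> borel_measurable M" "h \<in> borel_measurable M"
    and c: "c > 0" and lb: "\<And>\<omega>. \<omega> \<in> space M \<Longrightarrow> c * exp (- h \<omega>) \<le> R \<omega>" and ub: "\<And>\<omega>. \<omega> \<in> space M \<Longrightarrow> R \<omega> \<le> u"
    and h: "\<And>\<omega>. \<omega> \<in> space M \<Longrightarrow> h \<omega> \<ge> 0" "(\<integral>\<^sup>+ \<omega>. ennreal (h \<omega>) \<partial>M) < \<infinity>"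
  shows "integrable M (\<lambda>\<omega>. ln (R \<omega>))"
proof (rule Bochner_Integration.integrable_bound)
  interpret finite_measure M by fact
  show "integrable M (\<lambda>\<omega>. \<bar>ln c\<bar> + \<bar>ln u\<bar> + h \<omega>)"
    using h by (intro Bochner_Integration.integrable_add integrable_const) (auto intro!: integrableI_nonneg)
  show "AE \<omega> in M. norm (ln (R \<omega>)) \<le> norm (\<bar>ln c\<bar> + \<bar>ln u\<bar> + h \<omega>)"
  proof (rule AE_I2)
    fix \<omega> assume \<omega>: "\<omega> \<in> space M"
    have "0 < c * exp (- h \<omega>)" using c by simp
    with lb[OF \<omega>] have R: "R \<omega> > 0" by linarith
    have "ln c - h \<omega> = ln (c * exp (- h \<omega>))" using c by (simp add: ln_mult)
    also have "\<dots> \<le> ln (R \<omega>)" using lb[OF \<omega>] c R by (subst ln_le_cancel_iff) auto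
    finally have 1: "ln c - h \<omega> \<le> ln (R \<omega>)" .
    have 2: "ln (R \<omega>) \<le> ln u" using ub[OF \<omega>] R by (subst ln_le_cancel_iff) auto
    show "norm (ln (R \<omega>)) \<le> norm (\<bar>ln c\<bar> + \<bar>ln u\<bar> + h \<omega>)"
      using 1 2 h(1)[OF \<omega>] by auto
  qed
qed measurable

lemma integral_ln_nonpos:
  assumes "prob_space M" and [measurable]: "R \<in> borel_measurable M" and pos: "\<And>\<omega>. \<omega> \<in> space M \<Longrightarrow> (R \<omega> :: real) > 0"
    and le: "(\<integral>\<^sup>+ \<omega>. ennreal (R \<omega>) \<partial>M) \<le> 1" and int: "integrable M (\<lambda>\<omega>. ln (R \<omega>))"
  shows "(\<integral>\<omega>. ln (R \<omega>) \<partial>M) \<le> 0"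
proof -
  interpret prob_space M by fact
  have i: "integrable M R"
    using pos le_less_trans[OF le, of \<infinity>] by (intro integrableI_nonneg) (auto intro!: AE_I2 less_imp_le)
  have "(\<integral>\<omega>. ln (R \<omega>) \<partial>M) \<le> (\<integral>\<omega>. R \<omega> - 1 \<partial>M)"
    using i int pos by (intro integral_mono) (auto intro: ln_le_minus_one)
  also have "\<dots> = (\<integral>\<omega>. R \<omega> \<partial>M) - 1"
    using i by (simp add: prob_space)
  also have "(\<integral>\<omega>. R \<omega> \<partial>M) \<le> 1"
  proof -
    have "ennreal (\<integral>\<omega>. R \<omega> \<partial>M) = (\<integral>\<^sup>+ \<omega>. ennreal (R \<omega>) \<partial>M)"
      using i pos by (intro nn_integral_eq_integral[symmetric]) (auto intro!: AE_I2 less_imp_le)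
    with le have "ennreal (\<integral>\<omega>. R \<omega> \<partial>M) \<le> ennreal 1" by simp
    then show ?thesis by (subst (asm) ennreal_le_iff) auto
  qed
  finally show ?thesis by simp
qed

context interference_block
begin

section \<open>Lower bounds of Gaussian shape for the densities\<close>

definition sq_norm :: "(nat \<Rightarrow> complex) \<Rightarrow> real" where "sq_norm y = (\<Sum>k\<in>I. (cmod (y k))\<^sup>2)"

lemma sq_norm_nonneg: "sq_norm y \<ge> 0" unfolding sq_norm_def by (intro sum_nonneg) auto

lemma measurable_sq_norm [measurable]: "sq_norm \<in> borel_measurable B"
  unfolding sq_norm_def by measurable

text \<open>This is \<open>noise_density\<close> at the origin, the mean peak of the Gaussian
  mixture. It is positive because the peak is positive for every \<xi>, \<open>T\<close> being real
  throughout.\<close>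

definition c0 :: real where "c0 = enn2real (\<integral>\<^sup>+ \<xi>. ennreal (\<Prod>k\<in>I. 1 / (pi * T \<xi> k)) \<partial>S)"

lemma prod_T_pos: "(\<Prod>k\<in>I. 1 / (pi * T \<xi> k)) > 0"
  by (intro prod_pos) (auto simp: T_pos)

lemma measurable_prod_T [measurable]: "(\<lambda>\<xi>. ennreal (\<Prod>k\<in>I. 1 / (pi * T \<xi> k))) \<in> borel_measurable S"
  by measurable

lemma Phi_T_0: "Phi I (T \<xi>) (\<lambda>_. 0) = (\<Prod>k\<in>I. 1 / (pi * T \<xi> k))"
  by (simp add: Phi_def phi_def)

lemma c0: "c0 > 0" "ennreal c0 = (\<integral>\<^sup>+ \<xi>. ennreal (\<Prod>k\<in>I. 1 / (pi * T \<xi> k)) \<partial>S)"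
proof -
  have "(\<integral>\<^sup>+ \<xi>. ennreal (\<Prod>k\<in>I. 1 / (pi * T \<xi> k)) \<partial>S) = ennreal (noise_density (\<lambda>_. 0))"
    unfolding ennreal_noise_density Phi_T_0 ..
  then show e: "ennreal c0 = (\<integral>\<^sup>+ \<xi>. ennreal (\<Prod>k\<in>I. 1 / (pi * T \<xi> k)) \<partial>S)"
    unfolding c0_def by simp
  have "(\<integral>\<^sup>+ \<xi>. ennreal (\<Prod>k\<in>I. 1 / (pi * T \<xi> k)) \<partial>S) \<noteq> 0"
  proof
    assume "(\<integral>\<^sup>+ \<xi>. ennreal (\<Prod>k\<in>I. 1 / (pi * T \<xi> k)) \<partial>S) = 0"
    then have "AE \<xi> in S. ennreal (\<Prod>k\<in>I. 1 / (pi * T \<xi> k)) = 0"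
      unfolding nn_integral_0_iff_AE[OF measurable_prod_T] .
    then have "AE \<xi> in S. False"
      by (rule eventually_mono) (unfold ennreal_eq_0_iff, use prod_T_pos not_le in blast)
    then show False by simp
  qed
  with e show "c0 > 0" by (metis ennreal_eq_0_iff not_le)
qed

text \<open>The normalisation is controlled by \<open>V \<le> T * (1 + |x|\<^sup>2 / \<sigma>2)
  \<le> T * exp (|x|\<^sup>2 / \<sigma>2)\<close>, which uses \<open>T \<ge> \<sigma>2\<close>, and
  the exponent by \<open>V \<ge> \<sigma>2\<close>. The bound separates \<xi> from \<open>x\<close>
  and \<open>y\<close>, so that averaging over \<xi> leaves just \<open>c0\<close>.\<close>

lemma Phi_V_ge: "(\<Prod>k\<in>I. 1 / (pi * T \<xi> k)) * exp (- ((sq_norm x + sq_norm y) / \<sigma>2)) \<le> Phi I (V x \<xi>) y"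
proof -
  have "(1 / (pi * T \<xi> k)) * exp (- (((cmod (x k))\<^sup>2 + (cmod (y k))\<^sup>2) / \<sigma>2)) \<le> phi (V x \<xi> k) (y k)" for k
  proof -
    have "V x \<xi> k \<le> T \<xi> k * (1 + (cmod (x k))\<^sup>2 / \<sigma>2)"
    proof -
      have "(cmod (x k))\<^sup>2 = \<sigma>2 * ((cmod (x k))\<^sup>2 / \<sigma>2)" using \<sigma>2_pos by simp
      also have "\<dots> \<le> T \<xi> k * ((cmod (x k))\<^sup>2 / \<sigma>2)" using T_ge \<sigma>2_pos by (intro mult_right_mono) auto
      finally show ?thesis by (simp add: V_def algebra_simps)
    qed
    also have "\<dots> \<le> T \<xi> k * exp ((cmod (x k))\<^sup>2 / \<sigma>2)"
      using T_pos[of \<xi> k] by (intro mult_left_mono exp_ge_add_one_self less_imp_le)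
    finally have 1: "V x \<xi> k \<le> T \<xi> k * exp ((cmod (x k))\<^sup>2 / \<sigma>2)" .
    have "(1 / (pi * T \<xi> k)) * exp (- (((cmod (x k))\<^sup>2 + (cmod (y k))\<^sup>2) / \<sigma>2))
      = exp (- (cmod (y k))\<^sup>2 / \<sigma>2) / (pi * (T \<xi> k * exp ((cmod (x k))\<^sup>2 / \<sigma>2)))"
      by (simp add: add_divide_distrib exp_diff exp_minus field_simps)
    also have "\<dots> \<le> exp (- (cmod (y k))\<^sup>2 / \<sigma>2) / (pi * V x \<xi> k)"
      using 1 V_pos[of x \<xi> k] by (intro divide_left_mono mult_left_mono mult_pos_pos) (auto simp: T_pos)
    also have "\<dots> \<le> phi (V x \<xi> k) (y k)"
      unfolding phi_def using V_pos[of x \<xi> k] V_ge[of x \<xi> k] \<sigma>2_pos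
      by (intro divide_right_mono) (auto intro!: divide_left_mono)
    finally show ?thesis .
  qed
  then have "(\<Prod>k\<in>I. (1 / (pi * T \<xi> k)) * exp (- (((cmod (x k))\<^sup>2 + (cmod (y k))\<^sup>2) / \<sigma>2))) \<le> Phi I (V x \<xi>) y"
    unfolding Phi_def using T_pos by (intro prod_mono) (auto simp: less_imp_le)
  also have "(\<Prod>k\<in>I. (1 / (pi * T \<xi> k)) * exp (- (((cmod (x k))\<^sup>2 + (cmod (y k))\<^sup>2) / \<sigma>2)))
    = (\<Prod>k\<in>I. 1 / (pi * T \<xi> k)) * exp (- ((sq_norm x + sq_norm y) / \<sigma>2))"
    unfolding prod.distrib sq_norm_def
    by (simp add: exp_sum[symmetric] sum_negf sum_divide_distrib[symmetric] sum.distrib)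
  finally show ?thesis .
qed

lemma cond_density_ge: "c0 * exp (- ((sq_norm x + sq_norm y) / \<sigma>2)) \<le> cond_density x y"
proof -
  have "ennreal (c0 * exp (- ((sq_norm x + sq_norm y) / \<sigma>2))) = ennreal c0 * ennreal (exp (- ((sq_norm x + sq_norm y) / \<sigma>2)))"
    using c0(1) by (simp add: ennreal_mult)
  also have "\<dots> = (\<integral>\<^sup>+ \<xi>. ennreal (\<Prod>k\<in>I. 1 / (pi * T \<xi> k)) * ennreal (exp (- ((sq_norm x + sq_norm y) / \<sigma>2))) \<partial>S)"
    unfolding c0(2) by (rule nn_integral_multc[symmetric]) measurable
  also have "\<dots> \<le> (\<integral>\<^sup>+ \<xi>. ennreal (Phi I (V x \<xi>) y) \<partial>S)"
    using Phi_V_ge prod_T_pos by (intro nn_integral_mono) (simp add: ennreal_mult[symmetric] ennreal_leI less_imp_le)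
  also have "\<dots> = ennreal (cond_density x y)" by (simp add: ennreal_cond_density)
  finally show ?thesis using cond_density_nonneg[of x y] by (simp add: ennreal_le_iff)
qed

lemma cond_density_pos: "cond_density x y > 0"
  by (rule less_le_trans[OF _ cond_density_ge]) (simp add: c0(1))

lemma noise_density_ge: "c0 * exp (- (sq_norm y / \<sigma>2)) \<le> noise_density y"
  using cond_density_ge[of zero_block y] by (simp add: noise_density_def sq_norm_def zero_block_def)

lemma noise_density_pos: "noise_density y > 0" and noise_density_le: "noise_density y \<le> density_bound"
  by (simp_all add: noise_density_def cond_density_pos cond_density_le)

text \<open>Averaging \<open>cond_density_ge\<close> over the input contributes the factor
  \<open>E\<close>, positive because its integrand is. The constant may depend on \<open>Q\<close>,
  since it serves only positivity and integrability.\<close>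

lemma out_density_ge_ex: "\<exists>c>0. \<forall>y. c * exp (- (sq_norm y / \<sigma>2)) \<le> out_density y"
proof -
  define E where "E = (\<integral>\<^sup>+ x. ennreal (exp (- (sq_norm x / \<sigma>2))) \<partial>Q)"
  have [measurable]: "sq_norm \<in> borel_measurable Q" unfolding sq_norm_def by measurable
  have "E \<le> (\<integral>\<^sup>+ x. 1 \<partial>Q)"
    unfolding E_def using \<sigma>2_pos by (intro nn_integral_mono) (auto simp: sq_norm_nonneg)
  then have E1: "E < top" by (auto simp: Q.emeasure_space_1 intro: le_less_trans)
  have "E \<noteq> 0"
  proof
    assume "E = 0"
    then have "AE x in Q. ennreal (exp (- (sq_norm x / \<sigma>2))) = 0"
      unfolding E_def by (subst (asm) nn_integral_0_iff_AE) auto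
    then have "AE x in Q. False" by (rule eventually_mono) (simp add: ennreal_eq_0_iff not_le)
    then show False by simp
  qed
  then have E0: "enn2real E > 0" using E1 by (simp add: enn2real_positive_iff zero_less_iff_neq_zero)
  have "(c0 * enn2real E) * exp (- (sq_norm y / \<sigma>2)) \<le> out_density y" for y
  proof -
    have "ennreal ((c0 * enn2real E) * exp (- (sq_norm y / \<sigma>2))) = ennreal (c0 * exp (- (sq_norm y / \<sigma>2))) * E"
      using c0(1) E0 E1 by (simp add: ennreal_mult less_imp_le mult_ac)
    also have "\<dots> = (\<integral>\<^sup>+ x. ennreal (c0 * exp (- (sq_norm y / \<sigma>2))) * ennreal (exp (- (sq_norm x / \<sigma>2))) \<partial>Q)"
      unfolding E_def by (rule nn_integral_cmult[symmetric]) measurable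
    also have "\<dots> \<le> (\<integral>\<^sup>+ x. ennreal (cond_density x y) \<partial>Q)"
    proof (intro nn_integral_mono)
      fix x
      have "c0 * exp (- (sq_norm y / \<sigma>2)) * exp (- (sq_norm x / \<sigma>2)) = c0 * exp (- ((sq_norm x + sq_norm y) / \<sigma>2))"
        by (simp add: exp_add[symmetric] add_divide_distrib)
      also have "\<dots> \<le> cond_density x y" by (rule cond_density_ge)
      finally show "ennreal (c0 * exp (- (sq_norm y / \<sigma>2))) * ennreal (exp (- (sq_norm x / \<sigma>2))) \<le> ennreal (cond_density x y)"
        using c0(1) by (simp add: ennreal_mult[symmetric] ennreal_leI)
    qed
    also have "\<dots> = ennreal (out_density y)" by (simp add: ennreal_out_density)
    finally show ?thesis by (simp add: out_density_def ennreal_le_iff)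
  qed
  moreover have "c0 * enn2real E > 0" using c0(1) E0 by simp
  ultimately show ?thesis by blast
qed

lemma out_density_pos: "out_density y > 0"
proof -
  obtain c where c: "c > 0" "\<forall>y. c * exp (- (sq_norm y / \<sigma>2)) \<le> out_density y"
    using out_density_ge_ex by (elim exE conjE)
  have "0 < c * exp (- (sq_norm y / \<sigma>2))" using c(1) by simp
  also have "\<dots> \<le> out_density y" using c(2) by (rule spec)
  finally show ?thesis .
qed

section \<open>Laws on the block space and their realisations\<close>

definition noise_law :: "(nat \<Rightarrow> complex) measure" where "noise_law = density L (\<lambda>w. ennreal (noise_density w))"
definition out_law :: "(nat \<Rightarrow> complex) measure" where "out_law = density L (\<lambda>y. ennreal (out_density y))"
definition joint_law :: "((nat \<Rightarrow> complex) \<times> (nat \<Rightarrow> complex)) measure" where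
  "joint_law = density (Q \<Otimes>\<^sub>M L) (\<lambda>\<omega>. ennreal (cond_density (fst \<omega>) (snd \<omega>)))"

lemma sets_noise_law [measurable_cong]: "sets noise_law = sets B"
  unfolding noise_law_def by (simp add: sets_block_lborel)
lemma sets_out_law [measurable_cong]: "sets out_law = sets B"
  unfolding out_law_def by (simp add: sets_block_lborel)
lemma sets_joint_law [measurable_cong]: "sets joint_law = sets (B \<Otimes>\<^sub>M B)"
  unfolding joint_law_def by (simp add: sets_block_lborel sets_Q cong: sets_pair_measure_cong)

lemma nn_integral_noise_law:
  "F \<in> borel_measurable B \<Longrightarrow> (\<integral>\<^sup>+ w. F w \<partial>noise_law) = (\<integral>\<^sup>+ w. ennreal (noise_density w) * F w \<partial>L)"
  unfolding noise_law_def by (rule nn_integral_density) measurable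

lemma nn_integral_out_law:
  assumes F [measurable]: "F \<in> borel_measurable B"
  shows "(\<integral>\<^sup>+ y. F y \<partial>out_law) = (\<integral>\<^sup>+ x. \<integral>\<^sup>+ y. ennreal (cond_density x y) * F y \<partial>L \<partial>Q)"
proof -
  have "(\<integral>\<^sup>+ y. F y \<partial>out_law) = (\<integral>\<^sup>+ y. ennreal (out_density y) * F y \<partial>L)"
    unfolding out_law_def by (rule nn_integral_density) measurable
  also have "\<dots> = (\<integral>\<^sup>+ y. \<integral>\<^sup>+ x. ennreal (cond_density x y) * F y \<partial>Q \<partial>L)"
  proof (intro nn_integral_cong)
    fix y assume "y \<in> space L"
    then have [measurable]: "y \<in> space B" by (simp add: space_PiM)
    show "ennreal (out_density y) * F y = (\<integral>\<^sup>+ x. ennreal (cond_density x y) * F y \<partial>Q)"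
      unfolding ennreal_out_density by (rule nn_integral_multc[symmetric]) measurable
  qed
  also have "\<dots> = (\<integral>\<^sup>+ x. \<integral>\<^sup>+ y. ennreal (cond_density x y) * F y \<partial>L \<partial>Q)"
    by (rule QL.Fubini') measurable
  finally show ?thesis .
qed

lemma nn_integral_joint_law:
  assumes F [measurable]: "F \<in> borel_measurable (B \<Otimes>\<^sub>M B)"
  shows "(\<integral>\<^sup>+ \<omega>. F \<omega> \<partial>joint_law) = (\<integral>\<^sup>+ x. \<integral>\<^sup>+ y. ennreal (cond_density x y) * F (x, y) \<partial>L \<partial>Q)"
proof -
  have "(\<integral>\<^sup>+ \<omega>. F \<omega> \<partial>joint_law) = (\<integral>\<^sup>+ \<omega>. ennreal (cond_density (fst \<omega>) (snd \<omega>)) * F \<omega> \<partial>(Q \<Otimes>\<^sub>M L))"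
    unfolding joint_law_def by (rule nn_integral_density) measurable
  also have "\<dots> = (\<integral>\<^sup>+ x. \<integral>\<^sup>+ y. ennreal (cond_density x y) * F (x, y) \<partial>L \<partial>Q)"
    by (subst L.nn_integral_fst[symmetric]) ((measurable)[1], simp)
  finally show ?thesis .
qed

lemma prob_space_noise_law: "prob_space noise_law"
proof (rule prob_spaceI)
  have "emeasure noise_law (space noise_law) = (\<integral>\<^sup>+ w. 1 \<partial>noise_law)" by simp
  also have "\<dots> = (\<integral>\<^sup>+ w. ennreal (noise_density w) * 1 \<partial>L)" by (rule nn_integral_noise_law) simp
  also have "\<dots> = 1" unfolding noise_density_def by (simp add: nn_integral_cond_density_eq_1)
  finally show "emeasure noise_law (space noise_law) = 1" .
qed

sublocale NL: prob_space noise_law by (rule prob_space_noise_law)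

lemma measurable_channel_input' [measurable]: "channel_input \<in> channel_space \<alpha> \<sigma>2 n Q \<rightarrow>\<^sub>M B"
  using measurable_channel_input unfolding measurable_cong_sets[OF refl sets_Q] .

lemma measurable_channel_pair [measurable]:
  "(\<lambda>\<omega>. (channel_input \<omega>, channel_output n \<omega>)) \<in> channel_space \<alpha> \<sigma>2 n Q \<rightarrow>\<^sub>M B \<Otimes>\<^sub>M B"
  by (intro measurable_Pair measurable_channel_input' measurable_channel_output)

lemma space_Q: "space Q = space B" by (rule sets_eq_imp_space_eq[OF sets_Q])

lemma channel_joint_law:
  "distr (channel_space \<alpha> \<sigma>2 n Q) (B \<Otimes>\<^sub>M B) (\<lambda>\<omega>. (channel_input \<omega>, channel_output n \<omega>)) = joint_law"
proof (rule distr_eqI_nn_integral)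
  fix F :: "_ \<Rightarrow> ennreal" assume F [measurable]: "F \<in> borel_measurable (B \<Otimes>\<^sub>M B)"
  show "(\<integral>\<^sup>+ \<omega>. F (channel_input \<omega>, channel_output n \<omega>) \<partial>channel_space \<alpha> \<sigma>2 n Q) = (\<integral>\<^sup>+ \<omega>. F \<omega> \<partial>joint_law)"
    unfolding nn_integral_joint_law[OF F] by (rule nn_integral_channel_law) measurable
qed ((measurable)[1], simp add: sets_joint_law)

lemma joint_law_fst: "distr joint_law B fst = Q"
proof (rule distr_eqI_nn_integral)
  fix F :: "_ \<Rightarrow> ennreal" assume F [measurable]: "F \<in> borel_measurable B"
  have "(\<integral>\<^sup>+ \<omega>. F (fst \<omega>) \<partial>joint_law) = (\<integral>\<^sup>+ x. \<integral>\<^sup>+ y. ennreal (cond_density x y) * F x \<partial>L \<partial>Q)"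
    by (subst nn_integral_joint_law) ((measurable)[1], simp)
  also have "\<dots> = (\<integral>\<^sup>+ x. F x \<partial>Q)"
    by (intro nn_integral_cong, subst nn_integral_multc) ((measurable)[1], simp add: nn_integral_cond_density_eq_1)
  finally show "(\<integral>\<^sup>+ \<omega>. F (fst \<omega>) \<partial>joint_law) = (\<integral>\<^sup>+ x. F x \<partial>Q)" .
qed ((measurable)[1], simp add: sets_Q)

lemma joint_law_snd: "distr joint_law B snd = out_law"
proof (rule distr_eqI_nn_integral)
  fix F :: "_ \<Rightarrow> ennreal" assume F [measurable]: "F \<in> borel_measurable B"
  show "(\<integral>\<^sup>+ \<omega>. F (snd \<omega>) \<partial>joint_law) = (\<integral>\<^sup>+ y. F y \<partial>out_law)"
    unfolding nn_integral_out_law[OF F] by (subst nn_integral_joint_law) ((measurable)[1], simp)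
qed ((measurable)[1], simp add: sets_out_law)

lemma channel_input_law: "distr (channel_space \<alpha> \<sigma>2 n Q) B channel_input = Q"
  using distr_distr[of fst "B \<Otimes>\<^sub>M B" B "\<lambda>\<omega>. (channel_input \<omega>, channel_output n \<omega>)" "channel_space \<alpha> \<sigma>2 n Q"]
  by (simp add: channel_joint_law joint_law_fst comp_def)

lemma channel_output_law: "distr (channel_space \<alpha> \<sigma>2 n Q) B (channel_output n) = out_law"
  using distr_distr[of snd "B \<Otimes>\<^sub>M B" B "\<lambda>\<omega>. (channel_input \<omega>, channel_output n \<omega>)" "channel_space \<alpha> \<sigma>2 n Q"]
  by (simp add: channel_joint_law joint_law_snd comp_def)

lemma prob_space_joint_law: "prob_space joint_law"
  unfolding channel_joint_law[symmetric] by (intro prob_space.prob_space_distr prob_space_channel_space) measurable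
lemma prob_space_out_law: "prob_space out_law"
  unfolding channel_output_law[symmetric] by (intro prob_space.prob_space_distr prob_space_channel_space) measurable

sublocale J: prob_space joint_law by (rule prob_space_joint_law)
sublocale OL: prob_space out_law by (rule prob_space_out_law)

text \<open>The spaces of the comparisons.
  \<open>Q \<Otimes>\<^sub>M \<Gamma> \<Otimes>\<^sub>M noise_law\<close> carries
  \<open>(x, h, w)\<close> and realises the output as \<open>h x + w\<close>.
  \<open>S \<Otimes>\<^sub>M \<Gamma>\<close> carries the variances \<open>T\<close> together with
  the standard block that they scale to \<open>W\<close>.
  \<open>Q \<Otimes>\<^sub>M S \<Otimes>\<^sub>M \<Gamma>\<close> adds the transmitted block to the
  latter pair.\<close>

sublocale GN: prob_space "\<Gamma> \<Otimes>\<^sub>M noise_law" by (intro prob_space_pair \<Gamma>.prob_space_axioms NL.prob_space_axioms)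
sublocale QGN: prob_space "Q \<Otimes>\<^sub>M \<Gamma> \<Otimes>\<^sub>M noise_law" by (intro prob_space_pair prob_Q GN.prob_space_axioms)
sublocale SG: prob_space "S \<Otimes>\<^sub>M \<Gamma>" by (intro prob_space_pair S.prob_space_axioms \<Gamma>.prob_space_axioms)
sublocale QSG: prob_space "Q \<Otimes>\<^sub>M S \<Otimes>\<^sub>M \<Gamma>" by (intro prob_space_pair prob_Q SG.prob_space_axioms)

lemma nn_integral_QGN:
  assumes [measurable]: "F \<in> borel_measurable (Q \<Otimes>\<^sub>M \<Gamma> \<Otimes>\<^sub>M noise_law)"
  shows "(\<integral>\<^sup>+ \<omega>. F \<omega> \<partial>(Q \<Otimes>\<^sub>M \<Gamma> \<Otimes>\<^sub>M noise_law)) = (\<integral>\<^sup>+ x. \<integral>\<^sup>+ h. \<integral>\<^sup>+ w. ennreal (noise_density w) * F (x, h, w) \<partial>L \<partial>\<Gamma> \<partial>Q)"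
proof -
  have "(\<integral>\<^sup>+ \<omega>. F \<omega> \<partial>(Q \<Otimes>\<^sub>M \<Gamma> \<Otimes>\<^sub>M noise_law)) = (\<integral>\<^sup>+ x. \<integral>\<^sup>+ u. F (x, u) \<partial>(\<Gamma> \<Otimes>\<^sub>M noise_law) \<partial>Q)"
    by (rule GN.nn_integral_fst[symmetric]) measurable
  also have "\<dots> = (\<integral>\<^sup>+ x. \<integral>\<^sup>+ h. \<integral>\<^sup>+ w. F (x, h, w) \<partial>noise_law \<partial>\<Gamma> \<partial>Q)"
    by (intro nn_integral_cong NL.nn_integral_fst[symmetric]) measurable
  also have "\<dots> = (\<integral>\<^sup>+ x. \<integral>\<^sup>+ h. \<integral>\<^sup>+ w. ennreal (noise_density w) * F (x, h, w) \<partial>L \<partial>\<Gamma> \<partial>Q)"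
    by (intro nn_integral_cong nn_integral_noise_law) measurable
  finally show ?thesis .
qed

lemma nn_integral_QSG:
  assumes [measurable]: "F \<in> borel_measurable (Q \<Otimes>\<^sub>M S \<Otimes>\<^sub>M \<Gamma>)"
  shows "(\<integral>\<^sup>+ \<omega>. F \<omega> \<partial>(Q \<Otimes>\<^sub>M S \<Otimes>\<^sub>M \<Gamma>)) = (\<integral>\<^sup>+ x. \<integral>\<^sup>+ \<xi>. \<integral>\<^sup>+ e. F (x, \<xi>, e) \<partial>\<Gamma> \<partial>S \<partial>Q)"
proof -
  have "(\<integral>\<^sup>+ \<omega>. F \<omega> \<partial>(Q \<Otimes>\<^sub>M S \<Otimes>\<^sub>M \<Gamma>)) = (\<integral>\<^sup>+ x. \<integral>\<^sup>+ u. F (x, u) \<partial>(S \<Otimes>\<^sub>M \<Gamma>) \<partial>Q)"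
    by (rule SG.nn_integral_fst[symmetric]) measurable
  also have "\<dots> = (\<integral>\<^sup>+ x. \<integral>\<^sup>+ \<xi>. \<integral>\<^sup>+ e. F (x, \<xi>, e) \<partial>\<Gamma> \<partial>S \<partial>Q)"
    by (intro nn_integral_cong \<Gamma>.nn_integral_fst[symmetric]) measurable
  finally show ?thesis .
qed

lemma joint_law_fading:
  "distr (Q \<Otimes>\<^sub>M \<Gamma> \<Otimes>\<^sub>M noise_law) (B \<Otimes>\<^sub>M B) (\<lambda>\<omega>. (fst \<omega>, \<lambda>k\<in>I. fst (snd \<omega>) k * fst \<omega> k + snd (snd \<omega>) k)) = joint_law"
proof (rule distr_eqI_nn_integral)
  fix F :: "_ \<Rightarrow> ennreal" assume F [measurable]: "F \<in> borel_measurable (B \<Otimes>\<^sub>M B)"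
  have "(\<integral>\<^sup>+ \<omega>. F (fst \<omega>, \<lambda>k\<in>I. fst (snd \<omega>) k * fst \<omega> k + snd (snd \<omega>) k) \<partial>(Q \<Otimes>\<^sub>M \<Gamma> \<Otimes>\<^sub>M noise_law))
    = (\<integral>\<^sup>+ x. \<integral>\<^sup>+ h. \<integral>\<^sup>+ w. ennreal (noise_density w) * F (x, \<lambda>k\<in>I. h k * x k + w k) \<partial>L \<partial>\<Gamma> \<partial>Q)"
    by (subst nn_integral_QGN) ((measurable)[1], simp)
  also have "\<dots> = (\<integral>\<^sup>+ x. \<integral>\<^sup>+ y. ennreal (cond_density x y) * F (x, y) \<partial>L \<partial>Q)"
  proof (intro nn_integral_cong)
    fix x assume x: "x \<in> space Q"
    then have [measurable]: "x \<in> space B" by (simp add: space_Q)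
    show "(\<integral>\<^sup>+ h. \<integral>\<^sup>+ w. ennreal (noise_density w) * F (x, \<lambda>k\<in>I. h k * x k + w k) \<partial>L \<partial>\<Gamma>) = (\<integral>\<^sup>+ y. ennreal (cond_density x y) * F (x, y) \<partial>L)"
      by (rule nn_integral_fading_interference[where F = "\<lambda>y. F (x, y)", OF x]) measurable
  qed
  finally show "(\<integral>\<^sup>+ \<omega>. F (fst \<omega>, \<lambda>k\<in>I. fst (snd \<omega>) k * fst \<omega> k + snd (snd \<omega>) k) \<partial>(Q \<Otimes>\<^sub>M \<Gamma> \<Otimes>\<^sub>M noise_law)) = (\<integral>\<^sup>+ \<omega>. F \<omega> \<partial>joint_law)"
    unfolding nn_integral_joint_law[OF F] .
qed ((measurable)[1], simp add: sets_joint_law)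

lemma noise_law_proj: "distr (Q \<Otimes>\<^sub>M \<Gamma> \<Otimes>\<^sub>M noise_law) B (\<lambda>\<omega>. snd (snd \<omega>)) = noise_law"
proof (rule distr_eqI_nn_integral)
  fix F :: "_ \<Rightarrow> ennreal" assume F [measurable]: "F \<in> borel_measurable B"
  show "(\<integral>\<^sup>+ \<omega>. F (snd (snd \<omega>)) \<partial>(Q \<Otimes>\<^sub>M \<Gamma> \<Otimes>\<^sub>M noise_law)) = (\<integral>\<^sup>+ w. F w \<partial>noise_law)"
    unfolding nn_integral_noise_law[OF F]
    by (subst nn_integral_QGN) ((measurable)[1], simp add: \<Gamma>.emeasure_space_1 Q.emeasure_space_1)
qed ((measurable)[1], simp add: sets_noise_law)

lemma out_law_scale:
  "distr (Q \<Otimes>\<^sub>M S \<Otimes>\<^sub>M \<Gamma>) B (\<lambda>\<omega>. \<lambda>k\<in>I. of_real (sqrt (V (fst \<omega>) (fst (snd \<omega>)) k)) * snd (snd \<omega>) k) = out_law"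
proof (rule distr_eqI_nn_integral)
  fix F :: "_ \<Rightarrow> ennreal" assume F [measurable]: "F \<in> borel_measurable B"
  show "(\<integral>\<^sup>+ \<omega>. F (\<lambda>k\<in>I. of_real (sqrt (V (fst \<omega>) (fst (snd \<omega>)) k)) * snd (snd \<omega>) k) \<partial>(Q \<Otimes>\<^sub>M S \<Otimes>\<^sub>M \<Gamma>)) = (\<integral>\<^sup>+ y. F y \<partial>out_law)"
    unfolding nn_integral_out_law[OF F]
    by (subst nn_integral_QSG) ((measurable)[1], auto intro!: nn_integral_cong nn_integral_cond_density_scale[symmetric] F)
qed ((measurable)[1], simp add: sets_out_law)

lemma noise_law_scale:
  "distr (S \<Otimes>\<^sub>M \<Gamma>) B (\<lambda>\<omega>. \<lambda>k\<in>I. of_real (sqrt (T (fst \<omega>) k)) * snd \<omega> k) = noise_law"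
proof (rule distr_eqI_nn_integral)
  fix F :: "_ \<Rightarrow> ennreal" assume F [measurable]: "F \<in> borel_measurable B"
  have "(\<integral>\<^sup>+ \<omega>. F (\<lambda>k\<in>I. of_real (sqrt (T (fst \<omega>) k)) * snd \<omega> k) \<partial>(S \<Otimes>\<^sub>M \<Gamma>)) = (\<integral>\<^sup>+ \<xi>. \<integral>\<^sup>+ e. F (\<lambda>k\<in>I. of_real (sqrt (T \<xi> k)) * e k) \<partial>\<Gamma> \<partial>S)"
    by (subst \<Gamma>.nn_integral_fst[symmetric]) ((measurable)[1], simp)
  also have "\<dots> = (\<integral>\<^sup>+ \<xi>. \<integral>\<^sup>+ y. ennreal (Phi I (T \<xi>) y) * F y \<partial>L \<partial>S)"
    by (intro nn_integral_cong nn_integral_Phi_scale[symmetric] T_pos F) simp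
  finally show "(\<integral>\<^sup>+ \<omega>. F (\<lambda>k\<in>I. of_real (sqrt (T (fst \<omega>) k)) * snd \<omega> k) \<partial>(S \<Otimes>\<^sub>M \<Gamma>)) = (\<integral>\<^sup>+ w. F w \<partial>noise_law)"
    unfolding nn_integral_noise_law[OF F] nn_integral_T_eq[OF F] .
qed ((measurable)[1], simp add: sets_noise_law)

text \<open>\<open>case_nat x \<xi>\<close> puts \<open>x\<close> at index 0 and moves interferer
  \<open>l\<close> to \<open>Suc l\<close>. The law is preserved because the transmitter draws from
  the same \<open>Q\<close>.\<close>

lemma nn_integral_shift:
  assumes [measurable]: "F \<in> borel_measurable S"
  shows "(\<integral>\<^sup>+ x. \<integral>\<^sup>+ \<xi>. F (case_nat x \<xi>) \<partial>S \<partial>Q) = (\<integral>\<^sup>+ \<xi>. F \<xi> \<partial>S)"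
proof -
  have "(\<integral>\<^sup>+ \<xi>. F \<xi> \<partial>S) = (\<integral>\<^sup>+ \<omega>. F (case \<omega> of (x, \<xi>) \<Rightarrow> case_nat x \<xi>) \<partial>(Q \<Otimes>\<^sub>M S))"
    by (subst S.PiM_iter[symmetric]) (subst nn_integral_distr, measurable)
  also have "\<dots> = (\<integral>\<^sup>+ x. \<integral>\<^sup>+ \<xi>. F (case_nat x \<xi>) \<partial>S \<partial>Q)"
    by (subst S.nn_integral_fst[symmetric]) ((measurable)[1], simp)
  finally show ?thesis ..
qed

lemma noise_law_shift:
  "distr (Q \<Otimes>\<^sub>M S \<Otimes>\<^sub>M \<Gamma>) B (\<lambda>\<omega>. \<lambda>k\<in>I. of_real (sqrt (T (case_nat (fst \<omega>) (fst (snd \<omega>))) k)) * snd (snd \<omega>) k) = noise_law"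
proof (rule distr_eqI_nn_integral)
  fix F :: "_ \<Rightarrow> ennreal" assume F [measurable]: "F \<in> borel_measurable B"
  have "(\<integral>\<^sup>+ \<omega>. F (\<lambda>k\<in>I. of_real (sqrt (T (case_nat (fst \<omega>) (fst (snd \<omega>))) k)) * snd (snd \<omega>) k) \<partial>(Q \<Otimes>\<^sub>M S \<Otimes>\<^sub>M \<Gamma>))
    = (\<integral>\<^sup>+ x. \<integral>\<^sup>+ \<xi>. (\<lambda>\<xi>. \<integral>\<^sup>+ e. F (\<lambda>k\<in>I. of_real (sqrt (T \<xi> k)) * e k) \<partial>\<Gamma>) (case_nat x \<xi>) \<partial>S \<partial>Q)"
    by (subst nn_integral_QSG) ((measurable)[1], simp)
  also have "\<dots> = (\<integral>\<^sup>+ \<xi>. \<integral>\<^sup>+ e. F (\<lambda>k\<in>I. of_real (sqrt (T \<xi> k)) * e k) \<partial>\<Gamma> \<partial>S)"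
    by (rule nn_integral_shift) measurable
  also have "\<dots> = (\<integral>\<^sup>+ \<omega>. F (\<lambda>k\<in>I. of_real (sqrt (T (fst \<omega>) k)) * snd \<omega> k) \<partial>(S \<Otimes>\<^sub>M \<Gamma>))"
    by (subst \<Gamma>.nn_integral_fst[symmetric]) ((measurable)[1], simp)
  also have "\<dots> = (\<integral>\<^sup>+ w. F w \<partial>noise_law)"
    unfolding noise_law_scale[symmetric] by (subst nn_integral_distr) measurable
  finally show "(\<integral>\<^sup>+ \<omega>. F (\<lambda>k\<in>I. of_real (sqrt (T (case_nat (fst \<omega>) (fst (snd \<omega>))) k)) * snd (snd \<omega>) k) \<partial>(Q \<Otimes>\<^sub>M S \<Otimes>\<^sub>M \<Gamma>)) = (\<integral>\<^sup>+ w. F w \<partial>noise_law)" .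
qed ((measurable)[1], simp add: sets_noise_law)

section \<open>Second moments\<close>

lemma nn_integral_Gamma_sq:
  assumes k: "k \<in> I"
  shows "(\<integral>\<^sup>+ e. ennreal ((cmod (e k))\<^sup>2) \<partial>\<Gamma>) \<le> 4"
proof -
  interpret P: product_prob_space "\<lambda>_. complex_gaussian 1" I
    by (intro product_prob_spaceI prob_space_complex_gaussian) simp
  have "(\<integral>\<^sup>+ e. ennreal ((cmod (e k))\<^sup>2) \<partial>\<Gamma>) = (\<integral>\<^sup>+ z. ennreal ((cmod z)\<^sup>2) \<partial>complex_gaussian 1)"
    by (subst (2) P.PiM_component[OF k, symmetric]) (subst nn_integral_distr, use k in auto)
  then show ?thesis using nn_integral_sq_complex_gaussian by simp
qed

text \<open>The standard block is independent of the variances, so each coordinate contributes the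
  mean of its variance times a moment of at most 4.\<close>

lemma nn_integral_sq_norm_scale:
  assumes [measurable]: "\<And>k. k \<in> I \<Longrightarrow> (\<lambda>\<omega>. v \<omega> k) \<in> borel_measurable M" and v: "\<And>\<omega> k. v \<omega> k > 0"
    and fin: "\<And>k. k \<in> I \<Longrightarrow> (\<integral>\<^sup>+ \<omega>. ennreal (v \<omega> k) \<partial>M) < \<infinity>"
  shows "(\<integral>\<^sup>+ \<omega>. \<integral>\<^sup>+ e. ennreal (sq_norm (\<lambda>k\<in>I. of_real (sqrt (v \<omega> k)) * e k)) \<partial>\<Gamma> \<partial>M) < \<infinity>"
proof -
  have "(\<integral>\<^sup>+ \<omega>. \<integral>\<^sup>+ e. ennreal (sq_norm (\<lambda>k\<in>I. of_real (sqrt (v \<omega> k)) * e k)) \<partial>\<Gamma> \<partial>M)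
    = (\<integral>\<^sup>+ \<omega>. \<integral>\<^sup>+ e. (\<Sum>k\<in>I. ennreal (v \<omega> k) * ennreal ((cmod (e k))\<^sup>2)) \<partial>\<Gamma> \<partial>M)"
    unfolding sq_norm_def using v
    by (intro nn_integral_cong) (simp add: norm_mult power_mult_distrib less_imp_le ennreal_mult[symmetric] sum_ennreal)
  also have "\<dots> = (\<integral>\<^sup>+ \<omega>. (\<Sum>k\<in>I. ennreal (v \<omega> k) * (\<integral>\<^sup>+ e. ennreal ((cmod (e k))\<^sup>2) \<partial>\<Gamma>)) \<partial>M)"
    by (intro nn_integral_cong) (subst nn_integral_sum, measurable, intro sum.cong refl nn_integral_cmult, measurable)
  also have "\<dots> \<le> (\<integral>\<^sup>+ \<omega>. (\<Sum>k\<in>I. ennreal (v \<omega> k) * 4) \<partial>M)"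
    by (intro nn_integral_mono sum_mono mult_left_mono nn_integral_Gamma_sq) auto
  also have "\<dots> = (\<Sum>k\<in>I. (\<integral>\<^sup>+ \<omega>. ennreal (v \<omega> k) \<partial>M) * 4)"
    by (subst nn_integral_sum, measurable, intro sum.cong refl nn_integral_multc, measurable)
  also have "\<dots> < \<infinity>" using fin by (auto simp: ennreal_mult_less_top)
  finally show ?thesis .
qed

lemma Gamma_sq_norm: "integrable \<Gamma> sq_norm" "(\<integral>e. sq_norm e \<partial>\<Gamma>) \<le> 4 * real n"
proof -
  have "(\<integral>\<^sup>+ e. ennreal (sq_norm e) \<partial>\<Gamma>) = (\<integral>\<^sup>+ e. (\<Sum>k\<in>I. ennreal ((cmod (e k))\<^sup>2)) \<partial>\<Gamma>)"
    unfolding sq_norm_def by (simp add: sum_ennreal)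
  also have "\<dots> = (\<Sum>k\<in>I. \<integral>\<^sup>+ e. ennreal ((cmod (e k))\<^sup>2) \<partial>\<Gamma>)"
    by (rule nn_integral_sum) measurable
  also have "\<dots> \<le> (\<Sum>k\<in>I. ennreal 4)"
    by (intro sum_mono) (use nn_integral_Gamma_sq in simp)
  also have "\<dots> = ennreal (4 * real n)"
    by (subst sum_ennreal) (simp_all add: mult.commute)
  finally have le: "(\<integral>\<^sup>+ e. ennreal (sq_norm e) \<partial>\<Gamma>) \<le> ennreal (4 * real n)" .
  then show i: "integrable \<Gamma> sq_norm"
    by (intro integrableI_nonneg) (auto simp: sq_norm_nonneg intro: le_less_trans)
  have "ennreal (\<integral>e. sq_norm e \<partial>\<Gamma>) = (\<integral>\<^sup>+ e. ennreal (sq_norm e) \<partial>\<Gamma>)"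
    using i by (intro nn_integral_eq_integral[symmetric]) (auto simp: sq_norm_nonneg)
  with le have "ennreal (\<integral>e. sq_norm e \<partial>\<Gamma>) \<le> ennreal (4 * real n)" by simp
  then show "(\<integral>e. sq_norm e \<partial>\<Gamma>) \<le> 4 * real n" by (subst (asm) ennreal_le_iff) auto
qed

lemma noise_law_sq_norm: "(\<integral>\<^sup>+ w. ennreal (sq_norm w) \<partial>noise_law) < \<infinity>"
proof -
  have "(\<integral>\<^sup>+ w. ennreal (sq_norm w) \<partial>noise_law) = (\<integral>\<^sup>+ \<xi>. \<integral>\<^sup>+ e. ennreal (sq_norm (\<lambda>k\<in>I. of_real (sqrt (T \<xi> k)) * e k)) \<partial>\<Gamma> \<partial>S)"
    unfolding noise_law_scale[symmetric]
    by (subst nn_integral_distr, measurable, subst \<Gamma>.nn_integral_fst[symmetric], (measurable)[1], simp)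
  also have "\<dots> < \<infinity>" by (intro nn_integral_sq_norm_scale T_pos nn_integral_T) measurable
  finally show ?thesis .
qed

lemma Q_sq_norm: "(\<integral>\<^sup>+ x. ennreal (sq_norm x) \<partial>Q) < \<infinity>"
proof -
  have "(\<integral>\<^sup>+ x. ennreal (sq_norm x) \<partial>Q) = (\<integral>\<^sup>+ x. (\<Sum>k\<in>I. ennreal ((cmod (x k))\<^sup>2)) \<partial>Q)"
    unfolding sq_norm_def by (simp add: sum_ennreal)
  also have "\<dots> = (\<Sum>k\<in>I. \<integral>\<^sup>+ x. ennreal ((cmod (x k))\<^sup>2) \<partial>Q)"
    by (rule nn_integral_sum) measurable
  also have "\<dots> < \<infinity>" using finite_power by auto
  finally show ?thesis .
qed

lemma out_law_sq_norm: "(\<integral>\<^sup>+ y. ennreal (sq_norm y) \<partial>out_law) < \<infinity>"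
proof -
  have "(\<integral>\<^sup>+ y. ennreal (sq_norm y) \<partial>out_law) = (\<integral>\<^sup>+ \<omega>. \<integral>\<^sup>+ e. ennreal (sq_norm (\<lambda>k\<in>I. of_real (sqrt (V (fst \<omega>) (snd \<omega>) k)) * e k)) \<partial>\<Gamma> \<partial>(Q \<Otimes>\<^sub>M S))"
    unfolding out_law_scale[symmetric]
    by (subst nn_integral_distr, measurable, subst nn_integral_QSG, (measurable)[1], subst S.nn_integral_fst[symmetric], (measurable)[1], simp)
  also have "\<dots> < \<infinity>"
  proof (rule nn_integral_sq_norm_scale)
    fix k assume k: "k \<in> I"
    show "(\<lambda>\<omega>. V (fst \<omega>) (snd \<omega>) k) \<in> borel_measurable (Q \<Otimes>\<^sub>M S)" using k by measurable
    have "(\<integral>\<^sup>+ \<omega>. ennreal (V (fst \<omega>) (snd \<omega>) k) \<partial>(Q \<Otimes>\<^sub>M S)) = (\<integral>\<^sup>+ x. \<integral>\<^sup>+ \<xi>. ennreal (V x \<xi> k) \<partial>S \<partial>Q)"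
      using k by (subst S.nn_integral_fst[symmetric]) ((measurable)[1], simp)
    also have "\<dots> = (\<integral>\<^sup>+ x. \<integral>\<^sup>+ \<xi>. ennreal (T \<xi> k) + ennreal ((cmod (x k))\<^sup>2) \<partial>S \<partial>Q)"
      unfolding V_def by (simp add: T_pos less_imp_le)
    also have "\<dots> = (\<integral>\<^sup>+ x. (\<integral>\<^sup>+ \<xi>. ennreal (T \<xi> k) \<partial>S) + ennreal ((cmod (x k))\<^sup>2) \<partial>Q)"
      using k by (intro nn_integral_cong, subst nn_integral_add) (measurable, simp add: S.emeasure_space_1)
    also have "\<dots> = (\<integral>\<^sup>+ \<xi>. ennreal (T \<xi> k) \<partial>S) + (\<integral>\<^sup>+ x. ennreal ((cmod (x k))\<^sup>2) \<partial>Q)"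
      using k by (subst nn_integral_add) (measurable, simp add: Q.emeasure_space_1)
    also have "\<dots> < \<infinity>" using nn_integral_T[OF k] finite_power[OF k] by simp
    finally show "(\<integral>\<^sup>+ \<omega>. ennreal (V (fst \<omega>) (snd \<omega>) k) \<partial>(Q \<Otimes>\<^sub>M S)) < \<infinity>" .
  qed (rule V_pos)
  finally show ?thesis .
qed

section \<open>Integrability of the log-densities\<close>

definition scale_block :: "real \<Rightarrow> (nat \<Rightarrow> complex) \<Rightarrow> nat \<Rightarrow> complex" where
  "scale_block K w = (\<lambda>k\<in>I. of_real (sqrt K) * w k)"

lemma measurable_scale_block [measurable]: "scale_block K \<in> B \<rightarrow>\<^sub>M B"
  unfolding scale_block_def by measurable

lemma sq_norm_scale_block: "K \<ge> 0 \<Longrightarrow> sq_norm (scale_block K w) = K * sq_norm w"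
  by (simp add: sq_norm_def scale_block_def norm_mult power_mult_distrib sum_distrib_left)

text \<open>Stretching the argument by \<open>sqrt K\<close> only multiplies the exponent of the
  Gaussian-shaped lower bound by \<open>K\<close>, and \<open>noise_law\<close> has a finite second
  moment.\<close>

lemma integrable_ln_noise_scale:
  assumes K: "K \<ge> 0"
  shows "integrable noise_law (\<lambda>w. ln (noise_density (scale_block K w)))"
proof (rule integrable_ln_bounded[where c = c0 and h = "\<lambda>w. K * sq_norm w / \<sigma>2" and u = density_bound])
  have "(\<integral>\<^sup>+ w. ennreal (K * sq_norm w / \<sigma>2) \<partial>noise_law) = (\<integral>\<^sup>+ w. ennreal (K / \<sigma>2) * ennreal (sq_norm w) \<partial>noise_law)"
    using K \<sigma>2_pos by (simp add: ennreal_mult[symmetric] sq_norm_nonneg)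
  also have "\<dots> = ennreal (K / \<sigma>2) * (\<integral>\<^sup>+ w. ennreal (sq_norm w) \<partial>noise_law)"
    by (rule nn_integral_cmult) measurable
  also have "\<dots> < \<infinity>" using noise_law_sq_norm by (simp add: ennreal_mult_less_top)
  finally show "(\<integral>\<^sup>+ w. ennreal (K * sq_norm w / \<sigma>2) \<partial>noise_law) < \<infinity>" .
  show "c0 * exp (- (K * sq_norm w / \<sigma>2)) \<le> noise_density (scale_block K w)" for w
    using noise_density_ge[of "scale_block K w"] K by (simp add: sq_norm_scale_block)
  show "0 \<le> K * sq_norm w / \<sigma>2" for w
    using K \<sigma>2_pos by (simp add: sq_norm_nonneg)
qed (auto simp: NL.finite_measure_axioms c0 noise_density_le)

lemma integrable_ln_noise: "integrable noise_law (\<lambda>w. ln (noise_density w))"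
proof -
  \<comment> \<open>\<open>scale_block\<close> restricts to the time indices, so it is the identity
    only on extensional blocks.\<close>
  have "scale_block 1 w = w" if "w \<in> space noise_law" for w
    using that by (auto simp: scale_block_def sets_eq_imp_space_eq[OF sets_noise_law] space_PiM PiE_def extensional_def)
  then show ?thesis using integrable_ln_noise_scale[of 1] by (simp cong: Bochner_Integration.integrable_cong)
qed

lemma integrable_ln_out: "integrable out_law (\<lambda>y. ln (out_density y))"
proof -
  obtain c where c: "c > 0" "\<forall>y. c * exp (- (sq_norm y / \<sigma>2)) \<le> out_density y"
    using out_density_ge_ex by (elim exE conjE)
  show ?thesis
  proof (rule integrable_ln_bounded[where c = c and h = "\<lambda>w. sq_norm w / \<sigma>2" and u = density_bound])
    have "(\<integral>\<^sup>+ w. ennreal (sq_norm w / \<sigma>2) \<partial>out_law) = (\<integral>\<^sup>+ w. ennreal (1 / \<sigma>2) * ennreal (sq_norm w) \<partial>out_law)"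
      using \<sigma>2_pos by (simp add: ennreal_mult[symmetric] sq_norm_nonneg)
    also have "\<dots> = ennreal (1 / \<sigma>2) * (\<integral>\<^sup>+ w. ennreal (sq_norm w) \<partial>out_law)"
      by (rule nn_integral_cmult) measurable
    also have "\<dots> < \<infinity>" using out_law_sq_norm by (simp add: ennreal_mult_less_top)
    finally show "(\<integral>\<^sup>+ w. ennreal (sq_norm w / \<sigma>2) \<partial>out_law) < \<infinity>" .
    show "0 \<le> sq_norm w / \<sigma>2" for w using \<sigma>2_pos by (simp add: sq_norm_nonneg)
  qed (use c in \<open>auto simp: OL.finite_measure_axioms out_density_le\<close>)
qed

lemma integrable_ln_cond: "integrable joint_law (\<lambda>\<omega>. ln (cond_density (fst \<omega>) (snd \<omega>)))"
proof (rule integrable_ln_bounded[where c = c0 and h = "\<lambda>\<omega>. (sq_norm (fst \<omega>) + sq_norm (snd \<omega>)) / \<sigma>2" and u = density_bound])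
  have "(\<integral>\<^sup>+ \<omega>. ennreal ((sq_norm (fst \<omega>) + sq_norm (snd \<omega>)) / \<sigma>2) \<partial>joint_law)
    = (\<integral>\<^sup>+ \<omega>. ennreal (1 / \<sigma>2) * (ennreal (sq_norm (fst \<omega>)) + ennreal (sq_norm (snd \<omega>))) \<partial>joint_law)"
    using \<sigma>2_pos by (simp add: ennreal_mult[symmetric] sq_norm_nonneg ennreal_plus[symmetric] del: ennreal_plus)
  also have "\<dots> = ennreal (1 / \<sigma>2) * ((\<integral>\<^sup>+ \<omega>. ennreal (sq_norm (fst \<omega>)) \<partial>joint_law) + (\<integral>\<^sup>+ \<omega>. ennreal (sq_norm (snd \<omega>)) \<partial>joint_law))"
    by (subst nn_integral_cmult, measurable, subst nn_integral_add, measurable)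
  also have "(\<integral>\<^sup>+ \<omega>. ennreal (sq_norm (fst \<omega>)) \<partial>joint_law) = (\<integral>\<^sup>+ x. ennreal (sq_norm x) \<partial>Q)"
    by (subst (2) joint_law_fst[symmetric], subst nn_integral_distr) measurable
  also have "(\<integral>\<^sup>+ \<omega>. ennreal (sq_norm (snd \<omega>)) \<partial>joint_law) = (\<integral>\<^sup>+ y. ennreal (sq_norm y) \<partial>out_law)"
    by (subst joint_law_snd[symmetric], subst nn_integral_distr) measurable
  also have "ennreal (1 / \<sigma>2) * ((\<integral>\<^sup>+ x. ennreal (sq_norm x) \<partial>Q) + (\<integral>\<^sup>+ y. ennreal (sq_norm y) \<partial>out_law)) < \<infinity>"
    using Q_sq_norm out_law_sq_norm by (simp add: ennreal_mult_less_top)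
  finally show "(\<integral>\<^sup>+ \<omega>. ennreal ((sq_norm (fst \<omega>) + sq_norm (snd \<omega>)) / \<sigma>2) \<partial>joint_law) < \<infinity>" .
  show "0 \<le> (sq_norm (fst \<omega>) + sq_norm (snd \<omega>)) / \<sigma>2" for \<omega> using \<sigma>2_pos by (simp add: sq_norm_nonneg)
  show "(\<lambda>\<omega>. cond_density (fst \<omega>) (snd \<omega>)) \<in> borel_measurable joint_law"
    by (intro measurable_cond_density) (simp_all add: measurable_cong_sets[OF sets_joint_law sets_Q] measurable_cong_sets[OF sets_joint_law refl])
qed (auto simp: J.finite_measure_axioms c0 cond_density_ge cond_density_le)

section \<open>Entropy comparisons\<close>

lemma measurable_cond_density_BB [measurable]: "(\<lambda>\<omega>. cond_density (fst \<omega>) (snd \<omega>)) \<in> borel_measurable (B \<Otimes>\<^sub>M B)"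
  by (intro measurable_cond_density) (simp_all add: measurable_cong_sets[OF refl sets_Q])

text \<open>Given \<open>x\<close> and \<open>h\<close>, the output is \<open>w\<close> moved by a
  known amount. The ratio of \<open>cond_density x\<close> at \<open>h x + w\<close> to
  \<open>noise_density w\<close> has mean 1: its denominator cancels against the law of
  \<open>w\<close>, and a translated probability density remains.\<close>

lemma integral_ln_cond_le: "(\<integral>\<omega>. ln (cond_density (fst \<omega>) (snd \<omega>)) \<partial>joint_law) \<le> (\<integral>w. ln (noise_density w) \<partial>noise_law)"
proof -
  let ?M = "Q \<Otimes>\<^sub>M \<Gamma> \<Otimes>\<^sub>M noise_law"
  let ?X = "\<lambda>\<omega>. (fst \<omega>, \<lambda>k\<in>I. fst (snd \<omega>) k * fst \<omega> k + snd (snd \<omega>) k) :: (nat \<Rightarrow> complex) \<times> (nat \<Rightarrow> complex)"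
  define U where "U \<omega> = cond_density (fst (?X \<omega>)) (snd (?X \<omega>))" for \<omega> :: "(nat \<Rightarrow> complex) \<times> (nat \<Rightarrow> complex) \<times> (nat \<Rightarrow> complex)"
  define W where "W \<omega> = noise_density (snd (snd \<omega>))" for \<omega> :: "(nat \<Rightarrow> complex) \<times> (nat \<Rightarrow> complex) \<times> (nat \<Rightarrow> complex)"
  have X [measurable]: "?X \<in> ?M \<rightarrow>\<^sub>M B \<Otimes>\<^sub>M B" by measurable
  have P [measurable]: "(\<lambda>\<omega>. snd (snd \<omega>)) \<in> ?M \<rightarrow>\<^sub>M B" by measurable
  have [measurable]: "U \<in> borel_measurable ?M" "W \<in> borel_measurable ?M"
    unfolding U_def W_def by (rule measurable_compose[OF X measurable_cond_density_BB], measurable)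
  have iU: "integrable ?M (\<lambda>\<omega>. ln (U \<omega>))" and eU: "(\<integral>\<omega>. ln (U \<omega>) \<partial>?M) = (\<integral>\<omega>. ln (cond_density (fst \<omega>) (snd \<omega>)) \<partial>joint_law)"
    using integrable_ln_cond
    unfolding joint_law_fading[symmetric] U_def
    by (subst (asm) integrable_distr_eq[OF X]) (measurable, subst integral_distr[OF X], measurable)
  have iW: "integrable ?M (\<lambda>\<omega>. ln (W \<omega>))" and eW: "(\<integral>\<omega>. ln (W \<omega>) \<partial>?M) = (\<integral>w. ln (noise_density w) \<partial>noise_law)"
    unfolding W_def
    using integrable_ln_noise by (subst (asm) noise_law_proj[symmetric], subst (asm) integrable_distr_eq[OF P], measurable)
      (subst (2) noise_law_proj[symmetric], subst integral_distr[OF P], measurable)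
  have pos: "U \<omega> > 0" "W \<omega> > 0" for \<omega>
    unfolding U_def W_def by (rule cond_density_pos noise_density_pos)+
  have ln: "ln (U \<omega> / W \<omega>) = ln (U \<omega>) - ln (W \<omega>)" for \<omega>
    using pos by (intro ln_divide_pos)
  have "(\<integral>\<omega>. ln (U \<omega> / W \<omega>) \<partial>?M) \<le> 0"
  proof (rule integral_ln_nonpos)
    show "prob_space ?M" by (rule QGN.prob_space_axioms)
    show "integrable ?M (\<lambda>\<omega>. ln (U \<omega> / W \<omega>))" unfolding ln using iU iW by (rule Bochner_Integration.integrable_diff)
    have "(\<integral>\<^sup>+ \<omega>. ennreal (U \<omega> / W \<omega>) \<partial>?M) = (\<integral>\<^sup>+ x. \<integral>\<^sup>+ h. \<integral>\<^sup>+ w. ennreal (noise_density w) * ennreal (U (x, h, w) / W (x, h, w)) \<partial>L \<partial>\<Gamma> \<partial>Q)"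
      by (rule nn_integral_QGN) measurable
    also have "\<dots> = (\<integral>\<^sup>+ x. \<integral>\<^sup>+ h. \<integral>\<^sup>+ w. ennreal (cond_density x (\<lambda>k\<in>I. h k * x k + w k)) \<partial>L \<partial>\<Gamma> \<partial>Q)"
    proof (intro nn_integral_cong)
      fix x h w
      have "noise_density w * (U (x, h, w) / W (x, h, w)) = cond_density x (\<lambda>k\<in>I. h k * x k + w k)"
        using noise_density_pos[of w] by (simp add: U_def W_def)
      then show "ennreal (noise_density w) * ennreal (U (x, h, w) / W (x, h, w)) = ennreal (cond_density x (\<lambda>k\<in>I. h k * x k + w k))"
        using pos noise_density_pos[of w] by (metis ennreal_mult' less_imp_le)
    qed
    \<comment> \<open>For fixed \<open>x\<close> and \<open>h\<close> the substitution
      \<open>y = h x + w\<close> preserves Lebesgue measure.\<close>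
    also have "\<dots> = (\<integral>\<^sup>+ x. \<integral>\<^sup>+ h. \<integral>\<^sup>+ y. ennreal (cond_density x y) \<partial>L \<partial>\<Gamma> \<partial>Q)"
      by (intro nn_integral_cong nn_integral_block_lborel_translate[where F = "\<lambda>y. ennreal (cond_density _ y)"]) measurable
    also have "\<dots> = (\<integral>\<^sup>+ x. \<integral>\<^sup>+ h. 1 \<partial>\<Gamma> \<partial>Q)"
      by (intro nn_integral_cong nn_integral_cond_density_eq_1)
    also have "\<dots> = 1" by (simp add: \<Gamma>.emeasure_space_1 Q.emeasure_space_1)
    finally show "(\<integral>\<^sup>+ \<omega>. ennreal (U \<omega> / W \<omega>) \<partial>?M) \<le> 1" by simp
  qed (use pos in auto)
  then show ?thesis unfolding ln using iU iW eU eW by simp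
qed

text \<open>At \<open>w = sqrt T e\<close> the sum in the exponent equals \<open>sq_norm e\<close>,
  so the factor paid for the scaling no longer depends on \<open>T\<close>.\<close>

lemma Phi_T_scale:
  assumes K: "K \<ge> 1"
  shows "Phi I (T \<xi>) (scale_block K w) = Phi I (T \<xi>) w * exp (- ((K - 1) * (\<Sum>k\<in>I. (cmod (w k))\<^sup>2 / T \<xi> k)))"
proof -
  have "phi (T \<xi> k) (scale_block K w k) = phi (T \<xi> k) (w k) * exp (- ((K - 1) * ((cmod (w k))\<^sup>2 / T \<xi> k)))" if "k \<in> I" for k
  proof -
    have "- ((cmod (scale_block K w k))\<^sup>2) / T \<xi> k = - ((cmod (w k))\<^sup>2) / T \<xi> k + - ((K - 1) * ((cmod (w k))\<^sup>2 / T \<xi> k))"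
      using that K T_pos[of \<xi> k] by (simp add: scale_block_def norm_mult power_mult_distrib field_simps)
    then show ?thesis unfolding phi_def by (simp only: exp_add) simp
  qed
  then have "Phi I (T \<xi>) (scale_block K w) = (\<Prod>k\<in>I. phi (T \<xi> k) (w k) * exp (- ((K - 1) * ((cmod (w k))\<^sup>2 / T \<xi> k))))"
    unfolding Phi_def by (rule prod.cong[OF refl])
  also have "\<dots> = Phi I (T \<xi>) w * exp (- ((K - 1) * (\<Sum>k\<in>I. (cmod (w k))\<^sup>2 / T \<xi> k)))"
    unfolding prod.distrib Phi_def by (simp add: exp_sum[symmetric] sum_negf sum_distrib_left)
  finally show ?thesis .
qed

text \<open>For known \<open>T\<close> the scaling changes the log-density at
  \<open>sqrt T e\<close> by exactly \<open>- (K - 1) * sq_norm e\<close>. Replacing the Gaussian by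
  the mixture \<open>noise_density\<close> cannot raise the mean loss, and \<open>sq_norm e\<close>
  has mean at most \<open>4 * real n\<close>.\<close>

lemma integral_ln_noise_scale_ge:
  assumes K: "K \<ge> 1"
  shows "(\<integral>w. ln (noise_density w) \<partial>noise_law) - (K - 1) * (4 * real n) \<le> (\<integral>w. ln (noise_density (scale_block K w)) \<partial>noise_law)"
proof -
  let ?M = "S \<Otimes>\<^sub>M \<Gamma>"
  let ?X = "\<lambda>\<omega>. \<lambda>k\<in>I. of_real (sqrt (T (fst \<omega>) k)) * snd \<omega> k :: complex"
  have X [measurable]: "?X \<in> ?M \<rightarrow>\<^sub>M B" by measurable
  define D where "D w = noise_density w / noise_density (scale_block K w)" for w
  have [measurable]: "D \<in> borel_measurable B" unfolding D_def by measurable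
  have Dpos: "D w > 0" for w unfolding D_def by (simp add: noise_density_pos)
  have lnD: "ln (D w) = ln (noise_density w) - ln (noise_density (scale_block K w))" for w
    unfolding D_def by (intro ln_divide_pos noise_density_pos)
  have iD: "integrable noise_law (\<lambda>w. ln (D w))"
    unfolding lnD using K by (intro Bochner_Integration.integrable_diff integrable_ln_noise integrable_ln_noise_scale) simp
  have iD': "integrable ?M (\<lambda>\<omega>. ln (D (?X \<omega>)))" and eD: "(\<integral>\<omega>. ln (D (?X \<omega>)) \<partial>?M) = (\<integral>w. ln (D w) \<partial>noise_law)"
    using iD unfolding noise_law_scale[symmetric]
    by (subst (asm) integrable_distr_eq[OF X]) (measurable, subst integral_distr[OF X], measurable)
  have iE: "integrable ?M (\<lambda>\<omega>. sq_norm (snd \<omega>))" and eE: "(\<integral>\<omega>. sq_norm (snd \<omega>) \<partial>?M) = (\<integral>e. sq_norm e \<partial>\<Gamma>)"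
  proof -
    have d: "distr ?M B snd = \<Gamma>"
    proof (rule distr_eqI_nn_integral)
      fix F :: "_ \<Rightarrow> ennreal" assume F [measurable]: "F \<in> borel_measurable B"
      show "(\<integral>\<^sup>+ \<omega>. F (snd \<omega>) \<partial>?M) = (\<integral>\<^sup>+ e. F e \<partial>\<Gamma>)"
        by (subst \<Gamma>.nn_integral_fst[symmetric]) ((measurable)[1], simp add: S.emeasure_space_1)
    qed ((measurable)[1], simp add: sets_PiM_complex_gaussian)
    have s: "snd \<in> ?M \<rightarrow>\<^sub>M B" by measurable
    show "integrable ?M (\<lambda>\<omega>. sq_norm (snd \<omega>))"
      by (rule integrable_distr[OF s]) (simp add: d Gamma_sq_norm(1))
    show "(\<integral>\<omega>. sq_norm (snd \<omega>) \<partial>?M) = (\<integral>e. sq_norm e \<partial>\<Gamma>)"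
      using integral_distr[OF s measurable_sq_norm] by (simp add: d)
  qed
  \<comment> \<open>By \<open>Phi_T_scale\<close> the exponential is the quotient of
    \<open>Phi I (T \<xi>)\<close> at \<open>scale_block K w\<close> and at \<open>w\<close>, where
    \<open>w = sqrt T e\<close>; \<open>D\<close> divides this by the corresponding quotient of
    mixtures.\<close>
  define R where "R \<omega> = exp (- ((K - 1) * sq_norm (snd \<omega>))) * D (?X \<omega>)" for \<omega> :: "(nat \<Rightarrow> nat \<Rightarrow> complex) \<times> (nat \<Rightarrow> complex)"
  have [measurable]: "R \<in> borel_measurable ?M" unfolding R_def by measurable
  have lnR: "ln (R \<omega>) = ln (D (?X \<omega>)) - (K - 1) * sq_norm (snd \<omega>)" for \<omega>
    unfolding R_def by (subst ln_mult_pos) (auto simp: Dpos)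
  have "(\<integral>\<omega>. ln (R \<omega>) \<partial>?M) \<le> 0"
  proof (rule integral_ln_nonpos)
    show "prob_space ?M" by (rule SG.prob_space_axioms)
    show "integrable ?M (\<lambda>\<omega>. ln (R \<omega>))" unfolding lnR using iD' iE by (intro Bochner_Integration.integrable_diff integrable_mult_right)
    have "(\<integral>\<^sup>+ \<omega>. ennreal (R \<omega>) \<partial>?M) = (\<integral>\<^sup>+ \<xi>. \<integral>\<^sup>+ e. ennreal (R (\<xi>, e)) \<partial>\<Gamma> \<partial>S)"
      by (rule \<Gamma>.nn_integral_fst[symmetric]) measurable
    also have "\<dots> = (\<integral>\<^sup>+ \<xi>. \<integral>\<^sup>+ w. ennreal (Phi I (T \<xi>) (scale_block K w)) * ennreal (D w) \<partial>L \<partial>S)"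
    proof (intro nn_integral_cong)
      fix \<xi> assume [measurable]: "\<xi> \<in> space S"
      let ?F = "\<lambda>w. ennreal (exp (- ((K - 1) * (\<Sum>k\<in>I. (cmod (w k))\<^sup>2 / T \<xi> k))) * D w)"
      have "(\<integral>\<^sup>+ e. ennreal (R (\<xi>, e)) \<partial>\<Gamma>) = (\<integral>\<^sup>+ e. ?F (\<lambda>k\<in>I. of_real (sqrt (T \<xi> k)) * e k) \<partial>\<Gamma>)"
      proof (intro nn_integral_cong)
        fix e
        have "(\<Sum>k\<in>I. (cmod ((\<lambda>k\<in>I. of_real (sqrt (T \<xi> k)) * e k) k))\<^sup>2 / T \<xi> k) = sq_norm e"
          unfolding sq_norm_def using T_pos less_imp_neq[OF T_pos]
          by (intro sum.cong) (auto simp: norm_mult power_mult_distrib less_imp_le T_pos)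
        then show "ennreal (R (\<xi>, e)) = ?F (\<lambda>k\<in>I. of_real (sqrt (T \<xi> k)) * e k)"
          unfolding R_def by simp
      qed
      also have "\<dots> = (\<integral>\<^sup>+ w. ennreal (Phi I (T \<xi>) w) * ?F w \<partial>L)"
        by (rule nn_integral_Phi_scale[symmetric]) (auto simp: T_pos)
      also have "\<dots> = (\<integral>\<^sup>+ w. ennreal (Phi I (T \<xi>) (scale_block K w)) * ennreal (D w) \<partial>L)"
      proof (intro nn_integral_cong)
        fix w
        have "ennreal (Phi I (T \<xi>) w) * ?F w = ennreal (Phi I (T \<xi>) w * (exp (- ((K - 1) * (\<Sum>k\<in>I. (cmod (w k))\<^sup>2 / T \<xi> k))) * D w))"
          by (intro ennreal_mult[symmetric]) (auto simp: Phi_pos T_pos Dpos less_imp_le)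
        also have "\<dots> = ennreal (Phi I (T \<xi>) (scale_block K w) * D w)"
          unfolding Phi_T_scale[OF K] by (simp only: mult.assoc)
        also have "\<dots> = ennreal (Phi I (T \<xi>) (scale_block K w)) * ennreal (D w)"
          by (intro ennreal_mult) (auto simp: Phi_pos T_pos Dpos less_imp_le)
        finally show "ennreal (Phi I (T \<xi>) w) * ?F w = ennreal (Phi I (T \<xi>) (scale_block K w)) * ennreal (D w)" .
      qed
      finally show "(\<integral>\<^sup>+ e. ennreal (R (\<xi>, e)) \<partial>\<Gamma>) = (\<integral>\<^sup>+ w. ennreal (Phi I (T \<xi>) (scale_block K w)) * ennreal (D w) \<partial>L)" .
    qed
    also have "\<dots> = (\<integral>\<^sup>+ w. \<integral>\<^sup>+ \<xi>. ennreal (Phi I (T \<xi>) (scale_block K w)) * ennreal (D w) \<partial>S \<partial>L)"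
    proof (rule SL.Fubini'[symmetric])
      have "(\<lambda>\<omega>. scale_block K (snd \<omega>)) \<in> S \<Otimes>\<^sub>M L \<rightarrow>\<^sub>M B" by measurable
      then have [measurable]: "(\<lambda>\<omega>. scale_block K (snd \<omega>) k) \<in> borel_measurable (S \<Otimes>\<^sub>M L)" if "k \<in> I" for k
        using that by (rule measurable_compose[OF _ measurable_component_singleton])
      show "(\<lambda>(\<xi>, w). ennreal (Phi I (T \<xi>) (scale_block K w)) * ennreal (D w)) \<in> borel_measurable (S \<Otimes>\<^sub>M L)"
        unfolding case_prod_beta by measurable
    qed
    also have "\<dots> = (\<integral>\<^sup>+ w. (\<integral>\<^sup>+ \<xi>. ennreal (Phi I (T \<xi>) (scale_block K w)) \<partial>S) * ennreal (D w) \<partial>L)"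
      by (intro nn_integral_cong nn_integral_multc) measurable
    \<comment> \<open>The average over \<xi> restores the mixture at the scaled point, which cancels
      the denominator of \<open>D\<close>.\<close>
    also have "\<dots> = (\<integral>\<^sup>+ w. ennreal (noise_density w) \<partial>L)"
    proof (intro nn_integral_cong)
      fix w
      have "noise_density (scale_block K w) * D w = noise_density w"
        using noise_density_pos[of "scale_block K w"] by (simp add: D_def)
      then show "(\<integral>\<^sup>+ \<xi>. ennreal (Phi I (T \<xi>) (scale_block K w)) \<partial>S) * ennreal (D w) = ennreal (noise_density w)"
        unfolding ennreal_noise_density[symmetric] using Dpos noise_density_pos by (metis ennreal_mult less_imp_le)
    qed
    also have "\<dots> = 1" unfolding noise_density_def by (rule nn_integral_cond_density_eq_1) simp
    finally show "(\<integral>\<^sup>+ \<omega>. ennreal (R \<omega>) \<partial>?M) \<le> 1" by simp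
  qed (auto simp: R_def Dpos)
  moreover have "(\<integral>\<omega>. ln (R \<omega>) \<partial>?M) = (\<integral>w. ln (D w) \<partial>noise_law) - (K - 1) * (\<integral>e. sq_norm e \<partial>\<Gamma>)"
    unfolding lnR using iD' iE eD eE by (subst Bochner_Integration.integral_diff) auto
  moreover have "(\<integral>w. ln (D w) \<partial>noise_law) = (\<integral>w. ln (noise_density w) \<partial>noise_law) - (\<integral>w. ln (noise_density (scale_block K w)) \<partial>noise_law)"
    unfolding lnD using K by (intro Bochner_Integration.integral_diff integrable_ln_noise integrable_ln_noise_scale) simp
  moreover have "(K - 1) * (\<integral>e. sq_norm e \<partial>\<Gamma>) \<le> (K - 1) * (4 * real n)"
    using K Gamma_sq_norm(2) by (intro mult_left_mono) auto
  ultimately show ?thesis by linarith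
qed

section \<open>The mutual information of a block\<close>

abbreviation "prod_law \<equiv> Q \<Otimes>\<^sub>M out_law"

lemma sets_prod_law: "sets prod_law = sets (B \<Otimes>\<^sub>M B)"
  by (intro sets_pair_measure_cong sets_Q sets_out_law)

text \<open>The output density is positive everywhere, so dividing by it and integrating against
  \<open>out_law\<close> recovers the conditional density. The quotient is the likelihood ratio
  behind the mutual information.\<close>

lemma joint_law_density:
  "density prod_law (\<lambda>\<omega>. ennreal (cond_density (fst \<omega>) (snd \<omega>) / out_density (snd \<omega>))) = joint_law"
proof (rule measure_eqI)
  let ?h = "\<lambda>\<omega>. ennreal (cond_density (fst \<omega>) (snd \<omega>) / out_density (snd \<omega>))"
  show "sets (density prod_law ?h) = sets joint_law"
    by (simp add: sets_prod_law sets_joint_law)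
  fix A assume "A \<in> sets (density prod_law ?h)"
  then have A [measurable]: "A \<in> sets (B \<Otimes>\<^sub>M B)" by (simp add: sets_prod_law)
  have "emeasure (density prod_law ?h) A = (\<integral>\<^sup>+ \<omega>. ?h \<omega> * indicator A \<omega> \<partial>prod_law)"
    by (rule emeasure_density) measurable
  also have "\<dots> = (\<integral>\<^sup>+ x. \<integral>\<^sup>+ y. ?h (x, y) * indicator A (x, y) \<partial>out_law \<partial>Q)"
    by (rule OL.nn_integral_fst[symmetric]) measurable
  also have "\<dots> = (\<integral>\<^sup>+ x. \<integral>\<^sup>+ y. ennreal (cond_density x y) * indicator A (x, y) \<partial>L \<partial>Q)"
  proof (intro nn_integral_cong)
    fix x assume x [measurable]: "x \<in> space Q"
    then have [measurable]: "x \<in> space B" by (simp add: space_Q)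
    have "(\<integral>\<^sup>+ y. ?h (x, y) * indicator A (x, y) \<partial>out_law) = (\<integral>\<^sup>+ y. ennreal (out_density y) * (?h (x, y) * indicator A (x, y)) \<partial>L)"
      unfolding out_law_def by (rule nn_integral_density) measurable
    also have "\<dots> = (\<integral>\<^sup>+ y. ennreal (cond_density x y) * indicator A (x, y) \<partial>L)"
    proof (intro nn_integral_cong)
      fix y
      have "ennreal (out_density y) * ?h (x, y) = ennreal (cond_density x y)"
        using out_density_pos[of y] cond_density_pos[of x y] by (simp add: ennreal_mult[symmetric])
      then show "ennreal (out_density y) * (?h (x, y) * indicator A (x, y)) = ennreal (cond_density x y) * indicator A (x, y)"
        by (simp add: mult.assoc[symmetric])
    qed
    finally show "(\<integral>\<^sup>+ y. ?h (x, y) * indicator A (x, y) \<partial>out_law) = (\<integral>\<^sup>+ y. ennreal (cond_density x y) * indicator A (x, y) \<partial>L)" .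
  qed
  also have "\<dots> = (\<integral>\<^sup>+ \<omega>. indicator A \<omega> \<partial>joint_law)"
    by (rule nn_integral_joint_law[symmetric]) measurable
  also have "\<dots> = emeasure joint_law A"
    by (rule nn_integral_indicator) (simp add: sets_joint_law A)
  finally show "emeasure (density prod_law ?h) A = emeasure joint_law A" .
qed

lemma absolutely_continuous_joint_law: "absolutely_continuous prod_law joint_law"
  unfolding joint_law_density[symmetric] by (rule absolutely_continuousI_density) measurable

text \<open>\<open>RN_deriv\<close> is determined only up to null sets of \<open>prod_law\<close>;
  absolute continuity carries these over to \<open>joint_law\<close>. Positivity of both densities
  splits the logarithm of the quotient.\<close>

lemma entropy_density_joint_law:
  "AE \<omega> in joint_law. entropy_density (exp 1) prod_law joint_law \<omega> = ln (cond_density (fst \<omega>) (snd \<omega>)) - ln (out_density (snd \<omega>))"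
proof -
  interpret P: prob_space prod_law by (intro prob_space_pair prob_Q OL.prob_space_axioms)
  have "AE \<omega> in prod_law. ennreal (cond_density (fst \<omega>) (snd \<omega>) / out_density (snd \<omega>)) = RN_deriv prod_law joint_law \<omega>"
    by (rule P.RN_deriv_unique[OF _ joint_law_density]) measurable
  then have "AE \<omega> in joint_law. ennreal (cond_density (fst \<omega>) (snd \<omega>) / out_density (snd \<omega>)) = RN_deriv prod_law joint_law \<omega>"
    by (rule absolutely_continuous_AE[OF _ absolutely_continuous_joint_law, rotated]) (simp add: sets_prod_law sets_joint_law)
  then show ?thesis
  proof (elim eventually_mono)
    fix \<omega> assume e: "ennreal (cond_density (fst \<omega>) (snd \<omega>) / out_density (snd \<omega>)) = RN_deriv prod_law joint_law \<omega>"
    have "cond_density (fst \<omega>) (snd \<omega>) / out_density (snd \<omega>) > 0"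
      by (intro divide_pos_pos cond_density_pos out_density_pos)
    then have "entropy_density (exp 1) prod_law joint_law \<omega> = ln (cond_density (fst \<omega>) (snd \<omega>) / out_density (snd \<omega>))"
      unfolding entropy_density_def comp_def e[symmetric] by (simp add: log_def)
    then show "entropy_density (exp 1) prod_law joint_law \<omega> = ln (cond_density (fst \<omega>) (snd \<omega>)) - ln (out_density (snd \<omega>))"
      unfolding ln_divide_pos[OF cond_density_pos out_density_pos] .
  qed
qed

text \<open>This is \<open>h(Y) - h(Y|X)\<close>. Integrability of both logarithms puts
  \<open>mutual_info_nats\<close> into its finite branch, and splits the integral.\<close>

lemma block_information_eq:
  "block_information \<alpha> \<sigma>2 n Q = ereal ((\<integral>\<omega>. ln (cond_density (fst \<omega>) (snd \<omega>)) \<partial>joint_law) - (\<integral>y. ln (out_density y) \<partial>out_law))"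
proof -
  let ?e = "entropy_density (exp 1) prod_law joint_law"
  have s: "snd \<in> joint_law \<rightarrow>\<^sub>M B" by measurable
  have io: "integrable joint_law (\<lambda>\<omega>. ln (out_density (snd \<omega>)))"
    by (rule integrable_distr[OF s]) (simp add: joint_law_snd integrable_ln_out)
  have eo: "(\<integral>\<omega>. ln (out_density (snd \<omega>)) \<partial>joint_law) = (\<integral>y. ln (out_density y) \<partial>out_law)"
    using integral_distr[OF s, of "\<lambda>y. ln (out_density y)"] by (simp add: joint_law_snd)
  have me: "?e \<in> borel_measurable joint_law"
    using measurable_entropy_density[of "exp 1" prod_law joint_law]
    by (simp add: measurable_cong_sets[OF sets_prod_law refl] measurable_cong_sets[OF sets_joint_law refl])
  have mi: "(\<lambda>\<omega>. ln (cond_density (fst \<omega>) (snd \<omega>)) - ln (out_density (snd \<omega>))) \<in> borel_measurable joint_law"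
    using integrable_ln_cond io by (intro borel_measurable_integrable Bochner_Integration.integrable_diff)
  have i: "integrable joint_law ?e"
    by (subst integrable_cong_AE[OF me mi entropy_density_joint_law]) (intro Bochner_Integration.integrable_diff integrable_ln_cond io)
  have e: "integral\<^sup>L joint_law ?e = (\<integral>\<omega>. ln (cond_density (fst \<omega>) (snd \<omega>)) \<partial>joint_law) - (\<integral>y. ln (out_density y) \<partial>out_law)"
    unfolding integral_cong_AE[OF me mi entropy_density_joint_law] eo[symmetric]
    by (rule Bochner_Integration.integral_diff[OF integrable_ln_cond io])
  interpret C: prob_space "channel_space \<alpha> \<sigma>2 n Q" by (rule prob_space_channel_space)
  show ?thesis
    unfolding block_information_def mutual_info_nats_def Let_def C.mutual_information_def KL_divergence_def
      channel_input_law channel_output_law channel_joint_law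
    by (simp add: absolutely_continuous_joint_law i e)
qed

end

section \<open>Comparison of the output with the shifted interference\<close>

locale interference_decay = interference_block +
  fixes \<rho> :: real
  assumes \<rho>: "0 < \<rho>" "\<rho> < 1" and \<alpha>_decr: "\<And>l. \<alpha> (Suc l) \<le> \<alpha> l" and \<alpha>_ratio: "\<And>l. \<rho> * \<alpha> l \<le> \<alpha> (Suc l)"
begin

text \<open>Relative to \<open>V\<close>, the shifted variance weights the noise by 1, the
  transmitter by \<open>\<alpha> 0\<close>, and interferer \<open>l\<close> by
  \<open>\<alpha> (Suc l) / \<alpha> l\<close>, which lies between \<rho> and 1. \<open>lo\<close>
  and \<open>up\<close> bound all these weights; the weight 1 is covered in \<open>lo\<close> by
  \<open>\<rho> < 1\<close>.\<close>

definition lo :: real where "lo = min \<rho> (\<alpha> 0)"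
definition up :: real where "up = max 1 (\<alpha> 0)"

lemma lo_pos: "lo > 0" using \<rho> \<alpha>_pos by (simp add: lo_def)
lemma lo_le: "lo \<le> 1" "lo \<le> \<rho>" "lo \<le> \<alpha> 0" using \<rho> by (auto simp: lo_def)
lemma up_ge: "up \<ge> 1" "up \<ge> \<alpha> 0" by (auto simp: up_def)

text \<open>Finite power makes both occurrences of \<open>T\<close> genuine convergent series, so
  the comparison can be made term by term: noise, transmitter, each interferer.\<close>

lemma T_shift_bounds:
  assumes fin: "(\<Sum>l. ennreal (\<alpha> l * (cmod (\<xi> l k))\<^sup>2)) < \<infinity>"
  shows "lo * V x \<xi> k \<le> T (case_nat x \<xi>) k" "T (case_nat x \<xi>) k \<le> up * V x \<xi> k"
proof -
  let ?a = "\<lambda>l. \<alpha> l * (cmod (\<xi> l k))\<^sup>2" and ?b = "\<lambda>l. \<alpha> (Suc l) * (cmod (\<xi> l k))\<^sup>2"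
  let ?c = "\<lambda>l. \<alpha> l * (cmod (case_nat x \<xi> l k))\<^sup>2"
  have a0: "?a l \<ge> 0" and b0: "?b l \<ge> 0" and c0: "?c l \<ge> 0" for l
    using \<alpha>_pos[of l] \<alpha>_pos[of "Suc l"] by auto
  have ba: "?b l \<le> ?a l" and ab: "\<rho> * ?a l \<le> ?b l" for l
    using \<alpha>_decr[of l] \<alpha>_ratio[of l] by (auto simp: mult.assoc[symmetric] intro: mult_right_mono)
  have sa: "summable ?a" using fin a0 by (intro summable_suminf_not_top) auto
  have sb: "summable ?b" by (rule summable_comparison_test'[OF sa]) (use ba b0 in auto)
  \<comment> \<open>Past index 0 the shifted series carries the symbols of \<xi>, each weighted by
    the next fading variance.\<close>
  have cb: "(\<lambda>l. ?c (Suc l)) = ?b" by simp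
  then have sc: "summable ?c" using sb summable_Suc_iff[of ?c] by simp
  have Sc: "suminf ?c = \<alpha> 0 * (cmod (x k))\<^sup>2 + suminf ?b"
    using suminf_split_head[OF sc] unfolding cb by simp
  have T1: "T \<xi> k = \<sigma>2 + suminf ?a"
    unfolding T_def by (subst suminf_ennreal2) (auto simp: a0 sa suminf_nonneg)
  have T2: "T (case_nat x \<xi>) k = \<sigma>2 + (\<alpha> 0 * (cmod (x k))\<^sup>2 + suminf ?b)"
    unfolding T_def Sc[symmetric] by (subst suminf_ennreal2) (auto simp only: c0 sc suminf_nonneg enn2real_ennreal)
  have sle: "suminf ?b \<le> suminf ?a" by (intro suminf_le ba sa sb)
  have "\<rho> * suminf ?a \<le> suminf ?b"
    unfolding suminf_mult[OF sa, symmetric] by (intro suminf_le ab summable_mult sa sb)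
  moreover have pa: "suminf ?a \<ge> 0" by (intro suminf_nonneg sa a0)
  ultimately have sge: "lo * suminf ?a \<le> suminf ?b"
    using mult_right_mono[OF lo_le(2) pa] by linarith
  have "lo * \<sigma>2 \<le> \<sigma>2" "lo * (cmod (x k))\<^sup>2 \<le> \<alpha> 0 * (cmod (x k))\<^sup>2"
    using lo_le \<sigma>2_pos by (auto intro: mult_right_mono)
  then show "lo * V x \<xi> k \<le> T (case_nat x \<xi>) k"
    unfolding V_def T1 T2 using sge by (simp add: algebra_simps)
  have "\<sigma>2 \<le> up * \<sigma>2" "\<alpha> 0 * (cmod (x k))\<^sup>2 \<le> up * (cmod (x k))\<^sup>2" "suminf ?a \<le> up * suminf ?a"
    using up_ge \<sigma>2_pos pa mult_right_mono[OF up_ge(1) pa] by (auto intro: mult_right_mono)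
  then show "T (case_nat x \<xi>) k \<le> up * V x \<xi> k"
    unfolding V_def T1 T2 using sle by (simp add: algebra_simps)
qed

text \<open>With \<open>T'\<close> the shifted variance, each bound serves one part of the Gaussian:
  \<open>T' \<le> up * V\<close> makes the exponent at the stretched argument the smaller one, and
  \<open>lo * V \<le> T'\<close> pays for the normalisation with a factor \<open>lo\<close> per time
  index.\<close>

lemma Phi_V_ge_shift:
  assumes fin: "\<forall>k\<in>I. (\<Sum>l. ennreal (\<alpha> l * (cmod (\<xi> l k))\<^sup>2)) < \<infinity>"
  shows "lo ^ n * Phi I (T (case_nat x \<xi>)) (scale_block up y) \<le> Phi I (V x \<xi>) y"
proof -
  have "lo * phi (T (case_nat x \<xi>) k) (scale_block up y k) \<le> phi (V x \<xi> k) (y k)" if k: "k \<in> I" for k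
  proof -
    let ?T = "T (case_nat x \<xi>) k" and ?V = "V x \<xi> k"
    note b = T_shift_bounds[where \<xi> = \<xi> and k = k and x = x, OF bspec[OF fin k]]
    have T0: "?T > 0" and V0: "?V > 0" by (rule T_pos V_pos)+
    have "(cmod (y k))\<^sup>2 / ?V \<le> up * (cmod (y k))\<^sup>2 / ?T"
      using mult_right_mono[OF b(2), of "(cmod (y k))\<^sup>2"] T0 V0 by (simp add: field_simps)
    moreover have "(cmod (scale_block up y k))\<^sup>2 = up * (cmod (y k))\<^sup>2"
      using k up_ge by (simp add: scale_block_def norm_mult power_mult_distrib)
    ultimately have 1: "exp (- (cmod (scale_block up y k))\<^sup>2 / ?T) \<le> exp (- (cmod (y k))\<^sup>2 / ?V)"
      by simp
    have 2: "lo / (pi * ?T) \<le> 1 / (pi * ?V)"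
      using b(1) T0 V0 lo_pos by (simp add: field_simps)
    have "lo * phi ?T (scale_block up y k) = exp (- (cmod (scale_block up y k))\<^sup>2 / ?T) * (lo / (pi * ?T))"
      by (simp add: phi_def)
    also have "\<dots> \<le> exp (- (cmod (y k))\<^sup>2 / ?V) * (1 / (pi * ?V))"
      using 1 2 T0 lo_pos by (intro mult_mono) auto
    finally show ?thesis by (simp add: phi_def)
  qed
  then have "(\<Prod>k\<in>I. lo * phi (T (case_nat x \<xi>) k) (scale_block up y k)) \<le> Phi I (V x \<xi>) y"
    unfolding Phi_def using lo_pos by (intro prod_mono) (auto intro!: less_imp_le[OF mult_pos_pos] phi_pos T_pos)
  then show ?thesis by (simp add: prod.distrib Phi_def)
qed

text \<open>Averaging \<open>Phi_V_ge_shift\<close> over \<open>x\<close> and \<xi> gives the output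
  density on the right and, by shift invariance, the noise density on the left.\<close>

lemma out_density_ge_noise:
  assumes y: "y \<in> space B"
  shows "lo ^ n * noise_density (scale_block up y) \<le> out_density y"
proof -
  have [measurable]: "scale_block up y \<in> space B" using measurable_space[OF measurable_scale_block y] .
  have m [measurable]: "(\<lambda>\<xi>. ennreal (Phi I (T \<xi>) (scale_block up y))) \<in> borel_measurable S" by measurable
  have "ennreal (lo ^ n * noise_density (scale_block up y)) = ennreal (lo ^ n) * (\<integral>\<^sup>+ x. \<integral>\<^sup>+ \<xi>. ennreal (Phi I (T (case_nat x \<xi>)) (scale_block up y)) \<partial>S \<partial>Q)"
    unfolding nn_integral_shift[OF m] ennreal_noise_density[symmetric]
    using lo_pos noise_density_pos[of "scale_block up y"] by (intro ennreal_mult) auto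
  also have "\<dots> = (\<integral>\<^sup>+ x. ennreal (lo ^ n) * (\<integral>\<^sup>+ \<xi>. ennreal (Phi I (T (case_nat x \<xi>)) (scale_block up y)) \<partial>S) \<partial>Q)"
    by (rule nn_integral_cmult[symmetric]) measurable
  also have "\<dots> = (\<integral>\<^sup>+ x. \<integral>\<^sup>+ \<xi>. ennreal (lo ^ n) * ennreal (Phi I (T (case_nat x \<xi>)) (scale_block up y)) \<partial>S \<partial>Q)"
    by (intro nn_integral_cong nn_integral_cmult[symmetric]) measurable
  also have "\<dots> \<le> (\<integral>\<^sup>+ x. \<integral>\<^sup>+ \<xi>. ennreal (Phi I (V x \<xi>) y) \<partial>S \<partial>Q)"
  proof (rule nn_integral_mono, rule nn_integral_mono_AE)
    fix x
    show "AE \<xi> in S. ennreal (lo ^ n) * ennreal (Phi I (T (case_nat x \<xi>)) (scale_block up y)) \<le> ennreal (Phi I (V x \<xi>) y)"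
      using interference_power_finite_AE
    proof (elim eventually_mono)
      fix \<xi> assume "\<forall>k\<in>I. (\<Sum>l. ennreal (\<alpha> l * (cmod (\<xi> l k))\<^sup>2)) < \<infinity>"
      from Phi_V_ge_shift[OF this, of x y] lo_pos
      show "ennreal (lo ^ n) * ennreal (Phi I (T (case_nat x \<xi>)) (scale_block up y)) \<le> ennreal (Phi I (V x \<xi>) y)"
        by (simp add: ennreal_mult'[symmetric] ennreal_leI)
    qed
  qed
  also have "\<dots> = ennreal (out_density y)" by (simp add: ennreal_out_density ennreal_cond_density)
  finally show ?thesis using out_density_pos[of y] by (subst (asm) ennreal_le_iff) auto
qed

text \<open>Every component of the mixture is a centred Gaussian, decreasing in each modulus. This
  lets a stretched output be replaced by a copy of \<open>W\<close> stretched far enough to have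
  larger moduli.\<close>

lemma noise_density_antimono:
  assumes "\<And>k. k \<in> I \<Longrightarrow> cmod (y k) \<le> cmod (z k)"
  shows "noise_density z \<le> noise_density y"
proof -
  have "(\<integral>\<^sup>+ \<xi>. ennreal (Phi I (T \<xi>) z) \<partial>S) \<le> (\<integral>\<^sup>+ \<xi>. ennreal (Phi I (T \<xi>) y) \<partial>S)"
  proof (intro nn_integral_mono ennreal_leI)
    fix \<xi>
    have "phi (T \<xi> k) (z k) \<le> phi (T \<xi> k) (y k)" if "k \<in> I" for k
      unfolding phi_def using assms[OF that] T_pos[of \<xi> k]
      by (intro divide_right_mono) (auto intro!: divide_right_mono power_mono)
    then show "Phi I (T \<xi>) z \<le> Phi I (T \<xi>) y"
      unfolding Phi_def by (intro prod_mono) (auto intro: less_imp_le phi_pos T_pos)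
  qed
  then show ?thesis
    unfolding ennreal_noise_density[symmetric] using noise_density_pos[of y] by (subst (asm) ennreal_le_iff) auto
qed

text \<open>The interference plus noise and the output are realised on one space as
  \<open>sqrt T' e\<close> and \<open>sqrt V e\<close> with the same Gaussian \<open>e\<close>, where \<open>T'\<close> is obtained by
  shifting the transmitter into the sequence of interferers.\<close>
lemma integral_ln_out_ge:
  "real n * ln lo + (\<integral>w. ln (noise_density (scale_block (up / lo) w)) \<partial>noise_law) \<le> (\<integral>y. ln (out_density y) \<partial>out_law)"
proof -
  let ?M = "Q \<Otimes>\<^sub>M S \<Otimes>\<^sub>M \<Gamma>"
  let ?Y = "\<lambda>\<omega>. \<lambda>k\<in>I. of_real (sqrt (V (fst \<omega>) (fst (snd \<omega>)) k)) * snd (snd \<omega>) k :: complex"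
  let ?W = "\<lambda>\<omega>. \<lambda>k\<in>I. of_real (sqrt (T (case_nat (fst \<omega>) (fst (snd \<omega>))) k)) * snd (snd \<omega>) k :: complex"
  have Y [measurable]: "?Y \<in> ?M \<rightarrow>\<^sub>M B" by measurable
  have W [measurable]: "?W \<in> ?M \<rightarrow>\<^sub>M B" by measurable
  have K: "up / lo \<ge> 0" using up_ge lo_pos by simp
  have iY: "integrable ?M (\<lambda>\<omega>. ln (out_density (?Y \<omega>)))"
    by (rule integrable_distr[OF Y]) (simp only: out_law_scale integrable_ln_out)
  have eY: "(\<integral>\<omega>. ln (out_density (?Y \<omega>)) \<partial>?M) = (\<integral>y. ln (out_density y) \<partial>out_law)"
    using integral_distr[OF Y, of "\<lambda>y. ln (out_density y)"] unfolding out_law_scale by simp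
  let ?g = "\<lambda>w. ln (noise_density (scale_block (up / lo) w))"
  have iW: "integrable ?M (\<lambda>\<omega>. ?g (?W \<omega>))"
    by (rule integrable_distr[OF W]) (simp only: noise_law_shift integrable_ln_noise_scale[OF K])
  have eW: "(\<integral>\<omega>. ?g (?W \<omega>) \<partial>?M) = (\<integral>w. ?g w \<partial>noise_law)"
    using integral_distr[OF W, of ?g] unfolding noise_law_shift by simp
  have m: "(\<lambda>\<omega>. fst (snd \<omega>)) \<in> ?M \<rightarrow>\<^sub>M S" by measurable
  have d: "distr ?M S (\<lambda>\<omega>. fst (snd \<omega>)) = S"
  proof (rule distr_eqI_nn_integral)
    fix F :: "_ \<Rightarrow> ennreal" assume F [measurable]: "F \<in> borel_measurable S"
    show "(\<integral>\<^sup>+ \<omega>. F (fst (snd \<omega>)) \<partial>?M) = (\<integral>\<^sup>+ \<xi>. F \<xi> \<partial>S)"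
      by (subst nn_integral_QSG) ((measurable)[1], simp add: \<Gamma>.emeasure_space_1 Q.emeasure_space_1)
  qed ((measurable)[1], simp)
  have fin: "AE \<omega> in ?M. \<forall>k\<in>I. (\<Sum>l. ennreal (\<alpha> l * (cmod (fst (snd \<omega>) l k))\<^sup>2)) < \<infinity>"
    by (rule AE_distrD[OF m, where P = "\<lambda>\<xi>. \<forall>k\<in>I. (\<Sum>l. ennreal (\<alpha> l * (cmod (\<xi> l k))\<^sup>2)) < \<infinity>"])
       (subst d, rule interference_power_finite_AE)
  have ae: "AE \<omega> in ?M. real n * ln lo + ?g (?W \<omega>) \<le> ln (out_density (?Y \<omega>))"
    using fin AE_space
  proof eventually_elim
    case (elim \<omega>)
    have sp: "?Y \<omega> \<in> space B" using measurable_space[OF Y elim(2)] .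
    \<comment> \<open>Here \<open>K = up / lo\<close> originates: \<open>lo * V \<le> T'\<close>
      gives \<open>up * V \<le> (up / lo) * T'\<close>, and both blocks are driven by the same
      Gaussian.\<close>
    have "cmod (scale_block up (?Y \<omega>) k) \<le> cmod (scale_block (up / lo) (?W \<omega>) k)" if k: "k \<in> I" for k
    proof -
      have "up * V (fst \<omega>) (fst (snd \<omega>)) k \<le> up / lo * T (case_nat (fst \<omega>) (fst (snd \<omega>))) k"
      proof -
        have "up / lo * (lo * V (fst \<omega>) (fst (snd \<omega>)) k) \<le> up / lo * T (case_nat (fst \<omega>) (fst (snd \<omega>))) k"
          using T_shift_bounds(1)[where \<xi> = "fst (snd \<omega>)" and k = k and x = "fst \<omega>", OF bspec[OF elim(1) k]] K by (rule mult_left_mono)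
        then show ?thesis using lo_pos by simp
      qed
      then have "sqrt up * sqrt (V (fst \<omega>) (fst (snd \<omega>)) k) \<le> sqrt (up / lo) * sqrt (T (case_nat (fst \<omega>) (fst (snd \<omega>))) k)"
        unfolding real_sqrt_mult[symmetric] by (rule real_sqrt_le_mono)
      then have "sqrt up * sqrt (V (fst \<omega>) (fst (snd \<omega>)) k) * cmod (snd (snd \<omega>) k) \<le> sqrt (up / lo) * sqrt (T (case_nat (fst \<omega>) (fst (snd \<omega>))) k) * cmod (snd (snd \<omega>) k)"
        by (rule mult_right_mono) simp
      then show ?thesis
        using k K up_ge V_pos[of "fst \<omega>" "fst (snd \<omega>)" k] T_pos[of "case_nat (fst \<omega>) (fst (snd \<omega>))" k]
        by (simp add: scale_block_def norm_mult mult.assoc)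
    qed
    then have "noise_density (scale_block (up / lo) (?W \<omega>)) \<le> noise_density (scale_block up (?Y \<omega>))"
      by (rule noise_density_antimono)
    then have "lo ^ n * noise_density (scale_block (up / lo) (?W \<omega>)) \<le> lo ^ n * noise_density (scale_block up (?Y \<omega>))"
      using lo_pos by (intro mult_left_mono) auto
    also have "\<dots> \<le> out_density (?Y \<omega>)" by (rule out_density_ge_noise[OF sp])
    finally have "ln (lo ^ n * noise_density (scale_block (up / lo) (?W \<omega>))) \<le> ln (out_density (?Y \<omega>))"
      using lo_pos noise_density_pos out_density_pos by (subst ln_le_cancel_iff) auto
    then show ?case
      using lo_pos noise_density_pos by (simp add: ln_mult_pos ln_realpow)
  qed
  have "(\<integral>\<omega>. real n * ln lo + ?g (?W \<omega>) \<partial>?M) \<le> (\<integral>\<omega>. ln (out_density (?Y \<omega>)) \<partial>?M)"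
    by (rule integral_mono_AE[OF _ iY ae]) (intro Bochner_Integration.integrable_add QSG.integrable_const iW)
  also have "(\<integral>\<omega>. real n * ln lo + ?g (?W \<omega>) \<partial>?M) = real n * ln lo + (\<integral>w. ?g w \<partial>noise_law)"
    by (subst Bochner_Integration.integral_add[OF QSG.integrable_const iW]) (simp add: eW QSG.prob_space)
  finally show ?thesis unfolding eY .
qed

text \<open>When the three comparisons are added, the means of \<open>ln g\<close> at
  \<open>W\<close> and at the scaled \<open>W\<close> cancel. Per symbol there remain
  \<open>- ln lo\<close> from the normalisations and \<open>4 * (up / lo - 1)\<close> from undoing
  the scaling.\<close>

lemma block_information_le:
  "block_information \<alpha> \<sigma>2 n Q \<le> ereal (real n * (4 * (up / lo - 1) - ln lo))"
proof -
  have "up / lo \<ge> 1" using up_ge lo_le lo_pos by simp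
  from integral_ln_noise_scale_ge[OF this] integral_ln_cond_le integral_ln_out_ge
  show ?thesis unfolding block_information_eq by (simp add: algebra_simps)
qed

end

theorem theorem1:
  fixes \<rho> \<sigma>2 :: real and \<alpha> :: "nat \<Rightarrow> real"
  assumes "0 < \<rho>" "\<rho> < 1"
    and "0 < \<sigma>2"
    and "\<And>l. 0 < \<alpha> l"
    and "\<And>l. \<alpha> (Suc l) \<le> \<alpha> l"
    and "\<And>l. \<rho> \<le> \<alpha> (Suc l) / \<alpha> l"
    and "interference_converges \<alpha> \<sigma>2"
  shows "(SUP snr\<in>{0<..}. capacity \<alpha> \<sigma>2 snr) < \<infinity>"
proof -
  \<comment> \<open>The per-symbol constant of \<open>block_information_le\<close> with
    \<open>up\<close> and \<open>lo\<close> expanded. It depends only on \<rho> and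
    \<open>\<alpha> 0\<close>, not on the block, the input law, the noise or the power.\<close>
  define C where "C = 4 * (max 1 (\<alpha> 0) / min \<rho> (\<alpha> 0) - 1) - ln (min \<rho> (\<alpha> 0))"
  have info: "block_information \<alpha> \<sigma>2 n Q \<le> ereal (real n * C)"
    if n: "n \<ge> 1" and P: "P > 0" and Q: "Q \<in> input_laws n P" for n P Q
  proof -
    have Q': "prob_space Q" "sets Q = sets (block_space n)"
      "(\<integral>\<^sup>+ x. ennreal (1 / real n * (\<Sum>k=1..n. (cmod (x k))\<^sup>2)) \<partial>Q) \<le> ennreal P"
      using Q by (auto simp: input_laws_def)
    interpret interference_decay \<alpha> \<sigma>2 n Q \<rho>
    proof (intro interference_decay.intro interference_block.intro interference_channel.intro
        interference_block_axioms.intro interference_decay_axioms.intro)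
      show "AE \<omega> in channel_space \<alpha> \<sigma>2 n Q. \<forall>k\<in>{1..n}. summable (interference_terms \<omega> k)"
        using assms(7)[unfolded interference_converges_def, THEN spec[of _ n], THEN spec[of _ P], THEN mp, OF P] Q by (rule bspec)
      show "summable \<alpha>" by (rule summable_interference_powers[OF assms(7,4,3)])
      show "\<rho> * \<alpha> l \<le> \<alpha> (Suc l)" for l
        using assms(6)[of l] assms(4)[of l] by (simp add: field_simps)
      fix k assume k: "k \<in> {1..n}"
      \<comment> \<open>One symbol has at most \<open>n\<close> times the average energy, so the
        power constraint makes each second moment finite.\<close>
      have "(cmod (x k))\<^sup>2 \<le> real n * (1 / real n * (\<Sum>k=1..n. (cmod (x k))\<^sup>2))" for x :: "nat \<Rightarrow> complex"
        using n member_le_sum[OF k, of "\<lambda>k. (cmod (x k))\<^sup>2"] by simp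
      then have "(\<integral>\<^sup>+ x. ennreal ((cmod (x k))\<^sup>2) \<partial>Q) \<le> (\<integral>\<^sup>+ x. ennreal (real n) * ennreal (1 / real n * (\<Sum>k=1..n. (cmod (x k))\<^sup>2)) \<partial>Q)"
        by (intro nn_integral_mono) (simp only: ennreal_mult'[symmetric] of_nat_0_le_iff ennreal_leI)
      also have "\<dots> = ennreal (real n) * (\<integral>\<^sup>+ x. ennreal (1 / real n * (\<Sum>k=1..n. (cmod (x k))\<^sup>2)) \<partial>Q)"
        by (rule nn_integral_cmult) (subst measurable_cong_sets[OF Q'(2) refl], measurable)
      also have "\<dots> \<le> ennreal (real n) * ennreal P"
        by (intro mult_left_mono Q') auto
      also have "\<dots> < \<infinity>" by (simp add: ennreal_mult_less_top)
      finally show "(\<integral>\<^sup>+ x. ennreal ((cmod (x k))\<^sup>2) \<partial>Q) < \<infinity>" .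
    qed (use assms Q' in auto)
    show ?thesis using block_information_le by (simp add: C_def up_def lo_def)
  qed
  have "capacity \<alpha> \<sigma>2 snr \<le> ereal C" if "snr > 0" for snr
    unfolding capacity_def
  proof (rule Limsup_bounded)
    \<comment> \<open>The limsup ignores block length 0; for \<open>n \<ge> 1\<close> the factor
      \<open>1 / real n\<close> cancels the linear growth.\<close>
    show "\<forall>\<^sub>F n in sequentially. ereal (1 / real n) * (SUP Q\<in>input_laws n (snr * \<sigma>2). block_information \<alpha> \<sigma>2 n Q) \<le> ereal C"
      using eventually_ge_at_top[of 1]
    proof eventually_elim
      case (elim n)
      have "(SUP Q\<in>input_laws n (snr * \<sigma>2). block_information \<alpha> \<sigma>2 n Q) \<le> ereal (real n * C)"
        using that assms(3) elim by (intro SUP_least info[of n "snr * \<sigma>2"]) auto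
      then have "ereal (1 / real n) * (SUP Q\<in>input_laws n (snr * \<sigma>2). block_information \<alpha> \<sigma>2 n Q) \<le> ereal (1 / real n) * ereal (real n * C)"
        by (rule ereal_mult_left_mono) simp
      also have "\<dots> = ereal C" using elim by simp
      finally show ?case .
    qed
  qed
  then have "(SUP snr\<in>{0<..}. capacity \<alpha> \<sigma>2 snr) \<le> ereal C"
    by (intro SUP_least) auto
  then show ?thesis by (rule le_less_trans) simp
qed

end
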